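(* Let $\mathcal{C} = \mathrm{Cat}$ be the category of small categories and functors, equipped with the comprehensive factorisation system (initial functors, discrete opfibrations) and the discrete category comonad, and let $(R,\eta,\mu)$ be the monad on $\mathrm{Cat}^{\mathbf{2}}$ constructed from these in the context. Then there is an isomorphism of categories $\mathrm{Lens} \cong \mathrm{Alg}(R, \eta, \mu)$ between the category of delta lenses and the category of algebras for the monad $(R,\eta,\mu)$.
   Context: Delta lens: a delta lens $(f,\varphi) \colon A \to B$ is a functor $f \colon A \to B$ with a lifting operation assigning to each object $a \in A$ and each morphism $u \colon fa \to b$ in $B$ a morphism $\varphi(a,u) \colon a \to p(a,u)$ in $A$, where $p(a,u) = \mathrm{cod}(\varphi(a,u))$, such that (L1) $f\varphi(a,u) = u$; (L2) $\varphi(a,1_{fa}) = 1_a$; (L3) $\varphi(a, v\circ u) = \varphi(p(a,u), v) \circ \varphi(a,u)$. $\mathrm{Lens}$ is the category whose objects are delta lenses and whose morphisms $\langle h,k\rangle \colon (f,\varphi) \to (g,\psi)$ are pairs of functors with $k\circ f = g \circ h$ and $h\varphi(a,u) = \psi(ha,ku)$ for all $(a,u)$. $\mathrm{Cat}^{\mathbf{2}}$ is the arrow category: objects are functors; a morphism $\langle h, k\rangle \colon f \to g$, for $f \colon A \to B$ and $g \colon C \to D$, is a pair of functors $h \colon A \to C$, $k \colon B \to D$ with $k \circ f = g \circ h$. Structure on $\mathrm{Cat}$: a functor $f \colon A \to B$ is initial if for each $b \in B$ the comma category $f/b$ is connected (in particular nonempty); it is a discrete opfibration if for each $a \in A$ and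 $u \colon fa \to b$ in $B$ there is a unique morphism of $A$ with domain $a$ sent by $f$ to $u$. These form an orthogonal factorisation system $(\mathcal{E},\mathcal{M})$ with $\mathcal{E}$ the initial functors and $\mathcal{M}$ the discrete opfibrations. The discrete category comonad $M = (-)_0$ sends $A$ to the discrete category $A_0$ on its objects, with counit the inclusion $\iota_A \colon A_0 \to A$; it is idempotent and preserves colimits. Pushouts in $\mathrm{Cat}$ are chosen. Construction of the monad. For $f \colon A \to B$, factor $f \circ \iota_A = Tf \circ Sf$ with $Sf \colon A_0 \to Jf$ initial and $Tf \colon Jf \to B$ a discrete opfibration; concretely $Jf = \sum_{a \in A_0} fa/B$ has objects pairs $(a, u \colon fa \to b)$ and morphisms $\langle 1_a, v\rangle \colon (a,u_1) \to (a,u_2)$ given by $v \in B$ with $v \circ u_1 = u_2$, with $Sf(a) = (a,1_{fa})$ and $Tf$ the codomain projection $(a,u) \mapsto \mathrm{cod}(u)$. For $\langle h,k \rangle \colon f \to g$, $J\langle h,k\rangle \colon Jf \to Jg$ is the unique functor with $J\langle h,k\rangle \circ Sf = Sg \circ h_0$ and $Tg \circ J\langle h,k\rangle = k \circ Tf$. Let $\nu_f \colon JTf \to Jf$ be the unique functor with $\nu_f \circ STf = \iota_{Jf}$ and $Tf \circ \nu_f = T^2 f$. Let $Ef$ be the pushout of $\iota_A \colon A_0 \to A$ and $Sf \colon A_0 \to Jf$, with injections $Lf \colon A \to Ef$ and $\alpha_f \colon Jf \to Ef$, and let $Rf \colon Ef \to B$ be the unique functor with $Rf \circ Lf = f$ and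 $Rf \circ \alpha_f = Tf$. For $\langle h,k\rangle \colon f \to g$, $E\langle h,k\rangle \colon Ef \to Eg$ is the unique functor with $E\langle h,k\rangle \circ Lf = Lg \circ h$ and $E\langle h,k\rangle \circ \alpha_f = \alpha_g \circ J\langle h,k\rangle$, and $R\langle h,k\rangle = \langle E\langle h,k\rangle, k\rangle$. The unit has components $\eta_f = \langle Lf, 1_B\rangle \colon f \to Rf$. Since $(\alpha_f)_0$ is invertible, so is $J\langle \alpha_f, 1_B\rangle \colon JTf \to JRf$. Let $\mu_f \colon ERf \to Ef$ be the unique functor with $\mu_f \circ LRf = 1_{Ef}$ and $\mu_f \circ \alpha_{Rf} = \alpha_f \circ \nu_f \circ J\langle \alpha_f, 1_B\rangle^{-1}$; the component of $\mu \colon R^2 \Rightarrow R$ at $f$ is $\langle \mu_f, 1_B\rangle$. The triple $(R,\eta,\mu)$ is a monad on $\mathrm{Cat}^{\mathbf{2}}$. $\mathrm{Alg}(R,\eta,\mu)$ is its category of (Eilenberg–Moore) algebras. Explicitly, an algebra is a pair $(f \colon A \to B, \hat p \colon Ef \to A)$ with $\hat p \circ Lf = 1_A$, $f \circ \hat p = Rf$ and $\hat p \circ \mu_f = \hat p \circ E\langle \hat p, 1_B\rangle$; a morphism $(f,\hat p) \to (g, \hat q)$ is a morphism $\langle h,k\rangle \colon f \to g$ of $\mathrm{Cat}^{\mathbf{2}}$ with $h \circ \hat p = \hat q \circ E\langle h,k\rangle$. *)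

theory Defs
  imports "HOL-Library.FuncSet" "HOL-Library.Infinite_Typeclass"
    "HOL.BNF_Cardinal_Arithmetic"
begin

section \<open>Categories and functors\<close>

record ('o, 'm) cat =
  Obj :: "'o set"
  Arr :: "'m set"
  Dom :: "'m \<Rightarrow> 'o"
  Cod :: "'m \<Rightarrow> 'o"
  Ident :: "'o \<Rightarrow> 'm"
  Comp :: "'m \<Rightarrow> 'm \<Rightarrow> 'm"  \<comment> \<open>\<open>Comp C g f\<close> is \<open>g\<close> after \<open>f\<close>\<close>

definition in_hom :: "('o, 'm) cat \<Rightarrow> 'm \<Rightarrow> 'o \<Rightarrow> 'o \<Rightarrow> bool" where
  "in_hom C f x y \<longleftrightarrow> f \<in> Arr C \<and> Dom C f = x \<and> Cod C f = y"

definition composable :: "('o, 'm) cat \<Rightarrow> 'm \<Rightarrow> 'm \<Rightarrow> bool" where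
  "composable C g f \<longleftrightarrow> g \<in> Arr C \<and> f \<in> Arr C \<and> Dom C g = Cod C f"

definition category :: "('o, 'm) cat \<Rightarrow> bool" where
  "category C \<longleftrightarrow>
     (\<forall>f\<in>Arr C. Dom C f \<in> Obj C \<and> Cod C f \<in> Obj C) \<and>
     (\<forall>x\<in>Obj C. in_hom C (Ident C x) x x) \<and>
     (\<forall>f g. composable C g f \<longrightarrow> in_hom C (Comp C g f) (Dom C f) (Cod C g)) \<and>
     (\<forall>f\<in>Arr C. Comp C f (Ident C (Dom C f)) = f \<and> Comp C (Ident C (Cod C f)) f = f) \<and>
     (\<forall>f g h. composable C h g \<and> composable C g f \<longrightarrow>
        Comp C h (Comp C g f) = Comp C (Comp C h g) f)"

text \<open>The structure maps of a category are total functions in HOL.  Requiring them to be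
  \<open>undefined\<close> outside their domains makes equality of records coincide with equality of
  categories.\<close>

definition ext_category :: "('o, 'm) cat \<Rightarrow> bool" where
  "ext_category C \<longleftrightarrow> category C \<and>
     Dom C \<in> extensional (Arr C) \<and> Cod C \<in> extensional (Arr C) \<and>
     Ident C \<in> extensional (Obj C) \<and>
     (\<forall>f g. \<not> composable C g f \<longrightarrow> Comp C g f = undefined)"

record ('o, 'm, 'p, 'n) funct =
  Src :: "('o, 'm) cat"
  Tgt :: "('p, 'n) cat"
  OMap :: "'o \<Rightarrow> 'p"
  AMap :: "'m \<Rightarrow> 'n"

definition is_functor :: "('o, 'm, 'p, 'n) funct \<Rightarrow> bool" where
  "is_functor F \<longleftrightarrow> category (Src F) \<and> category (Tgt F) \<and>
     OMap F \<in> Obj (Src F) \<rightarrow>\<^sub>E Obj (Tgt F) \<and>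
     AMap F \<in> Arr (Src F) \<rightarrow>\<^sub>E Arr (Tgt F) \<and>
     (\<forall>f\<in>Arr (Src F). Dom (Tgt F) (AMap F f) = OMap F (Dom (Src F) f) \<and>
        Cod (Tgt F) (AMap F f) = OMap F (Cod (Src F) f)) \<and>
     (\<forall>x\<in>Obj (Src F). AMap F (Ident (Src F) x) = Ident (Tgt F) (OMap F x)) \<and>
     (\<forall>f g. composable (Src F) g f \<longrightarrow>
        AMap F (Comp (Src F) g f) = Comp (Tgt F) (AMap F g) (AMap F f))"

definition idf :: "('o, 'm) cat \<Rightarrow> ('o, 'm, 'o, 'm) funct" where
  "idf C = \<lparr>Src = C, Tgt = C, OMap = (\<lambda>x\<in>Obj C. x), AMap = (\<lambda>f\<in>Arr C. f)\<rparr>"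

definition fcomp :: "('p, 'n, 'q, 'r) funct \<Rightarrow> ('o, 'm, 'p, 'n) funct \<Rightarrow> ('o, 'm, 'q, 'r) funct"
    (infixr "\<odot>" 70) where
  "G \<odot> F = \<lparr>Src = Src F, Tgt = Tgt G,
     OMap = (\<lambda>x\<in>Obj (Src F). OMap G (OMap F x)),
     AMap = (\<lambda>f\<in>Arr (Src F). AMap G (AMap F f))\<rparr>"

definition isomorphic_categories :: "('o, 'm) cat \<Rightarrow> ('p, 'n) cat \<Rightarrow> bool" where
  "isomorphic_categories C D \<longleftrightarrow>
     (\<exists>F G. is_functor F \<and> Src F = C \<and> Tgt F = D \<and>
            is_functor G \<and> Src G = D \<and> Tgt G = C \<and>
            G \<odot> F = idf C \<and> F \<odot> G = idf D)"

definition is_inverse :: "('o, 'm) cat \<Rightarrow> 'm \<Rightarrow> 'm \<Rightarrow> bool" where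
  "is_inverse C f g \<longleftrightarrow> in_hom C g (Cod C f) (Dom C f) \<and>
     Comp C g f = Ident C (Dom C f) \<and> Comp C f g = Ident C (Cod C f)"

definition inverse_arrow :: "('o, 'm) cat \<Rightarrow> 'm \<Rightarrow> 'm" where
  "inverse_arrow C f = (THE g. is_inverse C f g)"

definition is_pushout :: "('o, 'm) cat \<Rightarrow> 'm \<Rightarrow> 'm \<Rightarrow> 'm \<Rightarrow> 'm \<Rightarrow> bool" where
  "is_pushout C f g i j \<longleftrightarrow>
     composable C i f \<and> composable C j g \<and> Cod C i = Cod C j \<and> Comp C i f = Comp C j g \<and>
     (\<forall>p q. composable C p f \<and> composable C q g \<and> Cod C p = Cod C q \<and>
        Comp C p f = Comp C q g \<longrightarrow>
        (\<exists>!m. in_hom C m (Cod C i) (Cod C p) \<and> Comp C m i = p \<and> Comp C m j = q))"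

definition pushout_choice :: "('o, 'm) cat \<Rightarrow> ('m \<Rightarrow> 'm \<Rightarrow> 'm \<times> 'm) \<Rightarrow> bool" where
  "pushout_choice C po \<longleftrightarrow>
     (\<forall>f\<in>Arr C. \<forall>g\<in>Arr C. Dom C f = Dom C g \<longrightarrow> is_pushout C f g (fst (po f g)) (snd (po f g)))"

text \<open>Arrows carrying their domain and codomain explicitly, for categories of structured
  objects.\<close>

record ('x, 'h) struct_arrow =
  Sdom :: 'x
  Scod :: 'x
  Smap :: 'h

definition arrow_category :: "('o, 'm) cat \<Rightarrow> ('m, ('m, 'm \<times> 'm) struct_arrow) cat" where
  "arrow_category C = \<lparr>
     Obj = Arr C,
     Arr = {s. \<exists>f g h k. s = \<lparr>Sdom = f, Scod = g, Smap = (h, k)\<rparr> \<and>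
        f \<in> Arr C \<and> g \<in> Arr C \<and>
        in_hom C h (Dom C f) (Dom C g) \<and> in_hom C k (Cod C f) (Cod C g) \<and>
        Comp C k f = Comp C g h},
     Dom = Sdom, Cod = Scod,
     Ident = (\<lambda>f. \<lparr>Sdom = f, Scod = f, Smap = (Ident C (Dom C f), Ident C (Cod C f))\<rparr>),
     Comp = (\<lambda>t s. \<lparr>Sdom = Sdom s, Scod = Scod t,
        Smap = (Comp C (fst (Smap t)) (fst (Smap s)), Comp C (snd (Smap t)) (snd (Smap s)))\<rparr>)\<rparr>"

text \<open>The Eilenberg-Moore category of a monad \<open>(T, \<eta>, \<mu>)\<close> on \<open>C\<close>.\<close>

definition is_algebra ::
  "('o, 'm) cat \<Rightarrow> ('o, 'm, 'o, 'm) funct \<Rightarrow> ('o \<Rightarrow> 'm) \<Rightarrow> ('o \<Rightarrow> 'm) \<Rightarrow> 'o \<times> 'm \<Rightarrow> bool" where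
  "is_algebra C T \<eta> \<mu> = (\<lambda>(x, a). x \<in> Obj C \<and> in_hom C a (OMap T x) x \<and>
     Comp C a (\<eta> x) = Ident C x \<and> Comp C a (\<mu> x) = Comp C a (AMap T a))"

definition algebra_category ::
  "('o, 'm) cat \<Rightarrow> ('o, 'm, 'o, 'm) funct \<Rightarrow> ('o \<Rightarrow> 'm) \<Rightarrow> ('o \<Rightarrow> 'm) \<Rightarrow>
   ('o \<times> 'm, ('o \<times> 'm, 'm) struct_arrow) cat" where
  "algebra_category C T \<eta> \<mu> = \<lparr>
     Obj = {X. is_algebra C T \<eta> \<mu> X},
     Arr = {s. \<exists>x a y b h. s = \<lparr>Sdom = (x, a), Scod = (y, b), Smap = h\<rparr> \<and>
        is_algebra C T \<eta> \<mu> (x, a) \<and> is_algebra C T \<eta> \<mu> (y, b) \<and>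
        in_hom C h x y \<and> Comp C h a = Comp C b (AMap T h)},
     Dom = Sdom, Cod = Scod,
     Ident = (\<lambda>X. \<lparr>Sdom = X, Scod = X, Smap = Ident C (fst X)\<rparr>),
     Comp = (\<lambda>t s. \<lparr>Sdom = Sdom s, Scod = Scod t, Smap = Comp C (Smap t) (Smap s)\<rparr>)\<rparr>"


section \<open>The category of small categories\<close>

text \<open>Small categories are those whose objects and arrows are elements of a type \<open>'u\<close> that
  serves as universe of small elements.  For infinite \<open>'u\<close> it is closed under the constructions
  below: it has a pairing function, and the resulting category has pushouts.\<close>

type_synonym 'u small_cat = "('u, 'u) cat"
type_synonym 'u small_funct = "('u, 'u, 'u, 'u) funct"
type_synonym 'u square = "('u small_funct, 'u small_funct \<times> 'u small_funct) struct_arrow"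

definition CAT :: "('u small_cat, 'u small_funct) cat" where
  "CAT = \<lparr>
     Obj = {C. ext_category C},
     Arr = {F. is_functor F \<and> ext_category (Src F) \<and> ext_category (Tgt F)},
     Dom = Src, Cod = Tgt, Ident = idf, Comp = fcomp\<rparr>"

abbreviation CAT2 :: "('u small_funct, 'u square) cat" where
  "CAT2 \<equiv> arrow_category CAT"

definition enc :: "'u \<times> 'u \<Rightarrow> 'u" where
  "enc = (SOME e. inj e)"

definition dec :: "'u \<Rightarrow> 'u \<times> 'u" where
  "dec = inv enc"

text \<open>The comma category \<open>F/b\<close>; an arrow \<open>(a, u) \<rightarrow> (a', u')\<close> is an arrow \<open>m : a \<rightarrow> a'\<close> with
  \<open>u' \<circ> F m = u\<close>.\<close>

definition comma :: "('o, 'm, 'p, 'n) funct \<Rightarrow> 'p \<Rightarrow> ('o \<times> 'n, ('o \<times> 'n, 'm) struct_arrow) cat" where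
  "comma F b = \<lparr>
     Obj = {(a, u). a \<in> Obj (Src F) \<and> in_hom (Tgt F) u (OMap F a) b},
     Arr = {s. \<exists>a u a' u' m. s = \<lparr>Sdom = (a, u), Scod = (a', u'), Smap = m\<rparr> \<and>
        a \<in> Obj (Src F) \<and> in_hom (Tgt F) u (OMap F a) b \<and>
        a' \<in> Obj (Src F) \<and> in_hom (Tgt F) u' (OMap F a') b \<and>
        in_hom (Src F) m a a' \<and> Comp (Tgt F) u' (AMap F m) = u},
     Dom = Sdom, Cod = Scod,
     Ident = (\<lambda>X. \<lparr>Sdom = X, Scod = X, Smap = Ident (Src F) (fst X)\<rparr>),
     Comp = (\<lambda>t s. \<lparr>Sdom = Sdom s, Scod = Scod t, Smap = Comp (Src F) (Smap t) (Smap s)\<rparr>)\<rparr>"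

definition connected_category :: "('o, 'm) cat \<Rightarrow> bool" where
  "connected_category C \<longleftrightarrow> Obj C \<noteq> {} \<and>
     (\<forall>x\<in>Obj C. \<forall>y\<in>Obj C.
        (x, y) \<in> (\<Union>f\<in>Arr C. {(Dom C f, Cod C f), (Cod C f, Dom C f)})\<^sup>*)"

definition initial_functor :: "('o, 'm, 'p, 'n) funct \<Rightarrow> bool" where
  "initial_functor F \<longleftrightarrow> is_functor F \<and> (\<forall>b\<in>Obj (Tgt F). connected_category (comma F b))"

definition discrete_opfibration :: "('o, 'm, 'p, 'n) funct \<Rightarrow> bool" where
  "discrete_opfibration F \<longleftrightarrow> is_functor F \<and>
     (\<forall>a\<in>Obj (Src F). \<forall>u\<in>Arr (Tgt F). Dom (Tgt F) u = OMap F a \<longrightarrow>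
        (\<exists>!m. m \<in> Arr (Src F) \<and> Dom (Src F) m = a \<and> AMap F m = u))"

text \<open>\<open>discr A\<close> is the discrete category \<open>A\<^sub>0\<close>, realised as the subcategory of identity arrows.\<close>

definition discr :: "('o, 'm) cat \<Rightarrow> ('o, 'm) cat" where
  "discr A = \<lparr>
     Obj = Obj A, Arr = Ident A ` Obj A,
     Dom = restrict (Dom A) (Ident A ` Obj A), Cod = restrict (Cod A) (Ident A ` Obj A),
     Ident = Ident A,
     Comp = (\<lambda>g f. if f \<in> Ident A ` Obj A \<and> g = f then f else undefined)\<rparr>"

definition iota :: "('o, 'm) cat \<Rightarrow> ('o, 'm, 'o, 'm) funct" where
  "iota A = \<lparr>Src = discr A, Tgt = A,
     OMap = (\<lambda>x\<in>Obj A. x), AMap = (\<lambda>f\<in>Ident A ` Obj A. f)\<rparr>"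

definition discr_map :: "('o, 'm, 'p, 'n) funct \<Rightarrow> ('o, 'm, 'p, 'n) funct" where
  "discr_map h = \<lparr>Src = discr (Src h), Tgt = discr (Tgt h),
     OMap = OMap h, AMap = restrict (AMap h) (Ident (Src h) ` Obj (Src h))\<rparr>"


section \<open>The monad\<close>

text \<open>The category \<open>J f\<close>, the coproduct over all objects \<open>a\<close> of \<open>A\<close> of the coslices \<open>fa/B\<close>.
  The object \<open>(a, u)\<close> is encoded as \<open>enc (a, u)\<close>, and the arrow out of it given by \<open>v\<close> as
  \<open>enc (enc (a, u), v)\<close>.\<close>

definition J_cat :: "'u small_funct \<Rightarrow> 'u small_cat" where
  "J_cat f = (let
     B = Tgt f;
     O' = {enc (a, u) | a u. a \<in> Obj (Src f) \<and> u \<in> Arr B \<and> Dom B u = OMap f a};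
     A' = {enc (enc (a, u), v) | a u v.
        a \<in> Obj (Src f) \<and> u \<in> Arr B \<and> Dom B u = OMap f a \<and> v \<in> Arr B \<and> Dom B v = Cod B u};
     d = (\<lambda>m. fst (dec m));
     c = (\<lambda>m. case dec m of (x, v) \<Rightarrow> case dec x of (a, u) \<Rightarrow> enc (a, Comp B v u))
   in \<lparr>
     Obj = O', Arr = A', Dom = restrict d A', Cod = restrict c A',
     Ident = (\<lambda>x\<in>O'. enc (x, Ident B (Cod B (snd (dec x))))),
     Comp = (\<lambda>n m. if n \<in> A' \<and> m \<in> A' \<and> d n = c m
        then enc (d m, Comp B (snd (dec n)) (snd (dec m))) else undefined)\<rparr>)"

definition S_fun :: "'u small_funct \<Rightarrow> 'u small_funct" where
  "S_fun f = (let s = (\<lambda>a. enc (a, Ident (Tgt f) (OMap f a))) in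
     \<lparr>Src = discr (Src f), Tgt = J_cat f,
      OMap = (\<lambda>a\<in>Obj (Src f). s a),
      AMap = (\<lambda>m\<in>Ident (Src f) ` Obj (Src f). Ident (J_cat f) (s (Dom (Src f) m)))\<rparr>)"

definition T_fun :: "'u small_funct \<Rightarrow> 'u small_funct" where
  "T_fun f = \<lparr>Src = J_cat f, Tgt = Tgt f,
     OMap = (\<lambda>x\<in>Obj (J_cat f). Cod (Tgt f) (snd (dec x))),
     AMap = (\<lambda>m\<in>Arr (J_cat f). snd (dec m))\<rparr>"

abbreviation sq_top :: "'u square \<Rightarrow> 'u small_funct" where "sq_top s \<equiv> fst (Smap s)"
abbreviation sq_bot :: "'u square \<Rightarrow> 'u small_funct" where "sq_bot s \<equiv> snd (Smap s)"

definition J_map :: "'u square \<Rightarrow> 'u small_funct" where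
  "J_map s = (THE j. in_hom CAT j (J_cat (Sdom s)) (J_cat (Scod s)) \<and>
     j \<odot> S_fun (Sdom s) = S_fun (Scod s) \<odot> discr_map (sq_top s) \<and>
     T_fun (Scod s) \<odot> j = sq_bot s \<odot> T_fun (Sdom s))"

definition nu_fun :: "'u small_funct \<Rightarrow> 'u small_funct" where
  "nu_fun f = (THE n. in_hom CAT n (J_cat (T_fun f)) (J_cat f) \<and>
     n \<odot> S_fun (T_fun f) = iota (J_cat f) \<and> T_fun f \<odot> n = T_fun (T_fun f))"

text \<open>In what follows \<open>po\<close> is a choice of pushouts in \<open>CAT\<close>.\<close>

type_synonym 'u po = "'u small_funct \<Rightarrow> 'u small_funct \<Rightarrow> 'u small_funct \<times> 'u small_funct"

definition L_fun :: "'u po \<Rightarrow> 'u small_funct \<Rightarrow> 'u small_funct" where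
  "L_fun po f = fst (po (iota (Src f)) (S_fun f))"

definition alpha_fun :: "'u po \<Rightarrow> 'u small_funct \<Rightarrow> 'u small_funct" where
  "alpha_fun po f = snd (po (iota (Src f)) (S_fun f))"

definition E_cat :: "'u po \<Rightarrow> 'u small_funct \<Rightarrow> 'u small_cat" where
  "E_cat po f = Tgt (L_fun po f)"

definition R_fun :: "'u po \<Rightarrow> 'u small_funct \<Rightarrow> 'u small_funct" where
  "R_fun po f = (THE r. in_hom CAT r (E_cat po f) (Tgt f) \<and>
     r \<odot> L_fun po f = f \<and> r \<odot> alpha_fun po f = T_fun f)"

definition E_map :: "'u po \<Rightarrow> 'u square \<Rightarrow> 'u small_funct" where
  "E_map po s = (THE e. in_hom CAT e (E_cat po (Sdom s)) (E_cat po (Scod s)) \<and>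
     e \<odot> L_fun po (Sdom s) = L_fun po (Scod s) \<odot> sq_top s \<and>
     e \<odot> alpha_fun po (Sdom s) = alpha_fun po (Scod s) \<odot> J_map s)"

definition R_functor :: "'u po \<Rightarrow> ('u small_funct, 'u square, 'u small_funct, 'u square) funct" where
  "R_functor po = \<lparr>Src = CAT2, Tgt = CAT2,
     OMap = (\<lambda>f\<in>Obj CAT2. R_fun po f),
     AMap = (\<lambda>s\<in>Arr CAT2. \<lparr>Sdom = R_fun po (Sdom s), Scod = R_fun po (Scod s),
        Smap = (E_map po s, sq_bot s)\<rparr>)\<rparr>"

definition eta_sq :: "'u po \<Rightarrow> 'u small_funct \<Rightarrow> 'u square" where
  "eta_sq po f = \<lparr>Sdom = f, Scod = R_fun po f, Smap = (L_fun po f, idf (Tgt f))\<rparr>"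

definition mu_fun :: "'u po \<Rightarrow> 'u small_funct \<Rightarrow> 'u small_funct" where
  "mu_fun po f = (THE m. in_hom CAT m (E_cat po (R_fun po f)) (E_cat po f) \<and>
     m \<odot> L_fun po (R_fun po f) = idf (E_cat po f) \<and>
     m \<odot> alpha_fun po (R_fun po f) = alpha_fun po f \<odot> nu_fun f \<odot>
       inverse_arrow CAT
         (J_map \<lparr>Sdom = T_fun f, Scod = R_fun po f, Smap = (alpha_fun po f, idf (Tgt f))\<rparr>))"

definition mu_sq :: "'u po \<Rightarrow> 'u small_funct \<Rightarrow> 'u square" where
  "mu_sq po f = \<lparr>Sdom = R_fun po (R_fun po f), Scod = R_fun po f, Smap = (mu_fun po f, idf (Tgt f))\<rparr>"

definition Alg :: "'u po \<Rightarrow>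
    ('u small_funct \<times> 'u square, ('u small_funct \<times> 'u square, 'u square) struct_arrow) cat" where
  "Alg po = algebra_category CAT2 (R_functor po) (eta_sq po) (mu_sq po)"


section \<open>Delta lenses\<close>

text \<open>A lens \<open>(f, \<phi>)\<close>, where \<open>\<phi> a u\<close> is \<open>undefined\<close> unless \<open>u\<close> is an arrow out of \<open>f a\<close>.\<close>

type_synonym 'u lens = "'u small_funct \<times> ('u \<Rightarrow> 'u \<Rightarrow> 'u)"

definition liftable :: "'u small_funct \<Rightarrow> 'u \<Rightarrow> 'u \<Rightarrow> bool" where
  "liftable f a u \<longleftrightarrow> a \<in> Obj (Src f) \<and> u \<in> Arr (Tgt f) \<and> Dom (Tgt f) u = OMap f a"

definition is_lens :: "'u lens \<Rightarrow> bool" where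
  "is_lens = (\<lambda>(f, \<phi>). f \<in> Arr CAT \<and>
     (\<forall>a u. liftable f a u \<longrightarrow>
        \<phi> a u \<in> Arr (Src f) \<and> Dom (Src f) (\<phi> a u) = a \<and> AMap f (\<phi> a u) = u) \<and>
     (\<forall>a\<in>Obj (Src f). \<phi> a (Ident (Tgt f) (OMap f a)) = Ident (Src f) a) \<and>
     (\<forall>a u v. liftable f a u \<and> composable (Tgt f) v u \<longrightarrow>
        \<phi> a (Comp (Tgt f) v u) = Comp (Src f) (\<phi> (Cod (Src f) (\<phi> a u)) v) (\<phi> a u)) \<and>
     (\<forall>a u. \<not> liftable f a u \<longrightarrow> \<phi> a u = undefined))"

definition Lens ::
  "('u lens, ('u lens, 'u small_funct \<times> 'u small_funct) struct_arrow) cat" where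
  "Lens = \<lparr>
     Obj = {X. is_lens X},
     Arr = {s. \<exists>f \<phi> g \<psi> h k. s = \<lparr>Sdom = (f, \<phi>), Scod = (g, \<psi>), Smap = (h, k)\<rparr> \<and>
        is_lens (f, \<phi>) \<and> is_lens (g, \<psi>) \<and>
        in_hom CAT h (Src f) (Src g) \<and> in_hom CAT k (Tgt f) (Tgt g) \<and> k \<odot> f = g \<odot> h \<and>
        (\<forall>a u. liftable f a u \<longrightarrow> AMap h (\<phi> a u) = \<psi> (OMap h a) (AMap k u))},
     Dom = Sdom, Cod = Scod,
     Ident = (\<lambda>X. \<lparr>Sdom = X, Scod = X, Smap = (idf (Src (fst X)), idf (Tgt (fst X)))\<rparr>),
     Comp = (\<lambda>t s. \<lparr>Sdom = Sdom s, Scod = Scod t,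
        Smap = (fst (Smap t) \<odot> fst (Smap s), snd (Smap t) \<odot> snd (Smap s))\<rparr>)\<rparr>"

section \<open>The comprehensive factorisation of \<open>f \<circ> \<iota>\<close>\<close>

lemma inj_enc:
  includes cardinal_syntax
  shows "inj (enc :: 'u::infinite \<times> 'u \<Rightarrow> 'u)"
proof -
  have "|UNIV \<times> UNIV :: ('u \<times> 'u) set| =o |UNIV :: 'u set|"
    by (rule card_of_Times_same_infinite) (rule infinite_UNIV)
  then have "|UNIV :: ('u \<times> 'u) set| \<le>o |UNIV :: 'u set|"
    by (simp add: ordIso_imp_ordLeq)
  then have "\<exists>e :: 'u \<times> 'u \<Rightarrow> 'u. inj e"
    using card_of_ordLeq[of "UNIV :: ('u \<times> 'u) set" "UNIV :: 'u set"] by auto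
  then show ?thesis
    unfolding enc_def by (rule someI_ex)
qed

lemma dec_enc [simp]: "dec (enc p) = (p :: 'u::infinite \<times> 'u)"
  by (simp add: dec_def inj_enc)

lemma enc_eq_iff [simp]: "enc p = enc q \<longleftrightarrow> p = (q :: 'u::infinite \<times> 'u)"
  by (metis dec_enc)

lemma ext_categoryD: "ext_category C \<Longrightarrow> category C"
  by (simp add: ext_category_def)

lemma Arr_CAT_iff: "F \<in> Arr CAT \<longleftrightarrow> is_functor F \<and> ext_category (Src F) \<and> ext_category (Tgt F)"
  by (simp add: CAT_def)

lemma categoryI:
  assumes "\<And>f. f \<in> Arr C \<Longrightarrow> Dom C f \<in> Obj C" "\<And>f. f \<in> Arr C \<Longrightarrow> Cod C f \<in> Obj C"
    and "\<And>x. x \<in> Obj C \<Longrightarrow> in_hom C (Ident C x) x x"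
    and "\<And>f g. composable C g f \<Longrightarrow> in_hom C (Comp C g f) (Dom C f) (Cod C g)"
    and "\<And>f. f \<in> Arr C \<Longrightarrow> Comp C f (Ident C (Dom C f)) = f"
    and "\<And>f. f \<in> Arr C \<Longrightarrow> Comp C (Ident C (Cod C f)) f = f"
    and "\<And>f g h. composable C h g \<Longrightarrow> composable C g f \<Longrightarrow>
           Comp C h (Comp C g f) = Comp C (Comp C h g) f"
  shows "category C"
  unfolding category_def using assms by blast

lemma
  assumes "category C"
  shows Dom_in: "f \<in> Arr C \<Longrightarrow> Dom C f \<in> Obj C"
    and Cod_in: "f \<in> Arr C \<Longrightarrow> Cod C f \<in> Obj C"
    and Ident_in: "x \<in> Obj C \<Longrightarrow> Ident C x \<in> Arr C"
    and Dom_Ident: "x \<in> Obj C \<Longrightarrow> Dom C (Ident C x) = x"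
    and Cod_Ident: "x \<in> Obj C \<Longrightarrow> Cod C (Ident C x) = x"
    and Comp_in: "composable C g f \<Longrightarrow> Comp C g f \<in> Arr C"
    and Dom_Comp: "composable C g f \<Longrightarrow> Dom C (Comp C g f) = Dom C f"
    and Cod_Comp: "composable C g f \<Longrightarrow> Cod C (Comp C g f) = Cod C g"
    and Comp_Ident: "f \<in> Arr C \<Longrightarrow> Comp C f (Ident C (Dom C f)) = f"
    and Ident_Comp: "f \<in> Arr C \<Longrightarrow> Comp C (Ident C (Cod C f)) f = f"
    and Comp_assoc: "composable C h g \<Longrightarrow> composable C g f \<Longrightarrow>
           Comp C h (Comp C g f) = Comp C (Comp C h g) f"
  using assms unfolding category_def in_hom_def by blast+

lemmas category_simps = Dom_in Cod_in Ident_in Dom_Ident Cod_Ident Comp_in Dom_Comp Cod_Comp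
  Comp_Ident Ident_Comp

lemma ext_category_discr:
  assumes "ext_category A" shows "ext_category (discr A)"
proof -
  have A: "category A" and e: "Ident A \<in> extensional (Obj A)"
    using assms by (auto simp: ext_category_def)
  have c: "composable (discr A) g f \<longleftrightarrow> f \<in> Ident A ` Obj A \<and> g = f" for f g
    using A by (auto simp: composable_def discr_def category_simps)
  have "category (discr A)"
    by (rule categoryI, unfold c)
      (use A in \<open>auto simp: discr_def in_hom_def category_simps\<close>)
  then show ?thesis
    using e by (auto simp: ext_category_def c) (auto simp: discr_def)
qed

lemma Obj_J: "Obj (J_cat f) = {enc (a, u) | a u. liftable f a u}"
  by (simp add: J_cat_def Let_def liftable_def)

lemma Arr_J: "Arr (J_cat f) =
    {enc (enc (a, u), v) | a u v. liftable f a u \<and> composable (Tgt f) v u}"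
  unfolding J_cat_def Let_def liftable_def composable_def by auto

lemma Dom_J:
  "liftable f a u \<Longrightarrow> composable (Tgt f) v u \<Longrightarrow>
     Dom (J_cat f) (enc (enc (a, u), v)) = (enc (a, u) :: 'u::infinite)"
  by (fastforce simp: J_cat_def Let_def liftable_def composable_def)

lemma Cod_J:
  "liftable f a u \<Longrightarrow> composable (Tgt f) v u \<Longrightarrow>
     Cod (J_cat f) (enc (enc (a, u), v)) = (enc (a, Comp (Tgt f) v u) :: 'u::infinite)"
  by (fastforce simp: J_cat_def Let_def liftable_def composable_def)

lemma Ident_J:
  "liftable f a u \<Longrightarrow>
     Ident (J_cat f) (enc (a, u)) = (enc (enc (a, u), Ident (Tgt f) (Cod (Tgt f) u)) :: 'u::infinite)"
  by (auto simp: J_cat_def Let_def liftable_def composable_def)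

lemma Comp_J:
  "liftable f a u \<Longrightarrow> composable (Tgt f) v u \<Longrightarrow> composable (Tgt f) w (Comp (Tgt f) v u) \<Longrightarrow>
     liftable f a (Comp (Tgt f) v u) \<Longrightarrow>
     Comp (J_cat f) (enc (enc (a, Comp (Tgt f) v u), w)) (enc (enc (a, u), v)) =
       (enc (enc (a, u), Comp (Tgt f) w v) :: 'u::infinite)"
  by (fastforce simp: J_cat_def Let_def liftable_def composable_def)

lemma composable_J:
  "composable (J_cat f) n m \<longleftrightarrow> (\<exists>a u v w. liftable f a u \<and> composable (Tgt f) v u \<and>
     liftable f a (Comp (Tgt f) v u) \<and> composable (Tgt f) w (Comp (Tgt f) v u) \<and>
     m = enc (enc (a, u), v) \<and> n = (enc (enc (a, Comp (Tgt f) v u), w) :: 'u::infinite))"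
    (is "?l \<longleftrightarrow> ?r")
proof
  assume ?l
  then obtain a u v a' u' w where
    "m = enc (enc (a, u), v)" "liftable f a u" "composable (Tgt f) v u"
    "n = enc (enc (a', u'), w)" "liftable f a' u'" "composable (Tgt f) w u'"
    "Dom (J_cat f) n = Cod (J_cat f) m"
    unfolding composable_def[of "J_cat f"] Arr_J by blast
  then show ?r
    by (auto simp: Dom_J Cod_J)
next
  assume ?r
  then obtain a u v w where *: "liftable f a u" "composable (Tgt f) v u"
     "liftable f a (Comp (Tgt f) v u)" "composable (Tgt f) w (Comp (Tgt f) v u)"
     "m = enc (enc (a, u), v)" "n = (enc (enc (a, Comp (Tgt f) v u), w) :: 'u::infinite)"
    by blast
  then have "n \<in> Arr (J_cat f)" "m \<in> Arr (J_cat f)"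
    unfolding Arr_J by blast+
  then show ?l
    using * by (auto simp: composable_def[of "J_cat f"] Dom_J Cod_J)
qed

lemma ext_category_J:
  fixes f :: "'u::infinite small_funct"
  assumes f: "f \<in> Arr CAT" shows "ext_category (J_cat f)"
proof -
  define B where "B = Tgt f"
  have B: "category B"
    using f by (simp add: B_def Arr_CAT_iff ext_category_def)
  have lift: "liftable f a (Comp B v u)" if "liftable f a u" "composable B v u" for a u v
    using that B by (auto simp: liftable_def B_def[symmetric] category_simps)
  have comp: "composable B (Comp B w v) u" "Comp B w (Comp B v u) = Comp B (Comp B w v) u"
      "composable B w v"
    if "composable B v u" "composable B w (Comp B v u)" for u v w
  proof -
    show wv: "composable B w v"
      using that B by (auto simp: composable_def category_simps Cod_Comp)
    show "composable B (Comp B w v) u"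
      using that wv B by (auto simp: composable_def category_simps Dom_Comp Comp_in)
    show "Comp B w (Comp B v u) = Comp B (Comp B w v) u"
      using Comp_assoc[OF B wv] that by auto
  qed
  note [simp] = B_def[symmetric]
  note CJ = Comp_J[where f=f, folded B_def]
  have "category (J_cat f)"
  proof (rule categoryI)
    fix m assume "m \<in> Arr (J_cat f)"
    then obtain a u v where m: "m = enc (enc (a, u), v)" "liftable f a u" "composable B v u"
      unfolding Arr_J B_def by blast
    note l = lift[OF m(2,3)]
    have i: "Dom (J_cat f) m = enc (a, u)" "Cod (J_cat f) m = enc (a, Comp B v u)"
      using m by (simp_all add: Dom_J Cod_J)
    then show "Dom (J_cat f) m \<in> Obj (J_cat f)" "Cod (J_cat f) m \<in> Obj (J_cat f)"
      using m l by (auto simp: Obj_J)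
    have u: "u \<in> Arr B" "v \<in> Arr B" "Cod B u = Dom B v"
      using m by (auto simp: composable_def)
    have j: "Ident (J_cat f) (enc (a, u)) = enc (enc (a, u), Ident B (Dom B v))"
      using Ident_J[OF m(2)] u by simp
    have k: "Comp B (Ident B (Dom B v)) u = u" "composable B (Ident B (Dom B v)) u"
      using u B Ident_Comp[OF B u(1)] by (auto simp: category_simps composable_def)
    show "Comp (J_cat f) m (Ident (J_cat f) (Dom (J_cat f) m)) = m"
      unfolding i j using CJ[OF m(2), of "Ident B (Dom B v)" v] k m u B
      by (simp add: category_simps)
    have j: "Ident (J_cat f) (enc (a, Comp B v u)) = enc (enc (a, Comp B v u), Ident B (Cod B v))"
      using Ident_J[OF l] m B by (simp add: Cod_Comp)
    have k: "composable B (Ident B (Cod B v)) (Comp B v u)"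
      using u B m by (auto simp: category_simps composable_def Cod_Comp[OF B] Comp_in[OF B])
    show "Comp (J_cat f) (Ident (J_cat f) (Cod (J_cat f) m)) m = m"
      unfolding i j using CJ[OF m(2), of v "Ident B (Cod B v)"] k m u B l
      by (simp add: category_simps)
  next
    fix x assume "x \<in> Obj (J_cat f)"
    then obtain a u where x: "x = enc (a, u)" "liftable f a u"
      unfolding Obj_J by blast
    then have u: "u \<in> Arr B"
      by (simp add: liftable_def)
    then have c: "composable B (Ident B (Cod B u)) u"
      using B by (simp add: composable_def category_simps)
    show "in_hom (J_cat f) (Ident (J_cat f) x) x x"
      using x c u B by (auto simp: in_hom_def Ident_J Dom_J Cod_J category_simps Arr_J)
  next
    fix m n assume "composable (J_cat f) n m"
    then obtain a u v w where *: "liftable f a u" "composable B v u"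
     "liftable f a (Comp B v u)" "composable B w (Comp B v u)"
     "m = enc (enc (a, u), v)" "n = enc (enc (a, Comp B v u), w)"
      unfolding composable_J by auto
    then show "in_hom (J_cat f) (Comp (J_cat f) n m) (Dom (J_cat f) m) (Cod (J_cat f) n)"
      using comp[OF *(2,4)]
      by (auto simp: CJ Dom_J Cod_J in_hom_def Arr_J)
  next
    fix m n k assume "composable (J_cat f) n m" "composable (J_cat f) k n"
    then obtain a u v w y where *: "liftable f a u" "composable B v u"
     "liftable f a (Comp B v u)" "composable B w (Comp B v u)"
     "m = enc (enc (a, u), v)" "n = enc (enc (a, Comp B v u), w)"
     "composable B y (Comp B w (Comp B v u))" "liftable f a (Comp B w (Comp B v u))"
     "k = enc (enc (a, Comp B w (Comp B v u)), y)"
      unfolding composable_J by auto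
    note c = comp[OF *(2,4)] and d = comp[OF *(4,7)]
    have y: "composable B y (Comp B w v)" "composable B (Comp B y w) (Comp B v u)"
      using *(7) c d by (auto intro: comp(3))
    have "Comp B y (Comp B w v) = Comp B (Comp B y w) v"
      using comp(2)[OF c(3) y(1)] by simp
    then show "Comp (J_cat f) k (Comp (J_cat f) n m) = Comp (J_cat f) (Comp (J_cat f) k n) m"
      using CJ[OF *(1), of v w] CJ[OF *(3), of w y] CJ[OF *(1), of "Comp B w v" y]
        CJ[OF *(1), of v "Comp B y w"] * c d y
      by simp
  qed
  moreover have "Dom (J_cat f) \<in> extensional (Arr (J_cat f))"
      "Cod (J_cat f) \<in> extensional (Arr (J_cat f))" "Ident (J_cat f) \<in> extensional (Obj (J_cat f))"
    by (simp_all add: J_cat_def Let_def)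
  moreover have "Comp (J_cat f) n m = undefined" if "\<not> composable (J_cat f) n m" for n m
    using that by (auto simp: J_cat_def Let_def composable_def[of "\<lparr>Obj = _, Arr = _, Dom = _, Cod = _, Ident = _, Comp = _\<rparr>"])
  ultimately show ?thesis
    by (simp add: ext_category_def)
qed

lemma liftable_Ident:
  assumes "f \<in> Arr CAT" "a \<in> Obj (Src f)"
  shows "liftable f a (Ident (Tgt f) (OMap f a))"
proof -
  have "category (Tgt f)" "OMap f a \<in> Obj (Tgt f)"
    using assms by (auto simp: Arr_CAT_iff is_functor_def)
  then show ?thesis
    using assms by (simp add: liftable_def category_simps)
qed

lemma T_in_CAT:
  fixes f :: "'u::infinite small_funct"
  assumes f: "f \<in> Arr CAT" shows "T_fun f \<in> Arr CAT"
proof -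
  have e: "ext_category (Tgt f)" and B: "category (Tgt f)"
    using f by (auto simp: Arr_CAT_iff ext_category_def)
  have J: "category (J_cat f)"
    using ext_category_J[OF f] by (rule ext_categoryD)
  have m: "composable (J_cat f) n m \<Longrightarrow> Comp (J_cat f) n m \<in> Arr (J_cat f) \<and>
      n \<in> Arr (J_cat f) \<and> m \<in> Arr (J_cat f)" for n m
    using J by (simp add: Comp_in) (simp add: composable_def)
  have "is_functor (T_fun f)"
    unfolding is_functor_def
  proof (intro conjI ballI allI impI)
    show "OMap (T_fun f) \<in> Obj (Src (T_fun f)) \<rightarrow>\<^sub>E Obj (Tgt (T_fun f))"
      using B by (auto simp: T_fun_def Obj_J liftable_def category_simps)
    show "AMap (T_fun f) \<in> Arr (Src (T_fun f)) \<rightarrow>\<^sub>E Arr (Tgt (T_fun f))"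
      by (auto simp: T_fun_def Arr_J composable_def)
    fix m assume "m \<in> Arr (Src (T_fun f))"
    then obtain a u v where m: "m = enc (enc (a, u), v)" "liftable f a u" "composable (Tgt f) v u"
      by (auto simp: T_fun_def Arr_J)
    have m': "m \<in> Arr (J_cat f)"
      using m by (auto simp: Arr_J)
    have "enc (a, u) \<in> Obj (J_cat f)" "enc (a, Comp (Tgt f) v u) \<in> Obj (J_cat f)"
      using Dom_in[OF J m'] Cod_in[OF J m'] m by (simp_all add: Dom_J Cod_J)
    then show "Dom (Tgt (T_fun f)) (AMap (T_fun f) m) = OMap (T_fun f) (Dom (Src (T_fun f)) m)"
      and "Cod (Tgt (T_fun f)) (AMap (T_fun f) m) = OMap (T_fun f) (Cod (Src (T_fun f)) m)"
      using m m' B by (auto simp: T_fun_def Dom_J Cod_J Cod_Comp composable_def[of _ v u])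
  next
    fix x assume "x \<in> Obj (Src (T_fun f))"
    then obtain a u where "x = enc (a, u)" "liftable f a u"
      by (auto simp: T_fun_def Obj_J)
    moreover from this have "x \<in> Obj (J_cat f)"
      by (auto simp: Obj_J)
    ultimately show "AMap (T_fun f) (Ident (Src (T_fun f)) x) = Ident (Tgt (T_fun f)) (OMap (T_fun f) x)"
      using Ident_in[OF J, of x] by (simp add: T_fun_def Ident_J)
  next
    fix m n assume nm: "composable (Src (T_fun f)) n m"
    then have "composable (J_cat f) n m"
      by (simp add: T_fun_def)
    from m[OF this] this
    show "AMap (T_fun f) (Comp (Src (T_fun f)) n m) =
       Comp (Tgt (T_fun f)) (AMap (T_fun f) n) (AMap (T_fun f) m)"
      by (auto simp: T_fun_def composable_J Comp_J)
  qed (use J B in \<open>simp_all add: T_fun_def\<close>)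
  then show ?thesis
    using e ext_category_J[OF f] by (simp add: Arr_CAT_iff T_fun_def)
qed

lemma S_in_CAT:
  fixes f :: "'u::infinite small_funct"
  assumes f: "f \<in> Arr CAT" shows "S_fun f \<in> Arr CAT"
proof -
  have e: "ext_category (Src f)" and A: "category (Src f)"
    using f by (auto simp: Arr_CAT_iff ext_category_def)
  have J: "category (J_cat f)"
    using ext_category_J[OF f] by (rule ext_categoryD)
  have D: "category (discr (Src f))"
    using ext_category_discr[OF e] by (rule ext_categoryD)
  have s: "enc (a, Ident (Tgt f) (OMap f a)) \<in> Obj (J_cat f)" if "a \<in> Obj (Src f)" for a
    using liftable_Ident[OF f that] by (auto simp: Obj_J)
  have c: "composable (discr (Src f)) n m \<longleftrightarrow> m \<in> Ident (Src f) ` Obj (Src f) \<and> n = m" for n m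
    using A by (auto simp: composable_def discr_def category_simps)
  have "Comp (J_cat f) (Ident (J_cat f) x) (Ident (J_cat f) x) = Ident (J_cat f) x"
    if "x \<in> Obj (J_cat f)" for x
    using Comp_Ident[OF J, of "Ident (J_cat f) x"] J that by (simp add: category_simps)
  then have "is_functor (S_fun f)"
    unfolding is_functor_def
    using A J D s by (auto simp: S_fun_def Let_def discr_def category_simps c[unfolded discr_def])
  then show ?thesis
    using ext_category_discr[OF e] ext_category_J[OF f] by (simp add: Arr_CAT_iff S_fun_def Let_def)
qed

lemma T_discrete_opfibration:
  fixes f :: "'u::infinite small_funct"
  assumes f: "f \<in> Arr CAT" shows "discrete_opfibration (T_fun f)"
proof -
  have "\<exists>!m. m \<in> Arr (Src (T_fun f)) \<and> Dom (Src (T_fun f)) m = x \<and> AMap (T_fun f) m = v"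
    if x': "x \<in> Obj (Src (T_fun f))" and "v \<in> Arr (Tgt (T_fun f))" "Dom (Tgt (T_fun f)) v = OMap (T_fun f) x"
    for x v
  proof -
    obtain a u where x: "x = enc (a, u)" "liftable f a u"
      using x' by (auto simp: T_fun_def Obj_J)
    have c: "composable (Tgt f) v u"
      using that x by (auto simp: T_fun_def composable_def liftable_def)
    have v: "enc (enc (a, u), v) \<in> Arr (J_cat f)"
      using x c by (auto simp: Arr_J)
    have uniq: "m = enc (enc (a, u), v)"
      if "m \<in> Arr (J_cat f) \<and> Dom (J_cat f) m = x \<and> snd (dec m) = v" for m
      using that x by (auto simp: Arr_J Dom_J)
    show ?thesis
    proof (rule ex1I)
      show "enc (enc (a, u), v) \<in> Arr (Src (T_fun f)) \<and>
          Dom (Src (T_fun f)) (enc (enc (a, u), v)) = x \<and> AMap (T_fun f) (enc (enc (a, u), v)) = v"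
        using v x c by (simp add: T_fun_def Dom_J)
      fix m assume "m \<in> Arr (Src (T_fun f)) \<and> Dom (Src (T_fun f)) m = x \<and> AMap (T_fun f) m = v"
      then show "m = enc (enc (a, u), v)"
        by (intro uniq) (auto simp: T_fun_def)
    qed
  qed
  then show ?thesis
    using T_in_CAT[OF f] by (simp add: discrete_opfibration_def Arr_CAT_iff)
qed

lemma S_initial:
  fixes f :: "'u::infinite small_funct"
  assumes f: "f \<in> Arr CAT" shows "initial_functor (S_fun f)"
proof -
  have B: "category (Tgt f)"
    using f by (auto simp: Arr_CAT_iff ext_category_def)
  have "Obj (comma (S_fun f) x) = {(fst (dec x), enc (enc (fst (dec x),
            Ident (Tgt f) (OMap f (fst (dec x)))), snd (dec x)))}"
    if x': "x \<in> Obj (Tgt (S_fun f))" for x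
  proof -
    obtain a u where x: "x = enc (a, u)" "liftable f a u"
      using x' by (auto simp: S_fun_def Let_def Obj_J)
    let ?i = "Ident (Tgt f) (OMap f a)"
    have a: "a \<in> Obj (Src f)" "u \<in> Arr (Tgt f)" "Dom (Tgt f) u = OMap f a"
      using x by (auto simp: liftable_def)
    have b: "OMap f a' \<in> Obj (Tgt f)" if "a' \<in> Obj (Src f)" for a'
      using that f by (auto simp: Arr_CAT_iff is_functor_def)
    have i: "liftable f a ?i" "composable (Tgt f) u ?i" "Comp (Tgt f) u ?i = u"
      using liftable_Ident[OF f a(1)] a b[OF a(1)] B Comp_Ident[OF B a(2)]
      by (auto simp: composable_def category_simps)
    have m: "in_hom (J_cat f) (enc (enc (a, ?i), u)) (enc (a, ?i)) x"
      using i x by (auto simp: in_hom_def Arr_J Dom_J Cod_J)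
    have uniq: "a' = a \<and> m = enc (enc (a, ?i), u)"
      if a': "a' \<in> Obj (Src f)"
        and m: "in_hom (J_cat f) m (enc (a', Ident (Tgt f) (OMap f a'))) x" for a' m
    proof -
      obtain v where "m = enc (enc (a', Ident (Tgt f) (OMap f a')), v)"
          "composable (Tgt f) v (Ident (Tgt f) (OMap f a'))"
        using m by (auto simp: in_hom_def Arr_J Dom_J)
      moreover from this have "v \<in> Arr (Tgt f)" "Dom (Tgt f) v = OMap f a'"
        using b[OF a'] B by (auto simp: composable_def category_simps)
      moreover from this have "Comp (Tgt f) v (Ident (Tgt f) (OMap f a')) = v"
        using Comp_Ident[OF B] by metis
      ultimately show ?thesis
        using m x liftable_Ident[OF f a'] by (auto simp: in_hom_def Cod_J)
    qed
    show ?thesis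
    proof (rule set_eqI)
      fix p :: "'u \<times> 'u"
      obtain a' m' where p: "p = (a', m')"
        by (cases p)
      show "p \<in> Obj (comma (S_fun f) x) \<longleftrightarrow> p \<in> {(fst (dec x), enc (enc (fst (dec x),
            Ident (Tgt f) (OMap f (fst (dec x)))), snd (dec x)))}"
        unfolding p using m x a uniq[of a' m']
        by (auto simp: comma_def S_fun_def Let_def discr_def)
    qed
  qed
  then show ?thesis
    using S_in_CAT[OF f] by (simp add: initial_functor_def Arr_CAT_iff connected_category_def)
qed

lemma T_S:
  fixes f :: "'u::infinite small_funct"
  assumes f: "f \<in> Arr CAT" shows "T_fun f \<odot> S_fun f = f \<odot> iota (Src f)"
proof -
  have B: "category (Tgt f)" and A: "category (Src f)"
    using f by (auto simp: Arr_CAT_iff ext_category_def)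
  have J: "category (J_cat f)"
    using ext_category_J[OF f] by (rule ext_categoryD)
  have F: "OMap f a \<in> Obj (Tgt f)" "AMap f (Ident (Src f) a) = Ident (Tgt f) (OMap f a)"
    if "a \<in> Obj (Src f)" for a
    using f that by (auto simp: Arr_CAT_iff is_functor_def)
  have s: "enc (a, Ident (Tgt f) (OMap f a)) \<in> Obj (J_cat f)" if "a \<in> Obj (Src f)" for a
    using liftable_Ident[OF f that] by (auto simp: Obj_J)
  have "Ident (J_cat f) (enc (a, Ident (Tgt f) (OMap f a))) \<in> Arr (J_cat f)"
    "snd (dec (Ident (J_cat f) (enc (a, Ident (Tgt f) (OMap f a))))) = Ident (Tgt f) (OMap f a)"
    if "a \<in> Obj (Src f)" for a
    using Ident_in[OF J s[OF that]] Ident_J[OF liftable_Ident[OF f that]] F[OF that] B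
    by (simp_all add: Cod_Ident)
  then show ?thesis
    using A B F s
    by (auto simp: fcomp_def T_fun_def S_fun_def iota_def discr_def Let_def fun_eq_iff
          category_simps restrict_def)
qed


section \<open>Existence of pushouts\<close>

inductive_set gen :: "'x set \<Rightarrow> ('x \<Rightarrow> 'x \<Rightarrow> bool) \<Rightarrow> ('x \<Rightarrow> 'x \<Rightarrow> 'x) \<Rightarrow> 'x set"
  for G P c where
  base: "x \<in> G \<Longrightarrow> x \<in> gen G P c"
| step: "g \<in> gen G P c \<Longrightarrow> f \<in> gen G P c \<Longrightarrow> P g f \<Longrightarrow> c g f \<in> gen G P c"

lemma ex_inj_gen:
  includes cardinal_syntax
  assumes G: "|G| \<le>o |UNIV :: 'u::infinite set|"
  shows "\<exists>e :: 'x \<Rightarrow> 'u. inj_on e (gen G P c)"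
proof -
  define st where "st = rec_nat G (\<lambda>_ X. X \<union> (\<lambda>(g, f). c g f) ` (X \<times> X))"
  have st: "st 0 = G" "st (Suc n) = st n \<union> (\<lambda>(g, f). c g f) ` (st n \<times> st n)" for n
    by (simp_all add: st_def)
  have inf: "infinite (UNIV :: 'u set)"
    by (rule infinite_UNIV)
  have "|st n| \<le>o |UNIV :: 'u set|" for n
  proof (induction n)
    case (Suc n)
    have "|st n \<times> st n| \<le>o |UNIV :: 'u set|"
      using card_of_Sigma_ordLeq_infinite[OF inf, of "st n" "\<lambda>_. st n"] Suc by simp
    then have "|(\<lambda>(g, f). c g f) ` (st n \<times> st n)| \<le>o |UNIV :: 'u set|"
      by (rule ordLeq_transitive[OF card_of_image])
    then show ?case
      unfolding st using inf Suc
      by (intro card_of_Un_ordLeq_infinite_Field card_of_Card_order) (simp_all add: infinite_UNIV Field_card_of)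
  qed (simp add: st G)
  then have "|\<Union>n. st n| \<le>o |UNIV :: 'u set|"
    using card_of_UNION_ordLeq_infinite[OF inf, of UNIV st]
      inf[unfolded infinite_iff_card_of_nat] by simp
  moreover have mono: "st m \<subseteq> st (m + k)" for m k
    by (induction k) (auto simp: st)
  have "gen G P c \<subseteq> (\<Union>n. st n)"
  proof
    fix x assume "x \<in> gen G P c"
    then show "x \<in> (\<Union>n. st n)"
    proof induction
      case (base x)
      then show ?case using st(1) by blast
    next
      case (step g f)
      then obtain m n where "g \<in> st m" "f \<in> st n"
        by blast
      then have "g \<in> st (m + n)" "f \<in> st (m + n)"
        using mono[of m n] mono[of n m] by (auto simp: add.commute)
      then have "c g f \<in> st (Suc (m + n))"
        by (auto simp: st)
      then show ?case by blast
    qed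
  qed
  ultimately have "|gen G P c| \<le>o |UNIV :: 'u set|"
    using ordLeq_transitive[OF card_of_mono1] by metis
  then show ?thesis
    unfolding card_of_ordLeq[symmetric] by auto
qed

lemma is_functorD:
  assumes "is_functor F"
  shows "category (Src F)" "category (Tgt F)"
    "x \<in> Obj (Src F) \<Longrightarrow> OMap F x \<in> Obj (Tgt F)" "m \<in> Arr (Src F) \<Longrightarrow> AMap F m \<in> Arr (Tgt F)"
    "m \<in> Arr (Src F) \<Longrightarrow> Dom (Tgt F) (AMap F m) = OMap F (Dom (Src F) m)"
    "m \<in> Arr (Src F) \<Longrightarrow> Cod (Tgt F) (AMap F m) = OMap F (Cod (Src F) m)"
    "x \<in> Obj (Src F) \<Longrightarrow> AMap F (Ident (Src F) x) = Ident (Tgt F) (OMap F x)"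
    "composable (Src F) n m \<Longrightarrow> AMap F (Comp (Src F) n m) = Comp (Tgt F) (AMap F n) (AMap F m)"
    "composable (Src F) n m \<Longrightarrow> composable (Tgt F) (AMap F n) (AMap F m)"
    "OMap F \<in> extensional (Obj (Src F))" "AMap F \<in> extensional (Arr (Src F))"
  using assms by (auto simp: is_functor_def composable_def PiE_def)

lemma funct_eqI:
  fixes F G :: "('o, 'm, 'p, 'n) funct"
  assumes "is_functor F" "is_functor G" "Src F = Src G" "Tgt F = Tgt G"
    "\<And>x. x \<in> Obj (Src F) \<Longrightarrow> OMap F x = OMap G x"
    "\<And>m. m \<in> Arr (Src F) \<Longrightarrow> AMap F m = AMap G m"
  shows "F = G"
proof -
  have "OMap F = OMap G" "AMap F = AMap G"
    using extensionalityI[OF is_functorD(10)[OF assms(1)], of "OMap G"]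
      extensionalityI[OF is_functorD(11)[OF assms(1)], of "AMap G"]
      is_functorD(10,11)[OF assms(2)] assms(3,5,6) by simp_all
  then show ?thesis
    using assms(3,4) by simp
qed

lemma is_functor_fcomp:
  assumes F: "is_functor F" and G: "is_functor G" and s: "Src G = Tgt F"
  shows "is_functor (G \<odot> F)"
proof -
  have c: "n \<in> Arr (Src F) \<and> m \<in> Arr (Src F) \<and> Comp (Src F) n m \<in> Arr (Src F)"
    if "composable (Src F) n m" for n m
    using that is_functorD(1)[OF F] by (simp add: Comp_in) (simp add: composable_def)
  note GD = is_functorD[OF G, unfolded s]
  show ?thesis
    unfolding is_functor_def
  proof (intro conjI ballI allI impI)
    show "OMap (G \<odot> F) \<in> Obj (Src (G \<odot> F)) \<rightarrow>\<^sub>E Obj (Tgt (G \<odot> F))"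
        "AMap (G \<odot> F) \<in> Arr (Src (G \<odot> F)) \<rightarrow>\<^sub>E Arr (Tgt (G \<odot> F))"
      using is_functorD(3,4)[OF F] GD(3,4) by (auto simp: fcomp_def)
  next
    fix m assume "m \<in> Arr (Src (G \<odot> F))"
    then have m: "m \<in> Arr (Src F)"
      by (simp add: fcomp_def)
    then show "Dom (Tgt (G \<odot> F)) (AMap (G \<odot> F) m) = OMap (G \<odot> F) (Dom (Src (G \<odot> F)) m)"
        "Cod (Tgt (G \<odot> F)) (AMap (G \<odot> F) m) = OMap (G \<odot> F) (Cod (Src (G \<odot> F)) m)"
      using Dom_in[OF is_functorD(1)[OF F] m] Cod_in[OF is_functorD(1)[OF F] m]
        is_functorD(4-6)[OF F m] GD(5,6)[of "AMap F m"]
      by (simp_all add: fcomp_def)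
  next
    fix x assume "x \<in> Obj (Src (G \<odot> F))"
    then show "AMap (G \<odot> F) (Ident (Src (G \<odot> F)) x) = Ident (Tgt (G \<odot> F)) (OMap (G \<odot> F) x)"
      using is_functorD(3,7)[OF F] GD(7) Ident_in[OF is_functorD(1)[OF F], of x]
      by (simp add: fcomp_def)
  next
    fix n m assume "composable (Src (G \<odot> F)) n m"
    then have nm: "composable (Src F) n m"
      by (simp add: fcomp_def)
    show "AMap (G \<odot> F) (Comp (Src (G \<odot> F)) n m) =
        Comp (Tgt (G \<odot> F)) (AMap (G \<odot> F) n) (AMap (G \<odot> F) m)"
      using c[OF nm] is_functorD(8,9)[OF F nm] GD(8)[of "AMap F n" "AMap F m"]
      by (simp add: fcomp_def)
  qed (use is_functorD(1)[OF F] is_functorD(2)[OF G] in \<open>simp_all add: fcomp_def\<close>)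
qed

text \<open>Transport of a category along an encoding of its objects and arrows.\<close>

definition transport :: "('o \<Rightarrow> 'p) \<Rightarrow> ('m \<Rightarrow> 'n) \<Rightarrow> ('o, 'm) cat \<Rightarrow> ('p, 'n) cat" where
  "transport eo ea C = (let do = inv_into (Obj C) eo; da = inv_into (Arr C) ea in
     \<lparr>Obj = eo ` Obj C, Arr = ea ` Arr C,
      Dom = (\<lambda>m\<in>ea ` Arr C. eo (Dom C (da m))), Cod = (\<lambda>m\<in>ea ` Arr C. eo (Cod C (da m))),
      Ident = (\<lambda>x\<in>eo ` Obj C. ea (Ident C (do x))),
      Comp = (\<lambda>n m. if n \<in> ea ` Arr C \<and> m \<in> ea ` Arr C \<and> composable C (da n) (da m)
                then ea (Comp C (da n) (da m)) else undefined)\<rparr>)"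

lemma
  assumes C: "category C" and eo: "inj_on eo (Obj C)" and ea: "inj_on ea (Arr C)"
  shows ext_category_transport: "ext_category (transport eo ea C)"
    and encode_functor: "is_functor \<lparr>Src = C, Tgt = transport eo ea C,
           OMap = restrict eo (Obj C), AMap = restrict ea (Arr C)\<rparr>"
    and decode_functor: "is_functor \<lparr>Src = transport eo ea C, Tgt = C,
           OMap = restrict (inv_into (Obj C) eo) (eo ` Obj C),
           AMap = restrict (inv_into (Arr C) ea) (ea ` Arr C)\<rparr>"
proof -
  let ?T = "transport eo ea C"
  have sel: "Obj ?T = eo ` Obj C" "Arr ?T = ea ` Arr C"
    by (simp_all add: transport_def Let_def)
  have d: "\<And>m. m \<in> Arr C \<Longrightarrow> Dom ?T (ea m) = eo (Dom C m)"
      "\<And>m. m \<in> Arr C \<Longrightarrow> Cod ?T (ea m) = eo (Cod C m)"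
      "\<And>x. x \<in> Obj C \<Longrightarrow> Ident ?T (eo x) = ea (Ident C x)"
      "\<And>n m. composable C n m \<Longrightarrow> Comp ?T (ea n) (ea m) = ea (Comp C n m)"
    using eo ea by (auto simp: transport_def Let_def composable_def)
  have c: "composable ?T y x \<longleftrightarrow> (\<exists>n m. y = ea n \<and> x = ea m \<and> composable C n m)" for x y
  proof
    assume "composable ?T y x"
    then obtain n m where "y = ea n" "x = ea m" "n \<in> Arr C" "m \<in> Arr C" "eo (Dom C n) = eo (Cod C m)"
      by (auto simp: composable_def sel d)
    moreover from this have "Dom C n = Cod C m"
      using eo C by (meson inj_onD Dom_in Cod_in)
    ultimately show "\<exists>n m. y = ea n \<and> x = ea m \<and> composable C n m"
      by (auto simp: composable_def)
  qed (auto simp: composable_def sel d)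
  have comp: "n \<in> Arr C \<and> m \<in> Arr C \<and> Comp C n m \<in> Arr C" if "composable C n m" for n m
    using that C by (auto simp: Comp_in) (auto simp: composable_def)
  have T: "category ?T"
  proof (rule categoryI)
    fix x y z assume "composable ?T z y" "composable ?T y x"
    then obtain m n n' k where *: "composable C n m" "composable C k n'"
        "x = ea m" "y = ea n" "y = ea n'" "z = ea k"
      unfolding c by blast
    have "n' = n"
      using inj_onD[OF ea, of n' n] *(4,5) comp[OF *(1)] comp[OF *(2)] by simp
    with * have kn: "composable C k n" by simp
    have k: "composable C k (Comp C n m)" "composable C (Comp C k n) m"
      using kn *(1) comp[OF kn] comp[OF *(1)] Cod_Comp[OF C *(1)] Dom_Comp[OF C kn]
      by (simp_all add: composable_def)
    show "Comp ?T z (Comp ?T y x) = Comp ?T (Comp ?T z y) x"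
      unfolding *(3,4,6) using *(1) kn k Comp_assoc[OF C kn *(1)] by (simp add: d)
  next
    fix x y assume "composable ?T y x"
    then obtain m n where *: "composable C n m" "x = ea m" "y = ea n"
      unfolding c by blast
    then show "in_hom ?T (Comp ?T y x) (Dom ?T x) (Cod ?T y)"
      using comp[OF *(1)] C by (simp add: in_hom_def d sel Dom_Comp Cod_Comp)
  next
    fix x assume "x \<in> Arr ?T"
    then obtain m where m: "m \<in> Arr C" "x = ea m"
      by (auto simp: sel)
    have i: "composable C m (Ident C (Dom C m))" "composable C (Ident C (Cod C m)) m"
      using m C by (auto simp: composable_def category_simps)
    show "Comp ?T x (Ident ?T (Dom ?T x)) = x" "Comp ?T (Ident ?T (Cod ?T x)) x = x"
      using m i C by (simp_all add: d category_simps)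
  qed (use C in \<open>auto simp: sel d in_hom_def category_simps\<close>)
  have "Comp ?T y x = undefined" if "\<not> composable ?T y x" for x y
  proof (rule ccontr)
    assume "Comp ?T y x \<noteq> undefined"
    then have "y \<in> ea ` Arr C" "x \<in> ea ` Arr C"
        "composable C (inv_into (Arr C) ea y) (inv_into (Arr C) ea x)"
      by (auto simp: transport_def Let_def split: if_splits)
    then show False
      using that unfolding c by (metis f_inv_into_f)
  qed
  then show "ext_category ?T"
    using T by (auto simp: ext_category_def) (auto simp: transport_def Let_def)
  show "is_functor \<lparr>Src = C, Tgt = ?T,
           OMap = restrict eo (Obj C), AMap = restrict ea (Arr C)\<rparr>"
    unfolding is_functor_def funct.simps
    using C T comp by (simp add: sel d category_simps)
  show "is_functor \<lparr>Src = ?T, Tgt = C,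
           OMap = restrict (inv_into (Obj C) eo) (eo ` Obj C),
           AMap = restrict (inv_into (Arr C) ea) (ea ` Arr C)\<rparr>"
    unfolding is_functor_def funct.simps
  proof (intro conjI ballI allI impI)
    fix m assume "m \<in> Arr ?T"
    then obtain m' where m: "m' \<in> Arr C" "m = ea m'"
      by (auto simp: sel)
    then show "Dom C (restrict (inv_into (Arr C) ea) (ea ` Arr C) m) =
        restrict (inv_into (Obj C) eo) (eo ` Obj C) (Dom ?T m)"
      "Cod C (restrict (inv_into (Arr C) ea) (ea ` Arr C) m) =
        restrict (inv_into (Obj C) eo) (eo ` Obj C) (Cod ?T m)"
      using C eo ea by (simp_all add: d Dom_in Cod_in)
  next
    fix x assume "x \<in> Obj ?T"
    then obtain x' where x: "x' \<in> Obj C" "x = eo x'"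
      by (auto simp: sel)
    then show "restrict (inv_into (Arr C) ea) (ea ` Arr C) (Ident ?T x) =
        Ident C (restrict (inv_into (Obj C) eo) (eo ` Obj C) x)"
      using C eo ea by (simp add: d Ident_in)
  next
    fix m n assume "composable ?T n m"
    then obtain n' m' where m: "n = ea n'" "m = ea m'" "composable C n' m'"
      unfolding c by blast
    then show "restrict (inv_into (Arr C) ea) (ea ` Arr C) (Comp ?T n m) =
        Comp C (restrict (inv_into (Arr C) ea) (ea ` Arr C) n)
          (restrict (inv_into (Arr C) ea) (ea ` Arr C) m)"
      using comp[OF m(3)] ea by (simp add: d)
  qed (use C T eo ea in \<open>auto simp: sel\<close>)
qed

lemma fcomp_simps [simp]:
  "Src (G \<odot> F) = Src F" "Tgt (G \<odot> F) = Tgt G"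
  "x \<in> Obj (Src F) \<Longrightarrow> OMap (G \<odot> F) x = OMap G (OMap F x)"
  "m \<in> Arr (Src F) \<Longrightarrow> AMap (G \<odot> F) m = AMap G (AMap F m)"
  by (simp_all add: fcomp_def)

lemma CAT_simps [simp]: "Dom CAT = Src" "Cod CAT = Tgt" "Comp CAT = fcomp"
  by (simp_all add: CAT_def)

text \<open>The pushout is realised inside the product of the vertices of all cocones, as the
  subcategory generated by the images of the two legs.\<close>

lemma ex_pushout:
  fixes F G :: "'u::infinite small_funct"
  assumes FG: "F \<in> Arr CAT" "G \<in> Arr CAT" "Src F = Src G"
  shows "\<exists>i j. is_pushout CAT F G i j"
proof -
  define A B where "A = Tgt F" and "B = Tgt G"
  define K where "K = {(p, q). composable CAT p F \<and> composable CAT q G \<and>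
      Cod CAT p = Cod CAT q \<and> Comp CAT p F = Comp CAT q G}"
  define c where "c k = Tgt (fst k)" for k :: "'u small_funct \<times> 'u small_funct"
  have AB: "ext_category A" "ext_category B" "category A" "category B"
    using FG by (simp_all add: A_def B_def Arr_CAT_iff ext_categoryD)
  have F: "is_functor F" "is_functor G"
    using FG by (simp_all add: Arr_CAT_iff)
  have p: "is_functor (fst k)" "Src (fst k) = A" "Tgt (fst k) = c k" "category (c k)"
    and q: "is_functor (snd k)" "Src (snd k) = B" "Tgt (snd k) = c k"
    and pq: "fst k \<odot> F = snd k \<odot> G" if "k \<in> K" for k
  proof -
    have *: "fst k \<in> Arr CAT" "snd k \<in> Arr CAT" "Src (fst k) = Tgt F" "Src (snd k) = Tgt G"
        "Tgt (fst k) = Tgt (snd k)" "fst k \<odot> F = snd k \<odot> G"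
      using that by (simp_all add: K_def case_prod_beta composable_def)
    then show "is_functor (fst k)" "Src (fst k) = A" "Tgt (fst k) = c k" "category (c k)"
        "is_functor (snd k)" "Src (snd k) = B" "Tgt (snd k) = c k" "fst k \<odot> F = snd k \<odot> G"
      by (simp_all add: Arr_CAT_iff c_def A_def B_def is_functorD(2))
  qed
  define oA where "oA a = (\<lambda>k\<in>K. OMap (fst k) a)" for a
  define oB where "oB a = (\<lambda>k\<in>K. OMap (snd k) a)" for a
  define aA where "aA a = (\<lambda>k\<in>K. AMap (fst k) a)" for a
  define aB where "aB a = (\<lambda>k\<in>K. AMap (snd k) a)" for a
  define P where "P g f \<longleftrightarrow> (\<forall>k\<in>K. Dom (c k) (g k) = Cod (c k) (f k))" for g f
  define cc where "cc g f = (\<lambda>k\<in>K. Comp (c k) (g k) (f k))" for g f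
  define Ob where "Ob = oA ` Obj A \<union> oB ` Obj B"
  define G0 where "G0 = aA ` Arr A \<union> aB ` Arr B"
  define AA where "AA = gen G0 P cc"
  define Q where "Q = \<lparr>Obj = Ob, Arr = AA, Dom = (\<lambda>x. \<lambda>k\<in>K. Dom (c k) (x k)),
      Cod = (\<lambda>x. \<lambda>k\<in>K. Cod (c k) (x k)), Ident = (\<lambda>y. \<lambda>k\<in>K. Ident (c k) (y k)), Comp = cc\<rparr>"
  have Q: "Obj Q = Ob" "Arr Q = AA" "Dom Q x = (\<lambda>k\<in>K. Dom (c k) (x k))"
      "Cod Q x = (\<lambda>k\<in>K. Cod (c k) (x k))" "Ident Q y = (\<lambda>k\<in>K. Ident (c k) (y k))"
      "Comp Q = cc" for x y
    by (simp_all add: Q_def)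
  have AAk: "x k \<in> Arr (c k)" if "x \<in> AA" "k \<in> K" for x k
    using that(1) unfolding AA_def
  proof induction
    case (base x)
    then show ?case
      using is_functorD(4)[OF p(1)[OF that(2)]] is_functorD(4)[OF q(1)[OF that(2)]]
        p(2,3)[OF that(2)] q(2,3)[OF that(2)] that(2)
      by (auto simp: G0_def aA_def aB_def)
  next
    case (step g f)
    then have "composable (c k) (g k) (f k)"
      using that(2) by (auto simp: composable_def P_def)
    then show ?case
      using Comp_in[OF p(4)[OF that(2)]] that(2) by (simp add: cc_def)
  qed
  have AAe: "x \<in> extensional K" if "x \<in> AA" for x
    using that unfolding AA_def
    by induction (auto simp: G0_def aA_def aB_def cc_def extensional_def)
  have Obk: "y k \<in> Obj (c k)" if "y \<in> Ob" "k \<in> K" for y k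
    using is_functorD(3)[OF p(1)[OF that(2)]] is_functorD(3)[OF q(1)[OF that(2)]]
        p(2,3)[OF that(2)] q(2,3)[OF that(2)] that
    by (auto simp: Ob_def oA_def oB_def)
  have Obe: "y \<in> extensional K" if "y \<in> Ob" for y
    using that by (auto simp: Ob_def oA_def oB_def)
  have cQ: "composable Q g f \<longleftrightarrow> g \<in> AA \<and> f \<in> AA \<and> P g f" for g f
    by (auto simp: composable_def Q P_def restrict_def fun_eq_iff)
  have cK: "composable (c k) (g k) (f k)" if "composable Q g f" "k \<in> K" for g f k
    using that AAk[of g k] AAk[of f k] unfolding cQ by (simp add: composable_def P_def)
  have ccQ: "cc g f \<in> AA" "Dom Q (cc g f) = Dom Q f" "Cod Q (cc g f) = Cod Q g"
    if "composable Q g f" for g f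
  proof -
    show "cc g f \<in> AA"
      using that by (auto simp: cQ AA_def intro: gen.step)
    show "Dom Q (cc g f) = Dom Q f" "Cod Q (cc g f) = Cod Q g"
      unfolding Q cc_def
      using cK[OF that] Dom_Comp[OF p(4)] Cod_Comp[OF p(4)]
      by (auto intro!: restrict_ext)
  qed
  have gA: "aA m \<in> AA" "Dom Q (aA m) = oA (Dom A m)" "Cod Q (aA m) = oA (Cod A m)"
      if "m \<in> Arr A" for m
  proof -
    show "aA m \<in> AA"
      using that by (auto simp: AA_def G0_def intro: gen.base)
    show "Dom Q (aA m) = oA (Dom A m)" "Cod Q (aA m) = oA (Cod A m)"
      unfolding Q aA_def oA_def using is_functorD(5,6)[OF p(1)] p(2,3) that
      by (auto intro!: restrict_ext)
  qed
  have gB: "aB m \<in> AA" "Dom Q (aB m) = oB (Dom B m)" "Cod Q (aB m) = oB (Cod B m)"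
      if "m \<in> Arr B" for m
  proof -
    show "aB m \<in> AA"
      using that by (auto simp: AA_def G0_def intro: gen.base)
    show "Dom Q (aB m) = oB (Dom B m)" "Cod Q (aB m) = oB (Cod B m)"
      unfolding Q aB_def oB_def using is_functorD(5,6)[OF q(1)] q(2,3) that
      by (auto intro!: restrict_ext)
  qed
  have iA: "Ident Q (oA a) = aA (Ident A a)" if "a \<in> Obj A" for a
    unfolding Q aA_def oA_def using is_functorD(7)[OF p(1)] p(2,3) that
    by (auto intro!: restrict_ext)
  have iB: "Ident Q (oB a) = aB (Ident B a)" if "a \<in> Obj B" for a
    unfolding Q aB_def oB_def using is_functorD(7)[OF q(1)] q(2,3) that
    by (auto intro!: restrict_ext)
  have mA: "cc (aA n) (aA m) = aA (Comp A n m)" if "composable A n m" for n m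
    unfolding cc_def aA_def using is_functorD(8)[OF p(1)] p(2,3) that
    by (auto intro!: restrict_ext)
  have mB: "cc (aB n) (aB m) = aB (Comp B n m)" if "composable B n m" for n m
    unfolding cc_def aB_def using is_functorD(8)[OF q(1)] q(2,3) that
    by (auto intro!: restrict_ext)
  have DC: "Dom Q x \<in> Ob \<and> Cod Q x \<in> Ob" if "x \<in> AA" for x
    using that unfolding AA_def
  proof induction
    case (base x)
    then show ?case
      using gA gB AB by (auto simp: G0_def Ob_def Dom_in Cod_in)
  next
    case (step g f)
    then have "composable Q g f"
      by (simp add: cQ AA_def)
    then show ?case
      using step ccQ by simp
  qed
  have CQ: "category Q"
  proof (rule categoryI)
    fix x assume "x \<in> Arr Q"
    then have x: "x \<in> AA" by (simp add: Q)
    then show "Dom Q x \<in> Obj Q" "Cod Q x \<in> Obj Q"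
      using DC by (simp_all add: Q(1))
    show "Comp Q x (Ident Q (Dom Q x)) = x" "Comp Q (Ident Q (Cod Q x)) x = x"
      unfolding Q cc_def using AAk[OF x] Comp_Ident[OF p(4)] Ident_Comp[OF p(4)]
      by (auto intro!: extensionalityI[OF _ AAe[OF x]])
  next
    fix y assume "y \<in> Obj Q"
    then have y: "y \<in> Ob" by (simp add: Q)
    have "Ident Q y \<in> AA"
      using y AB iA iB gA(1) gB(1) by (auto simp: Ob_def Ident_in)
    moreover have "Dom Q (Ident Q y) = y" "Cod Q (Ident Q y) = y"
      unfolding Q using Obk[OF y] Dom_Ident[OF p(4)] Cod_Ident[OF p(4)]
      by (auto intro!: extensionalityI[OF _ Obe[OF y]])
    ultimately show "in_hom Q (Ident Q y) y y"
      by (simp add: in_hom_def Q(2))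
  next
    fix g f assume "composable Q g f"
    then show "in_hom Q (Comp Q g f) (Dom Q f) (Cod Q g)"
      using ccQ by (simp add: in_hom_def Q(2,6))
  next
    fix f g h assume "composable Q h g" "composable Q g f"
    then show "Comp Q h (Comp Q g f) = Comp Q (Comp Q h g) f"
      unfolding Q(6) using cK Comp_assoc[OF p(4)] by (auto simp: cc_def intro!: restrict_ext)
  qed
  obtain eo :: "_ \<Rightarrow> 'u" where eo: "inj_on eo Ob"
  proof -
    have "\<exists>e :: _ \<Rightarrow> 'u. inj_on e (gen Ob (\<lambda>_ _. False) cc)"
      unfolding Ob_def
      by (intro ex_inj_gen card_of_Un_ordLeq_infinite_Field card_of_Card_order
            ordLeq_transitive[OF card_of_image card_of_mono1])
        (simp_all add: infinite_UNIV Field_card_of)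
    then show ?thesis
      using that by (meson gen.base inj_on_subset subsetI)
  qed
  obtain ea :: "_ \<Rightarrow> 'u" where ea: "inj_on ea AA"
  proof -
    have "\<exists>e :: _ \<Rightarrow> 'u. inj_on e AA"
      unfolding AA_def G0_def
      by (intro ex_inj_gen card_of_Un_ordLeq_infinite_Field card_of_Card_order
            ordLeq_transitive[OF card_of_image card_of_mono1])
        (simp_all add: infinite_UNIV Field_card_of)
    then show ?thesis
      using that by blast
  qed
  define W where "W = transport eo ea Q"
  define en where "en = \<lparr>Src = Q, Tgt = W, OMap = restrict eo (Obj Q), AMap = restrict ea (Arr Q)\<rparr>"
  define de where "de = \<lparr>Src = W, Tgt = Q, OMap = restrict (inv_into (Obj Q) eo) (eo ` Obj Q),
           AMap = restrict (inv_into (Arr Q) ea) (ea ` Arr Q)\<rparr>"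
  have W: "ext_category W" "is_functor en" "is_functor de"
    using ext_category_transport[OF CQ, of eo ea] encode_functor[OF CQ, of eo ea]
      decode_functor[OF CQ, of eo ea] eo ea
    by (simp_all add: W_def en_def de_def Q(1,2))
  have Wsel: "Obj W = eo ` Ob" "Arr W = ea ` AA"
    by (simp_all add: W_def transport_def Let_def Q(1,2))
  have WC: "Comp W (ea g) (ea f) = ea (cc g f) \<and> composable W (ea g) (ea f)"
    if "composable Q g f" for g f
    using that is_functorD(8,9)[OF W(2), of g f] ccQ[OF that]
    by (simp add: en_def cQ Q(2,6))
  define iA' where "iA' = \<lparr>Src = A, Tgt = Q, OMap = restrict oA (Obj A), AMap = restrict aA (Arr A)\<rparr>"
  define iB' where "iB' = \<lparr>Src = B, Tgt = Q, OMap = restrict oB (Obj B), AMap = restrict aB (Arr B)\<rparr>"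
  have fA: "is_functor iA'"
    unfolding is_functor_def iA'_def funct.simps
  proof (intro conjI ballI allI impI)
    fix n m assume nm: "composable A n m"
    then show "restrict aA (Arr A) (Comp A n m) =
        Comp Q (restrict aA (Arr A) n) (restrict aA (Arr A) m)"
      using mA[OF nm] Comp_in[OF AB(3) nm] by (simp add: Q(6) composable_def)
  next
    show "restrict oA (Obj A) \<in> Obj A \<rightarrow>\<^sub>E Obj Q" "restrict aA (Arr A) \<in> Arr A \<rightarrow>\<^sub>E Arr Q"
      using gA(1) by (auto simp: Q(1,2) Ob_def)
  qed (use AB CQ gA iA in \<open>simp_all add: Ident_in Dom_in Cod_in\<close>)
  have fB: "is_functor iB'"
    unfolding is_functor_def iB'_def funct.simps
  proof (intro conjI ballI allI impI)
    fix n m assume nm: "composable B n m"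
    then show "restrict aB (Arr B) (Comp B n m) =
        Comp Q (restrict aB (Arr B) n) (restrict aB (Arr B) m)"
      using mB[OF nm] Comp_in[OF AB(4) nm] by (simp add: Q(6) composable_def)
  next
    show "restrict oB (Obj B) \<in> Obj B \<rightarrow>\<^sub>E Obj Q" "restrict aB (Arr B) \<in> Arr B \<rightarrow>\<^sub>E Arr Q"
      using gB(1) by (auto simp: Q(1,2) Ob_def)
  qed (use AB CQ gB iB in \<open>simp_all add: Ident_in Dom_in Cod_in\<close>)
  define i j where "i = en \<odot> iA'" and "j = en \<odot> iB'"
  have ij: "is_functor i" "is_functor j" "Src i = A" "Src j = B" "Tgt i = W" "Tgt j = W"
    using is_functor_fcomp[OF fA W(2)] is_functor_fcomp[OF fB W(2)]
    by (simp_all add: i_def j_def en_def iA'_def iB'_def)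
  have iv: "a \<in> Obj A \<Longrightarrow> OMap i a = eo (oA a)" "m \<in> Arr A \<Longrightarrow> AMap i m = ea (aA m)" for a m
    by (simp_all add: i_def en_def iA'_def fcomp_def Q(1,2) Ob_def gA(1))
  have jv: "a \<in> Obj B \<Longrightarrow> OMap j a = eo (oB a)" "m \<in> Arr B \<Longrightarrow> AMap j m = ea (aB m)" for a m
    by (simp_all add: j_def en_def iB'_def fcomp_def Q(1,2) Ob_def gB(1))
  have ijC: "i \<in> Arr CAT" "j \<in> Arr CAT"
    using ij AB W(1) by (simp_all add: Arr_CAT_iff)
  have oFG: "oA (OMap F x) = oB (OMap G x)" if "x \<in> Obj (Src F)" for x
  proof -
    have "OMap (fst k) (OMap F x) = OMap (snd k) (OMap G x)" if "k \<in> K" for k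
      using arg_cong[OF pq[OF that], of "\<lambda>H. OMap H x"] \<open>x \<in> Obj (Src F)\<close> FG(3) by simp
    then show ?thesis
      by (auto simp: oA_def oB_def intro!: restrict_ext)
  qed
  have aFG: "aA (AMap F x) = aB (AMap G x)" if "x \<in> Arr (Src F)" for x
  proof -
    have "AMap (fst k) (AMap F x) = AMap (snd k) (AMap G x)" if "k \<in> K" for k
      using arg_cong[OF pq[OF that], of "\<lambda>H. AMap H x"] \<open>x \<in> Arr (Src F)\<close> FG(3) by simp
    then show ?thesis
      by (auto simp: aA_def aB_def intro!: restrict_ext)
  qed
  have sq: "i \<odot> F = j \<odot> G"
  proof (rule funct_eqI)
    show "is_functor (i \<odot> F)" "is_functor (j \<odot> G)"
      using ij F by (auto intro!: is_functor_fcomp simp: A_def B_def)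
    fix x assume "x \<in> Obj (Src (i \<odot> F))"
    then show "OMap (i \<odot> F) x = OMap (j \<odot> G) x"
      using FG(3) is_functorD(3)[OF F(1)] is_functorD(3)[OF F(2)] oFG
      by (simp add: iv jv A_def B_def)
  next
    fix x assume "x \<in> Arr (Src (i \<odot> F))"
    then show "AMap (i \<odot> F) x = AMap (j \<odot> G) x"
      using FG(3) is_functorD(4)[OF F(1)] is_functorD(4)[OF F(2)] aFG
      by (simp add: iv jv A_def B_def)
  qed (use FG(3) ij in simp_all)
  have "\<exists>!m. in_hom CAT m W (Tgt p') \<and> m \<odot> i = p' \<and> m \<odot> j = q'"
    if k: "(p', q') \<in> K" for p' q'
  proof -
    let ?k = "(p', q')"
    define pr where "pr = \<lparr>Src = Q, Tgt = c ?k, OMap = (\<lambda>y\<in>Ob. y ?k), AMap = (\<lambda>x\<in>AA. x ?k)\<rparr>"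
    have "is_functor pr"
      unfolding is_functor_def pr_def funct.simps
    proof (intro conjI ballI allI impI)
      fix x assume "x \<in> Arr Q"
      then have x: "x \<in> AA" by (simp add: Q(2))
      show "Dom (c ?k) ((\<lambda>x\<in>AA. x ?k) x) = (\<lambda>y\<in>Ob. y ?k) (Dom Q x)"
        "Cod (c ?k) ((\<lambda>x\<in>AA. x ?k) x) = (\<lambda>y\<in>Ob. y ?k) (Cod Q x)"
        using x DC[OF x] k by (simp_all add: Q(3,4))
    next
      fix y assume y: "y \<in> Obj Q"
      have "Ident Q y \<in> AA"
        using Ident_in[OF CQ y] by (simp add: Q(2))
      then show "(\<lambda>x\<in>AA. x ?k) (Ident Q y) = Ident (c ?k) ((\<lambda>y\<in>Ob. y ?k) y)"
        using y k by (simp add: Q(1,5))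
    next
      fix g f assume gf: "composable Q g f"
      then show "(\<lambda>x\<in>AA. x ?k) (Comp Q g f) =
          Comp (c ?k) ((\<lambda>x\<in>AA. x ?k) g) ((\<lambda>x\<in>AA. x ?k) f)"
        using ccQ(1)[OF gf] k by (simp add: Q(6) cQ) (simp add: cc_def)
    qed (use CQ p(4)[OF k] k Obk AAk in \<open>auto simp: Q(1,2)\<close>)
    then have m: "is_functor (pr \<odot> de)"
      by (intro is_functor_fcomp W) (simp_all add: pr_def de_def)
    have mo: "OMap (pr \<odot> de) (eo y) = y ?k" if "y \<in> Ob" for y
      using that eo by (simp add: fcomp_def pr_def de_def Wsel Q(1))
    have ma: "AMap (pr \<odot> de) (ea x) = x ?k" if "x \<in> AA" for x
      using that ea by (simp add: fcomp_def pr_def de_def Wsel Q(2))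
    have st: "Src (pr \<odot> de) = W" "Tgt (pr \<odot> de) = Tgt p'"
      by (simp_all add: pr_def de_def c_def)
    have p': "is_functor p'" "Src p' = A" "ext_category (Tgt p')"
        "is_functor q'" "Src q' = B" "Tgt q' = Tgt p'"
      using k by (auto simp: K_def composable_def Arr_CAT_iff A_def B_def)
    have mp: "(pr \<odot> de) \<odot> i = p'"
    proof (rule funct_eqI)
      show "is_functor ((pr \<odot> de) \<odot> i)"
        using is_functor_fcomp[OF ij(1) m] ij st by simp
      fix x assume "x \<in> Obj (Src ((pr \<odot> de) \<odot> i))"
      then have x: "x \<in> Obj A" using ij by simp
      have "oA x \<in> Ob" using x by (simp add: Ob_def)
      then show "OMap ((pr \<odot> de) \<odot> i) x = OMap p' x"
        using x ij mo k by (simp add: iv) (simp add: oA_def)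
    next
      fix x assume "x \<in> Arr (Src ((pr \<odot> de) \<odot> i))"
      then have x: "x \<in> Arr A" using ij by simp
      show "AMap ((pr \<odot> de) \<odot> i) x = AMap p' x"
        using x ij ma[OF gA(1)[OF x]] k by (simp add: iv) (simp add: aA_def)
    qed (use p' ij st in simp_all)
    have mq: "(pr \<odot> de) \<odot> j = q'"
    proof (rule funct_eqI)
      show "is_functor ((pr \<odot> de) \<odot> j)"
        using is_functor_fcomp[OF ij(2) m] ij st by simp
      fix x assume "x \<in> Obj (Src ((pr \<odot> de) \<odot> j))"
      then have x: "x \<in> Obj B" using ij by simp
      have "oB x \<in> Ob" using x by (simp add: Ob_def)
      then show "OMap ((pr \<odot> de) \<odot> j) x = OMap q' x"
        using x ij mo k by (simp add: jv) (simp add: oB_def)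
    next
      fix x assume "x \<in> Arr (Src ((pr \<odot> de) \<odot> j))"
      then have x: "x \<in> Arr B" using ij by simp
      show "AMap ((pr \<odot> de) \<odot> j) x = AMap q' x"
        using x ij ma[OF gB(1)[OF x]] k by (simp add: jv) (simp add: aB_def)
    qed (use p' ij st in simp_all)
    show ?thesis
    proof (rule ex1I)
      show "in_hom CAT (pr \<odot> de) W (Tgt p') \<and> (pr \<odot> de) \<odot> i = p' \<and> (pr \<odot> de) \<odot> j = q'"
        using mp mq m st W(1) p' by (simp add: in_hom_def Arr_CAT_iff)
      fix n assume "in_hom CAT n W (Tgt p') \<and> n \<odot> i = p' \<and> n \<odot> j = q'"
      then have n: "is_functor n" "Src n = W" "Tgt n = Tgt p'" "n \<odot> i = p'" "n \<odot> j = q'"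
        by (auto simp: in_hom_def Arr_CAT_iff)
      have no: "OMap n (OMap i a) = OMap p' a" if "a \<in> Obj A" for a
        using arg_cong[OF n(4), of "\<lambda>H. OMap H a"] that ij by simp
      have no': "OMap n (OMap j a) = OMap q' a" if "a \<in> Obj B" for a
        using arg_cong[OF n(5), of "\<lambda>H. OMap H a"] that ij by simp
      have na: "AMap n (AMap i a) = AMap p' a" if "a \<in> Arr A" for a
        using arg_cong[OF n(4), of "\<lambda>H. AMap H a"] that ij by simp
      have na': "AMap n (AMap j a) = AMap q' a" if "a \<in> Arr B" for a
        using arg_cong[OF n(5), of "\<lambda>H. AMap H a"] that ij by simp
      have nea: "AMap n (ea x) = x ?k" if "x \<in> AA" for x
        using that unfolding AA_def
      proof induction
        case (base x)
        have "AMap n (ea (aA a)) = aA a ?k" if "a \<in> Arr A" for a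
          using na[OF that] iv(2)[OF that] k by (simp add: aA_def)
        moreover have "AMap n (ea (aB a)) = aB a ?k" if "a \<in> Arr B" for a
          using na'[OF that] jv(2)[OF that] k by (simp add: aB_def)
        ultimately show ?case
          using base by (auto simp: G0_def)
      next
        case (step g f)
        then have gf: "composable Q g f"
          by (simp add: cQ AA_def)
        have "cc g f ?k = Comp (Tgt n) (g ?k) (f ?k)"
          using k n(3) by (simp add: cc_def c_def)
        then show ?case
          using is_functorD(8)[OF n(1), of "ea g" "ea f"] WC[OF gf] step n(2) by simp
      qed
      show "n = pr \<odot> de"
      proof (rule funct_eqI[OF n(1) m])
        fix x assume "x \<in> Obj (Src n)"
        then obtain y where y: "y \<in> Ob" "x = eo y"
          by (auto simp: n(2) Wsel)
        have "OMap n (eo (oA a)) = oA a ?k" if "a \<in> Obj A" for a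
          using no[OF that] iv(1)[OF that] k by (simp add: oA_def)
        moreover have "OMap n (eo (oB a)) = oB a ?k" if "a \<in> Obj B" for a
          using no'[OF that] jv(1)[OF that] k by (simp add: oB_def)
        ultimately show "OMap n x = OMap (pr \<odot> de) x"
          using mo[OF y(1)] y by (auto simp: Ob_def)
      next
        fix x assume "x \<in> Arr (Src n)"
        then obtain y where y: "y \<in> AA" "x = ea y"
          by (auto simp: n(2) Wsel)
        then show "AMap n x = AMap (pr \<odot> de) x"
          using ma[OF y(1)] nea[OF y(1)] by simp
      qed (use n st in simp_all)
    qed
  qed
  then have "is_pushout CAT F G i j"
    using sq ij ijC FG
    by (auto simp: is_pushout_def composable_def K_def A_def[symmetric] B_def[symmetric])
  then show ?thesis
    by blast
qed

lemma ex_pushout_choice: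
  "\<exists>po. pushout_choice (CAT :: ('u::infinite small_cat, 'u small_funct) cat) po"
proof -
  have "\<exists>x. is_pushout CAT F G (fst x) (snd x)"
    if "F \<in> Arr CAT" "G \<in> Arr CAT" "Src F = Src G" for F G :: "'u small_funct"
    using ex_pushout[OF that] by simp
  then have "pushout_choice CAT
      (\<lambda>F G :: 'u small_funct. SOME x. is_pushout CAT F G (fst x) (snd x))"
    unfolding pushout_choice_def by (auto intro: someI_ex)
  then show ?thesis
    by blast
qed

end

theory Submission
  imports Defs
begin

text \<open>By the universal property of the pushout \<open>E f\<close>, a retraction \<open>p\<close> of \<open>L f\<close> over \<open>B\<close> is the same
  as a functor \<open>q : J f \<rightarrow> A\<close> with \<open>q \<odot> S f = \<iota>\<close> and \<open>f \<odot> q = T f\<close>.  Since \<open>J \<langle>\<alpha>, 1\<rangle>\<close> is invertible, the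
  multiplication law for \<open>p\<close> becomes \<open>q \<odot> \<nu> = q \<odot> J \<langle>q, 1\<rangle>\<close>, that is, \<open>q (a, v \<circ> u) = q (q (a, u), v)\<close>
  on objects and likewise on arrows.  Such a \<open>q\<close> is a lens: \<open>\<phi> a u\<close> is the image of the arrow
  \<open>u : (a, 1) \<rightarrow> (a, u)\<close> of \<open>J f\<close>, and \<open>q\<close> is recovered from \<open>\<phi>\<close> because the law sends the arrow \<open>v\<close>
  out of \<open>(a, u)\<close> to \<open>\<phi> (cod (\<phi> a u)) v\<close>; functoriality of \<open>q\<close> is then axiom (L3).\<close>

section \<open>Categories, functors and isomorphisms\<close>

text \<open>The choice \<open>po\<close> is arbitrary, so \<open>E f\<close> is known only through
  its universal property and its arrows are never described. The obstacle is the inverse of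
  \<open>J \<langle>\<alpha>, 1\<rangle>\<close> in the definition of \<mu>: its existence rests on
  \<alpha> being bijective on objects. This is extracted from the universal property by mapping
  \<open>E f\<close> into chaotic categories, since a functor into one is merely a map on objects.
  The bijection suffices because \<open>J g\<close> sees the domain of \<open>g\<close> only through
  its objects. Equations between functors out of \<open>E f\<close> are checked on the two legs of
  the pushout. When algebras are compared with lenses, the leg \<open>L f\<close> contributes only
  the unit law, so what remains are equations out of \<open>J f\<close>, whose objects and arrows
  have explicit codes. The result is an isomorphism and not just an equivalence because functors are
  extensional and a lifting is \<open>undefined\<close> off its domain: each structure has exactly
  one representing record, and it is enough to give bijections on objects and on arrows.\<close>

lemma composable_Comp:
  assumes C: "category C" and vu: "composable C v u" and w: "composable C w (Comp C v u)"
  shows "composable C w v" "composable C (Comp C w v) u"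
    "Comp C w (Comp C v u) = Comp C (Comp C w v) u"
proof -
  show wv: "composable C w v"
    using vu w C by (auto simp: composable_def Cod_Comp)
  show "composable C (Comp C w v) u"
    using vu wv C by (auto simp: composable_def Dom_Comp Comp_in)
  show "Comp C w (Comp C v u) = Comp C (Comp C w v) u"
    using Comp_assoc[OF C wv vu] .
qed

lemma composable_Comp':
  "category C \<Longrightarrow> composable C v u \<Longrightarrow> composable C w v \<Longrightarrow> composable C w (Comp C v u)"
  by (simp add: composable_def Comp_in Cod_Comp)

lemma Comp_Ident': "category C \<Longrightarrow> u \<in> Arr C \<Longrightarrow> Dom C u = x \<Longrightarrow> Comp C u (Ident C x) = u"
  and Ident_Comp': "category C \<Longrightarrow> u \<in> Arr C \<Longrightarrow> Cod C u = x \<Longrightarrow> Comp C (Ident C x) u = u"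
  by (auto simp: Comp_Ident Ident_Comp)

lemma in_hom_CAT_iff:
  "in_hom CAT F A B \<longleftrightarrow>
     is_functor F \<and> Src F = A \<and> Tgt F = B \<and> ext_category A \<and> ext_category B"
  by (auto simp: in_hom_def Arr_CAT_iff)

lemma Arr_CAT_in_hom: "F \<in> Arr CAT \<Longrightarrow> in_hom CAT F (Src F) (Tgt F)"
  by (simp add: in_hom_def)

lemma idf_simps [simp]: "Src (idf C) = C" "Tgt (idf C) = C"
  "x \<in> Obj C \<Longrightarrow> OMap (idf C) x = x" "m \<in> Arr C \<Longrightarrow> AMap (idf C) m = m"
  by (simp_all add: idf_def)

lemma is_functor_idf: "category C \<Longrightarrow> is_functor (idf C)"
  unfolding is_functor_def idf_def
  by (auto simp: Dom_in Cod_in Ident_in Comp_in) (auto simp: composable_def)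

lemma fcomp_idf: "is_functor F \<Longrightarrow> Src F = C \<Longrightarrow> F \<odot> idf C = F"
  by (rule funct_eqI) (auto intro!: is_functor_fcomp is_functor_idf simp: is_functorD)

lemma idf_fcomp: "is_functor F \<Longrightarrow> Tgt F = C \<Longrightarrow> idf C \<odot> F = F"
  by (rule funct_eqI) (auto intro!: is_functor_fcomp is_functor_idf simp: is_functorD)

lemma fcomp_assoc:
  assumes "is_functor F" "is_functor G" "is_functor H" "Src G = Tgt F" "Src H = Tgt G"
  shows "(H \<odot> G) \<odot> F = H \<odot> G \<odot> F"
  by (rule funct_eqI)
    (use assms in \<open>auto intro!: is_functor_fcomp simp: is_functorD\<close>)

lemma CAT_Obj_Ident: "Obj CAT = {C. ext_category C}" "Ident CAT = idf"
  by (simp_all add: CAT_def)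

lemma category_CAT: "category CAT"
proof (rule categoryI)
  fix F G H :: "'a small_funct"
  assume "composable CAT H G" "composable CAT G F"
  then show "Comp CAT H (Comp CAT G F) = Comp CAT (Comp CAT H G) F"
    by (simp add: composable_def Arr_CAT_iff fcomp_assoc)
next
  fix C :: "'a small_cat"
  assume "C \<in> Obj CAT"
  then show "in_hom CAT (Ident CAT C) C C"
    by (simp add: in_hom_CAT_iff CAT_Obj_Ident ext_categoryD is_functor_idf)
qed (simp_all add: in_hom_CAT_iff composable_def Arr_CAT_iff fcomp_idf idf_fcomp is_functor_fcomp
    CAT_Obj_Ident)

text \<open>The inverse maps respect endpoints, identities and composites automatically: apply
  \<open>F\<close> to both sides and use its injectivity. Serves both the final isomorphism and the
  inverse of \<open>J \<langle>\<alpha>, 1\<rangle>\<close>.\<close>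

lemma bij_functor_inverse:
  assumes F: "is_functor F"
    and o: "bij_betw (OMap F) (Obj (Src F)) (Obj (Tgt F))"
    and a: "bij_betw (AMap F) (Arr (Src F)) (Arr (Tgt F))"
  shows "\<exists>G. is_functor G \<and> Src G = Tgt F \<and> Tgt G = Src F \<and>
    G \<odot> F = idf (Src F) \<and> F \<odot> G = idf (Tgt F)"
proof -
  define C D where "C = Src F" and "D = Tgt F"
  define io ia where "io = inv_into (Obj C) (OMap F)" and "ia = inv_into (Arr C) (AMap F)"
  note FD = is_functorD[OF F, folded C_def D_def]
  have io: "\<And>y. y \<in> Obj D \<Longrightarrow> io y \<in> Obj C" "\<And>y. y \<in> Obj D \<Longrightarrow> OMap F (io y) = y"
      "\<And>x. x \<in> Obj C \<Longrightarrow> io (OMap F x) = x"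
    and ia: "\<And>n. n \<in> Arr D \<Longrightarrow> ia n \<in> Arr C" "\<And>n. n \<in> Arr D \<Longrightarrow> AMap F (ia n) = n"
      "\<And>m. m \<in> Arr C \<Longrightarrow> ia (AMap F m) = m"
    using o a bij_betw_inv_into[OF o] bij_betw_inv_into[OF a]
    by (auto simp: io_def ia_def C_def D_def bij_betw_inv_into_left bij_betw_inv_into_right
        dest: bij_betwE)
  define G where "G = \<lparr>Src = D, Tgt = C, OMap = restrict io (Obj D), AMap = restrict ia (Arr D)\<rparr>"
  have d: "Dom C (ia n) = io (Dom D n)" "Cod C (ia n) = io (Cod D n)" if "n \<in> Arr D" for n
    using FD(5,6)[OF ia(1)[OF that]] ia(1,2)[OF that] io(3) Dom_in[OF FD(1)] Cod_in[OF FD(1)]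
    by metis+
  have c: "composable C (ia n) (ia m)" if "composable D n m" for n m
    using that ia(1) d by (auto simp: composable_def)
  have G: "is_functor G"
    unfolding is_functor_def G_def funct.simps
  proof (intro conjI ballI allI impI)
    fix x assume x: "x \<in> Obj D"
    have "AMap F (Ident C (io x)) = Ident D x"
      using FD(7)[OF io(1)[OF x]] io(2)[OF x] by simp
    then show "restrict ia (Arr D) (Ident D x) = Ident C (restrict io (Obj D) x)"
      using x io(1)[OF x] ia(3)[of "Ident C (io x)"] FD(1,2) by (simp add: Ident_in)
  next
    fix m n assume nm: "composable D n m"
    have "AMap F (Comp C (ia n) (ia m)) = Comp D n m"
      using FD(8)[OF c[OF nm]] nm by (simp add: composable_def ia)
    then show "restrict ia (Arr D) (Comp D n m) =
        Comp C (restrict ia (Arr D) n) (restrict ia (Arr D) m)"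
      using nm ia(3)[of "Comp C (ia n) (ia m)"] Comp_in[OF FD(1) c[OF nm]] Comp_in[OF FD(2) nm]
      by (simp add: composable_def)
  qed (use FD(1,2) io(1) ia(1) d Dom_in[OF FD(2)] Cod_in[OF FD(2)] in simp_all)
  have G': "is_functor (G \<odot> F)" "is_functor (F \<odot> G)"
    using F G by (auto intro!: is_functor_fcomp simp: C_def D_def G_def)
  have "G \<odot> F = idf C"
    using io(3) ia(3) FD(3,4)
    by (intro funct_eqI G' is_functor_idf FD(1)) (simp_all add: C_def[symmetric], simp_all add: G_def C_def D_def)
  moreover have "F \<odot> G = idf D"
    using io(1,2) ia(1,2)
    by (intro funct_eqI G' is_functor_idf FD(2)) (simp_all add: G_def D_def)
  moreover have "Src G = D" "Tgt G = C"
    by (simp_all add: G_def)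
  ultimately show ?thesis
    using G unfolding C_def D_def by blast
qed

lemma isomorphic_categoriesI:
  assumes "is_functor F" "bij_betw (OMap F) (Obj (Src F)) (Obj (Tgt F))"
    "bij_betw (AMap F) (Arr (Src F)) (Arr (Tgt F))"
  shows "isomorphic_categories (Src F) (Tgt F)"
  using bij_functor_inverse[OF assms] assms(1) unfolding isomorphic_categories_def by blast

lemma inverse_arrow_eqI:
  assumes C: "category C" and f: "f \<in> Arr C" and g: "is_inverse C f g"
  shows "inverse_arrow C f = g"
  unfolding inverse_arrow_def
proof (rule the_equality)
  fix h assume h: "is_inverse C f h"
  have gh: "g \<in> Arr C" "h \<in> Arr C" "Dom C g = Cod C f" "Cod C g = Dom C f"
      "Dom C h = Cod C f" "Cod C h = Dom C f"
    using g h by (auto simp: is_inverse_def in_hom_def)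
  have "h = Comp C h (Comp C f g)"
    using g gh Comp_Ident[OF C gh(2)] by (simp add: is_inverse_def)
  also have "\<dots> = Comp C (Comp C h f) g"
    using gh f by (intro Comp_assoc[OF C]) (simp_all add: composable_def)
  also have "\<dots> = g"
    using h gh Ident_Comp[OF C gh(1)] by (simp add: is_inverse_def)
  finally show "h = g" .
qed (rule g)

section \<open>Arrow categories and Eilenberg-Moore categories\<close>

lemma arrow_category_simps [simp]:
  "Obj (arrow_category C) = Arr C" "Dom (arrow_category C) = Sdom" "Cod (arrow_category C) = Scod"
  "Ident (arrow_category C) f = \<lparr>Sdom = f, Scod = f, Smap = (Ident C (Dom C f), Ident C (Cod C f))\<rparr>"
  "Comp (arrow_category C) t s = \<lparr>Sdom = Sdom s, Scod = Scod t,
        Smap = (Comp C (fst (Smap t)) (fst (Smap s)), Comp C (snd (Smap t)) (snd (Smap s)))\<rparr>"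
  by (simp_all add: arrow_category_def)

lemma Arr_arrow_category:
  "s \<in> Arr (arrow_category C) \<longleftrightarrow> Sdom s \<in> Arr C \<and> Scod s \<in> Arr C \<and>
     in_hom C (fst (Smap s)) (Dom C (Sdom s)) (Dom C (Scod s)) \<and>
     in_hom C (snd (Smap s)) (Cod C (Sdom s)) (Cod C (Scod s)) \<and>
     Comp C (snd (Smap s)) (Sdom s) = Comp C (Scod s) (fst (Smap s))"
  unfolding arrow_category_def by (cases s) (auto split: prod.splits)

lemma category_arrow_category:
  assumes C: "category C"
  shows "category (arrow_category C)"
proof (rule categoryI)
  fix s t assume st: "composable (arrow_category C) t s"
  then have s: "s \<in> Arr (arrow_category C)" and t: "t \<in> Arr (arrow_category C)"
    and e: "Sdom t = Scod s"
    by (auto simp: composable_def)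
  note s = s[unfolded Arr_arrow_category in_hom_def] and t = t[unfolded Arr_arrow_category in_hom_def]
  have c: "composable C (fst (Smap t)) (fst (Smap s))" "composable C (snd (Smap t)) (snd (Smap s))"
      "composable C (snd (Smap s)) (Sdom s)" "composable C (snd (Smap t)) (Scod s)"
      "composable C (Scod s) (fst (Smap s))" "composable C (Scod t) (fst (Smap t))"
    using s t e by (auto simp: composable_def)
  have "Comp C (Comp C (snd (Smap t)) (snd (Smap s))) (Sdom s) =
      Comp C (snd (Smap t)) (Comp C (Scod s) (fst (Smap s)))"
    using s Comp_assoc[OF C c(2,3)] by simp
  also have "\<dots> = Comp C (Comp C (Scod t) (fst (Smap t))) (fst (Smap s))"
    using t e Comp_assoc[OF C c(4,5)] by simp
  also have "\<dots> = Comp C (Scod t) (Comp C (fst (Smap t)) (fst (Smap s)))"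
    using Comp_assoc[OF C c(6,1)] by simp
  finally show "in_hom (arrow_category C) (Comp (arrow_category C) t s)
      (Dom (arrow_category C) s) (Cod (arrow_category C) t)"
    using s t e c Comp_in[OF C] Dom_Comp[OF C] Cod_Comp[OF C]
    by (simp add: in_hom_def Arr_arrow_category)
next
  fix s t r assume "composable (arrow_category C) r t" "composable (arrow_category C) t s"
  then show "Comp (arrow_category C) r (Comp (arrow_category C) t s) =
      Comp (arrow_category C) (Comp (arrow_category C) r t) s"
    by (auto simp: composable_def Arr_arrow_category in_hom_def intro!: Comp_assoc[OF C])
qed (use C in \<open>auto simp: in_hom_def Arr_arrow_category category_simps Comp_Ident' Ident_Comp'\<close>)

lemma algebra_category_simps [simp]:
  "Obj (algebra_category C T \<eta> \<mu>) = {X. is_algebra C T \<eta> \<mu> X}"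
  "Dom (algebra_category C T \<eta> \<mu>) = Sdom" "Cod (algebra_category C T \<eta> \<mu>) = Scod"
  "Ident (algebra_category C T \<eta> \<mu>) X = \<lparr>Sdom = X, Scod = X, Smap = Ident C (fst X)\<rparr>"
  "Comp (algebra_category C T \<eta> \<mu>) t s =
     \<lparr>Sdom = Sdom s, Scod = Scod t, Smap = Comp C (Smap t) (Smap s)\<rparr>"
  by (simp_all add: algebra_category_def)

lemma Arr_algebra_category:
  "s \<in> Arr (algebra_category C T \<eta> \<mu>) \<longleftrightarrow>
     is_algebra C T \<eta> \<mu> (Sdom s) \<and> is_algebra C T \<eta> \<mu> (Scod s) \<and>
     in_hom C (Smap s) (fst (Sdom s)) (fst (Scod s)) \<and>
     Comp C (Smap s) (snd (Sdom s)) = Comp C (snd (Scod s)) (AMap T (Smap s))"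
  unfolding algebra_category_def by (cases s) (auto split: prod.splits)

text \<open>Algebra morphisms compose by pasting their squares, where functoriality turns
  \<open>T t \<circ> T s\<close> into \<open>T (t \<circ> s)\<close>.\<close>

lemma category_algebra_category:
  assumes T: "is_functor T" and C: "Src T = C" "Tgt T = C"
  shows "category (algebra_category C T \<eta> \<mu>)"
proof -
  note TD = is_functorD[OF T, unfolded C]
  have alg: "fst X \<in> Obj C" "snd X \<in> Arr C" "Dom C (snd X) = OMap T (fst X)"
      "Cod C (snd X) = fst X" if "is_algebra C T \<eta> \<mu> X" for X
    using that by (auto simp: is_algebra_def in_hom_def split: prod.splits)
  show ?thesis
  proof (rule categoryI)
    fix X assume "X \<in> Obj (algebra_category C T \<eta> \<mu>)"
    then show "in_hom (algebra_category C T \<eta> \<mu>) (Ident (algebra_category C T \<eta> \<mu>) X) X X"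
      using alg[of X] TD(1,7)
      by (simp add: in_hom_def Arr_algebra_category category_simps Comp_Ident' Ident_Comp')
  next
    fix s t assume st: "composable (algebra_category C T \<eta> \<mu>) t s"
    then have s: "s \<in> Arr (algebra_category C T \<eta> \<mu>)" and t: "t \<in> Arr (algebra_category C T \<eta> \<mu>)"
      and e: "Sdom t = Scod s"
      by (auto simp: composable_def)
    note s = s[unfolded Arr_algebra_category in_hom_def]
      and t = t[unfolded Arr_algebra_category in_hom_def]
    have a: "is_algebra C T \<eta> \<mu> (Sdom s)" "is_algebra C T \<eta> \<mu> (Scod s)" "is_algebra C T \<eta> \<mu> (Scod t)"
      using s t by auto
    have c: "composable C (Smap t) (Smap s)" "composable C (Smap s) (snd (Sdom s))"
      "composable C (Smap t) (snd (Scod s))" "composable C (snd (Scod s)) (AMap T (Smap s))"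
      "composable C (snd (Scod t)) (AMap T (Smap t))"
      using s t e alg a TD by (auto simp: composable_def)
    have "Comp C (Comp C (Smap t) (Smap s)) (snd (Sdom s)) =
        Comp C (Smap t) (Comp C (snd (Scod s)) (AMap T (Smap s)))"
      using s Comp_assoc[OF TD(1) c(1,2)] by simp
    also have "\<dots> = Comp C (Comp C (snd (Scod t)) (AMap T (Smap t))) (AMap T (Smap s))"
      using t e Comp_assoc[OF TD(1) c(3,4)] by simp
    also have "\<dots> = Comp C (snd (Scod t)) (AMap T (Comp C (Smap t) (Smap s)))"
      using Comp_assoc[OF TD(1) c(5)] TD(8,9)[OF c(1)] by simp
    finally show "in_hom (algebra_category C T \<eta> \<mu>) (Comp (algebra_category C T \<eta> \<mu>) t s)
        (Dom (algebra_category C T \<eta> \<mu>) s) (Cod (algebra_category C T \<eta> \<mu>) t)"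
      using s t c(1) TD(1)
      by (simp add: in_hom_def Arr_algebra_category Comp_in Dom_Comp Cod_Comp)
  next
    fix s t r
    assume "composable (algebra_category C T \<eta> \<mu>) r t" "composable (algebra_category C T \<eta> \<mu>) t s"
    then show "Comp (algebra_category C T \<eta> \<mu>) r (Comp (algebra_category C T \<eta> \<mu>) t s) =
        Comp (algebra_category C T \<eta> \<mu>) (Comp (algebra_category C T \<eta> \<mu>) r t) s"
      by (auto simp: composable_def Arr_algebra_category in_hom_def intro!: Comp_assoc[OF TD(1)])
  qed (use TD(1) in \<open>auto simp: in_hom_def Arr_algebra_category Comp_Ident' Ident_Comp'\<close>)
qed

section \<open>The comprehensive factorisation on arrows\<close>

lemma composable_discr:
  "category A \<Longrightarrow> composable (discr A) g f \<longleftrightarrow> f \<in> Ident A ` Obj A \<and> g = f"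
  by (auto simp: composable_def discr_def category_simps)

lemma Obj_discr [simp]: "Obj (discr A) = Obj A" and Ident_discr [simp]: "Ident (discr A) = Ident A"
  and Arr_discr: "Arr (discr A) = Ident A ` Obj A"
  by (simp_all add: discr_def)

text \<open>Every arrow of \<open>discr A\<close> is an identity, so preservation of identities
  settles the arrow maps. Equations out of a discrete category thereby become pointwise equations on
  objects.\<close>

lemma funct_discr_eqI:
  assumes "is_functor F" "is_functor G" "Src F = discr A" "Src G = discr A" "Tgt F = Tgt G"
    "\<And>x. x \<in> Obj A \<Longrightarrow> OMap F x = OMap G x"
  shows "F = G"
proof (rule funct_eqI)
  fix m assume "m \<in> Arr (Src F)"
  then show "AMap F m = AMap G m"
    using assms is_functorD(7)[OF assms(1)] is_functorD(7)[OF assms(2)] by (auto simp: Arr_discr)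
qed (use assms in auto)

lemma iota_simps [simp]: "Src (iota A) = discr A" "Tgt (iota A) = A"
  "x \<in> Obj A \<Longrightarrow> OMap (iota A) x = x"
  by (simp_all add: iota_def)

lemma iota_in_CAT:
  assumes A: "ext_category A"
  shows "iota A \<in> Arr CAT"
proof -
  have A': "category A" and D: "category (discr A)" "ext_category (discr A)"
    using A by (simp_all add: ext_categoryD ext_category_discr)
  have i: "Comp A (Ident A x) (Ident A x) = Ident A x" if "x \<in> Obj A" for x
    using that A' by (simp add: category_simps Comp_Ident')
  have "is_functor (iota A)"
    unfolding is_functor_def
    using A' D by (auto simp: composable_discr Arr_discr category_simps i iota_def)
      (auto simp: discr_def i category_simps)
  then show ?thesis
    using A D by (simp add: Arr_CAT_iff)
qed

lemma S_simps [simp]: "Src (S_fun f) = discr (Src f)" "Tgt (S_fun f) = J_cat f"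
  "a \<in> Obj (Src f) \<Longrightarrow> OMap (S_fun f) a = enc (a, Ident (Tgt f) (OMap f a))"
  by (simp_all add: S_fun_def Let_def)

lemma T_simps [simp]: "Src (T_fun f) = J_cat f" "Tgt (T_fun f) = Tgt f"
  by (simp_all add: T_fun_def)

lemma is_functor_T: "f \<in> Arr CAT \<Longrightarrow> is_functor (T_fun (f :: 'u::infinite small_funct))"
  and is_functor_S: "f \<in> Arr CAT \<Longrightarrow> is_functor (S_fun f)"
  using T_in_CAT[of f] S_in_CAT[of f] by (simp_all add: Arr_CAT_iff)

lemma Obj_JI: "liftable f a u \<Longrightarrow> enc (a, u) \<in> Obj (J_cat f)"
  and Arr_JI: "liftable f a u \<Longrightarrow> composable (Tgt f) v u \<Longrightarrow> enc (enc (a, u), v) \<in> Arr (J_cat f)"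
  by (auto simp: Obj_J Arr_J)

lemma T_Obj [simp]: "liftable f a u \<Longrightarrow> OMap (T_fun f) (enc (a, u) :: 'u::infinite) = Cod (Tgt f) u"
  and T_Arr [simp]: "liftable f a u \<Longrightarrow> composable (Tgt f) v u \<Longrightarrow>
    AMap (T_fun f) (enc (enc (a, u), v) :: 'u) = v"
  using Obj_JI[of f a u] Arr_JI[of f a u v] by (simp_all add: T_fun_def)

lemma discr_map_simps [simp]: "Src (discr_map h) = discr (Src h)" "Tgt (discr_map h) = discr (Tgt h)"
  "OMap (discr_map h) = OMap h"
  by (simp_all add: discr_map_def)

lemma is_functor_discr_map:
  assumes "h \<in> Arr CAT"
  shows "is_functor (discr_map h)"
proof -
  have h: "is_functor h" and A: "category (Src h)" "category (Tgt h)"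
    and D: "category (discr (Src h))" "category (discr (Tgt h))"
    using assms by (auto simp: Arr_CAT_iff ext_categoryD ext_category_discr)
  note hD = is_functorD[OF h]
  show ?thesis
    unfolding is_functor_def
    using A D hD(3,7,10)
    by (auto simp: composable_discr Arr_discr PiE_def) (auto simp: discr_def discr_map_def category_simps)
qed

section \<open>Functors out of \<open>J f\<close>\<close>

definition J_out ::
  "'u small_funct \<Rightarrow> 'u small_cat \<Rightarrow> ('u \<Rightarrow> 'u \<Rightarrow> 'u) \<Rightarrow> ('u \<Rightarrow> 'u \<Rightarrow> 'u \<Rightarrow> 'u) \<Rightarrow> 'u small_funct" where
  "J_out f D o' r = \<lparr>Src = J_cat f, Tgt = D,
     OMap = (\<lambda>x\<in>Obj (J_cat f). case dec x of (a, u) \<Rightarrow> o' a u),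
     AMap = (\<lambda>m\<in>Arr (J_cat f). case dec m of (x, v) \<Rightarrow> case dec x of (a, u) \<Rightarrow> r a u v)\<rparr>"

lemma J_out_simps [simp]:
  fixes f :: "'u::infinite small_funct"
  shows "Src (J_out f D o' r) = J_cat f" "Tgt (J_out f D o' r) = D"
    "liftable f a u \<Longrightarrow> OMap (J_out f D o' r) (enc (a, u)) = o' a u"
    "liftable f a u \<Longrightarrow> composable (Tgt f) v u \<Longrightarrow>
       AMap (J_out f D o' r) (enc (enc (a, u), v)) = r a u v"
  using Obj_JI[of f a u] Arr_JI[of f a u v] by (simp_all add: J_out_def)

lemma liftable_Comp:
  assumes "f \<in> Arr CAT" "liftable f a u" "composable (Tgt f) v u"
  shows "liftable f a (Comp (Tgt f) v u)"
proof -
  have "category (Tgt f)"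
    using assms(1) by (simp add: Arr_CAT_iff ext_categoryD)
  then show ?thesis
    using assms(2,3) by (simp add: liftable_def Comp_in Dom_Comp)
qed

lemma composable_Ident:
  "category C \<Longrightarrow> u \<in> Arr C \<Longrightarrow> Cod C u = x \<Longrightarrow> composable C (Ident C x) u"
  by (auto simp: composable_def category_simps)

lemma composable_Ident2:
  "category C \<Longrightarrow> u \<in> Arr C \<Longrightarrow> Dom C u = x \<Longrightarrow> composable C u (Ident C x)"
  by (auto simp: composable_def category_simps)

text \<open>An arrow composable with the one coded by \<open>(a, u), v\<close> starts at
  \<open>(a, v \<circ> u)\<close>, so preservation of composites comes down to the cocycle condition
  \<open>rc\<close>. The functors \<open>J \<langle>h, k\<rangle>\<close> and \<nu> and the functor
  of a lens are all built this way.\<close>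

lemma J_out_in_CAT:
  fixes f :: "'u::infinite small_funct"
  assumes f: "f \<in> Arr CAT" and D: "ext_category D"
    and o': "\<And>a u. liftable f a u \<Longrightarrow> o' a u \<in> Obj D"
    and r: "\<And>a u v. liftable f a u \<Longrightarrow> composable (Tgt f) v u \<Longrightarrow>
      in_hom D (r a u v) (o' a u) (o' a (Comp (Tgt f) v u))"
    and ri: "\<And>a u. liftable f a u \<Longrightarrow> r a u (Ident (Tgt f) (Cod (Tgt f) u)) = Ident D (o' a u)"
    and rc: "\<And>a u v w. liftable f a u \<Longrightarrow> composable (Tgt f) v u \<Longrightarrow> composable (Tgt f) w v \<Longrightarrow>
      r a u (Comp (Tgt f) w v) = Comp D (r a (Comp (Tgt f) v u) w) (r a u v)"
  shows "J_out f D o' r \<in> Arr CAT"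
proof -
  let ?F = "J_out f D o' r"
  have B: "category (Tgt f)" and J: "category (J_cat f)"
    using f ext_category_J[OF f] by (simp_all add: Arr_CAT_iff ext_categoryD)
  have ci: "composable (Tgt f) (Ident (Tgt f) (Cod (Tgt f) u)) u" if "liftable f a u" for a u
    using that B by (simp add: liftable_def composable_Ident)
  have "is_functor ?F"
    unfolding is_functor_def
  proof (intro conjI ballI allI impI)
    show "OMap ?F \<in> Obj (Src ?F) \<rightarrow>\<^sub>E Obj (Tgt ?F)" "AMap ?F \<in> Arr (Src ?F) \<rightarrow>\<^sub>E Arr (Tgt ?F)"
      using o' r by (auto simp: J_out_def Obj_J Arr_J in_hom_def)
  next
    fix m assume "m \<in> Arr (Src ?F)"
    then show "Dom (Tgt ?F) (AMap ?F m) = OMap ?F (Dom (Src ?F) m)"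
        "Cod (Tgt ?F) (AMap ?F m) = OMap ?F (Cod (Src ?F) m)"
      using r liftable_Comp[OF f] by (auto simp: Arr_J Dom_J Cod_J in_hom_def)
  next
    fix x assume "x \<in> Obj (Src ?F)"
    then show "AMap ?F (Ident (Src ?F) x) = Ident (Tgt ?F) (OMap ?F x)"
      using ri ci by (auto simp: Obj_J Ident_J)
  next
    fix m n assume "composable (Src ?F) n m"
    then obtain a u v w where c: "liftable f a u" "composable (Tgt f) v u"
        "liftable f a (Comp (Tgt f) v u)" "composable (Tgt f) w (Comp (Tgt f) v u)"
      and mn: "m = enc (enc (a, u), v)" "n = enc (enc (a, Comp (Tgt f) v u), w)"
      by (auto simp: composable_J)
    then show "AMap ?F (Comp (Src ?F) n m) = Comp (Tgt ?F) (AMap ?F n) (AMap ?F m)"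
      using rc[OF c(1,2)] composable_Comp[OF B c(2,4)] by (simp add: Comp_J)
  qed (use J D in \<open>simp_all add: ext_categoryD\<close>)
  then show ?thesis
    using D ext_category_J[OF f] by (simp add: Arr_CAT_iff)
qed

lemma J_eqI:
  fixes f :: "'u::infinite small_funct"
  assumes "is_functor F" "is_functor G" "Src F = J_cat f" "Src G = J_cat f" "Tgt F = Tgt G"
    "\<And>a u. liftable f a u \<Longrightarrow> OMap F (enc (a, u)) = OMap G (enc (a, u))"
    "\<And>a u v. liftable f a u \<Longrightarrow> composable (Tgt f) v u \<Longrightarrow>
       AMap F (enc (enc (a, u), v)) = AMap G (enc (enc (a, u), v))"
  shows "F = G"
  by (rule funct_eqI) (use assms in \<open>auto simp: Obj_J Arr_J\<close>)

text \<open>Uniqueness of the diagonal filler: the object \<open>(a, u)\<close> receives the arrow given by \<open>u\<close>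
  from \<open>(a, 1)\<close>.\<close>

lemma J_filler_unique:
  fixes f :: "'u::infinite small_funct"
  assumes f: "f \<in> Arr CAT" and T: "discrete_opfibration T"
    and F: "is_functor F" "Src F = J_cat f" "Tgt F = Src T"
    and G: "is_functor G" "Src G = J_cat f" "Tgt G = Src T"
    and S: "F \<odot> S_fun f = G \<odot> S_fun f" and TF: "T \<odot> F = T \<odot> G"
  shows "F = G"
proof -
  have B: "category (Tgt f)" and fo: "OMap f a \<in> Obj (Tgt f)" if "a \<in> Obj (Src f)" for a
    using f that by (auto simp: Arr_CAT_iff ext_categoryD is_functorD)
  have "is_functor T"
    using T by (simp add: discrete_opfibration_def)
  note TD = is_functorD[OF this] and FD = is_functorD[OF F(1), unfolded F(2,3)]
    and GD = is_functorD[OF G(1), unfolded G(2,3)]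
  \<comment> \<open>Discreteness: two arrows of \<open>Src T\<close> with the same domain and the
    same image under \<open>T\<close> coincide. Hence agreement at the domain of \<open>m\<close>
    passes to \<open>m\<close>, and from there to its codomain.\<close>
  have arr: "AMap F m = AMap G m"
    if m: "m \<in> Arr (J_cat f)" and d: "OMap F (Dom (J_cat f) m) = OMap G (Dom (J_cat f) m)" for m
  proof -
    have e: "AMap T (AMap F m) = AMap T (AMap G m)"
      using arg_cong[OF TF, of "\<lambda>H. AMap H m"] m F G by simp
    have "\<exists>!n. n \<in> Arr (Src T) \<and> Dom (Src T) n = Dom (Src T) (AMap F m) \<and>
        AMap T n = AMap T (AMap F m)"
      using T FD(4)[OF m] TD(4,5)[of "AMap F m"] Dom_in[OF FD(2), of "AMap F m"]
      unfolding discrete_opfibration_def by simp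
    moreover have "AMap G m \<in> Arr (Src T)" "Dom (Src T) (AMap G m) = Dom (Src T) (AMap F m)"
        "AMap F m \<in> Arr (Src T)"
      using FD(4,5)[OF m] GD(4,5)[OF m] d by simp_all
    ultimately show ?thesis
      using e by metis
  qed
  have o0: "OMap F (enc (a, Ident (Tgt f) (OMap f a))) = OMap G (enc (a, Ident (Tgt f) (OMap f a)))"
    if "a \<in> Obj (Src f)" for a
    using arg_cong[OF S, of "\<lambda>H. OMap H a"] that by simp
  have ob: "OMap F (enc (a, u)) = OMap G (enc (a, u))" if "liftable f a u" for a u
  proof -
    let ?i = "Ident (Tgt f) (OMap f a)"
    have a: "a \<in> Obj (Src f)" and u: "u \<in> Arr (Tgt f)" "Dom (Tgt f) u = OMap f a"
      using that by (simp_all add: liftable_def)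
    note i = liftable_Ident[OF f a]
    have c: "composable (Tgt f) u ?i" "Comp (Tgt f) u ?i = u"
      using B[OF a] u by (simp_all add: composable_Ident2 Comp_Ident')
    have m: "enc (enc (a, ?i), u) \<in> Arr (J_cat f)"
      using i c by (simp add: Arr_JI)
    have "AMap F (enc (enc (a, ?i), u)) = AMap G (enc (enc (a, ?i), u))"
      using arr[OF m] o0[OF a] i c by (simp add: Dom_J)
    then show ?thesis
      using FD(6)[OF m] GD(6)[OF m] i c by (simp add: Cod_J)
  qed
  have "AMap F (enc (enc (a, u), v)) = AMap G (enc (enc (a, u), v))"
    if "liftable f a u" "composable (Tgt f) v u" for a u v
    using arr[OF Arr_JI[OF that]] ob that by (simp add: Dom_J)
  then show ?thesis
    by (intro J_eqI[where f=f]) (simp_all add: F G ob)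
qed

text \<open>The \<open>THE\<close> in \<open>J_map\<close> is resolved by exhibiting one filler and
  quoting \<open>J_filler_unique\<close>. Its formula is forced: \<open>(a, 1)\<close> must go to
  \<open>(h a, 1)\<close>, and the arrow \<open>u\<close> out of it to the unique arrow over
  \<open>k u\<close>, which ends at \<open>(h a, k u)\<close>.\<close>

lemma J_map_eq:
  fixes s :: "'u::infinite square"
  assumes s: "s \<in> Arr CAT2"
  shows "J_map s = J_out (Sdom s) (J_cat (Scod s))
      (\<lambda>a u. enc (OMap (sq_top s) a, AMap (sq_bot s) u))
      (\<lambda>a u v. enc (enc (OMap (sq_top s) a, AMap (sq_bot s) u), AMap (sq_bot s) v))" (is "_ = ?j")
    and J_map_in_CAT: "J_map s \<in> Arr CAT"
    and J_map_S: "J_map s \<odot> S_fun (Sdom s) = S_fun (Scod s) \<odot> discr_map (sq_top s)"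
    and T_J_map: "T_fun (Scod s) \<odot> J_map s = sq_bot s \<odot> T_fun (Sdom s)"
    and liftable_square: "liftable (Sdom s) a u \<Longrightarrow>
      liftable (Scod s) (OMap (sq_top s) a) (AMap (sq_bot s) u)"
proof -
  define f g h k where "f = Sdom s" "g = Scod s" "h = sq_top s" "k = sq_bot s"
  note [simp] = this[symmetric]
  have fg: "f \<in> Arr CAT" "g \<in> Arr CAT" "h \<in> Arr CAT" "k \<in> Arr CAT"
    and st: "Src h = Src f" "Tgt h = Src g" "Src k = Tgt f" "Tgt k = Tgt g"
    and sq: "k \<odot> f = g \<odot> h"
    using s by (simp_all add: Arr_arrow_category in_hom_def)
  have F: "is_functor f" "is_functor g" "is_functor h" "is_functor k"
    using fg by (simp_all add: Arr_CAT_iff)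
  note fD = is_functorD[OF F(1)] and gD = is_functorD[OF F(2)]
    and hD = is_functorD[OF F(3), unfolded st] and kD = is_functorD[OF F(4), unfolded st]
  have sqo: "OMap k (OMap f a) = OMap g (OMap h a)" if "a \<in> Obj (Src f)" for a
    using arg_cong[OF sq, of "\<lambda>H. OMap H a"] that st by simp
  have li: "liftable g (OMap h a) (AMap k u)" if "liftable f a u" for a u
    using that hD(3) kD(4,5) sqo by (simp add: liftable_def)
  then show "liftable (Sdom s) a u \<Longrightarrow> liftable (Scod s) (OMap (sq_top s) a) (AMap (sq_bot s) u)"
    by simp
  have uC: "u \<in> Arr (Tgt f)" if "liftable f a u" for a u
    using that by (simp add: liftable_def)
  have j: "?j \<in> Arr CAT"
  proof (rule J_out_in_CAT)
    fix a u v assume "liftable (Sdom s) a u" "composable (Tgt (Sdom s)) v u"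
    then show "in_hom (J_cat (Scod s)) (enc (enc (OMap (sq_top s) a, AMap (sq_bot s) u), AMap (sq_bot s) v))
       (enc (OMap (sq_top s) a, AMap (sq_bot s) u))
       (enc (OMap (sq_top s) a, AMap (sq_bot s) (Comp (Tgt (Sdom s)) v u)))"
      using kD(8,9)[of v u] li by (simp add: in_hom_def Arr_JI Dom_J Cod_J)
  next
    fix a u assume "liftable (Sdom s) a u"
    then show "enc (enc (OMap (sq_top s) a, AMap (sq_bot s) u),
           AMap (sq_bot s) (Ident (Tgt (Sdom s)) (Cod (Tgt (Sdom s)) u))) =
       Ident (J_cat (Scod s)) (enc (OMap (sq_top s) a, AMap (sq_bot s) u))"
      using kD(6,7) li uC kD(1) by (simp add: Ident_J Cod_in)
  next
    fix a u v w assume a: "liftable (Sdom s) a u" "composable (Tgt (Sdom s)) v u"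
      "composable (Tgt (Sdom s)) w v"
    have "liftable f a (Comp (Tgt f) v u)" "composable (Tgt f) w (Comp (Tgt f) v u)"
      using liftable_Comp[OF fg(1)] composable_Comp'[OF fD(2)] a by simp_all
    then show "enc (enc (OMap (sq_top s) a, AMap (sq_bot s) u),
             AMap (sq_bot s) (Comp (Tgt (Sdom s)) w v)) =
         Comp (J_cat (Scod s))
           (enc (enc (OMap (sq_top s) a, AMap (sq_bot s) (Comp (Tgt (Sdom s)) v u)), AMap (sq_bot s) w))
           (enc (enc (OMap (sq_top s) a, AMap (sq_bot s) u), AMap (sq_bot s) v))"
      using a kD(8,9)[of v u] kD(8,9)[of w v] kD(8,9)[of w "Comp (Tgt f) v u"]
        li[of a u] li[of a "Comp (Tgt f) v u"]
      by (simp add: Comp_J)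
  qed (use fg li in \<open>simp_all add: Obj_JI ext_category_J\<close>)
  have jF: "is_functor ?j"
    using j by (simp add: Arr_CAT_iff)
  have TS: "is_functor (T_fun f)" "is_functor (T_fun g)" "is_functor (S_fun f)" "is_functor (S_fun g)"
    using fg(1,2) by (simp_all add: is_functor_S is_functor_T)
  have jS: "?j \<odot> S_fun f = S_fun g \<odot> discr_map h"
  proof (rule funct_discr_eqI)
    show "is_functor (?j \<odot> S_fun f)" "is_functor (S_fun g \<odot> discr_map h)"
      using jF TS fg st by (auto intro!: is_functor_fcomp is_functor_discr_map)
    fix x assume x: "x \<in> Obj (Src f)"
    have "AMap k (Ident (Tgt f) (OMap f x)) = Ident (Tgt g) (OMap g (OMap h x))"
      using x fD(3) kD(7) sqo by simp
    then show "OMap (?j \<odot> S_fun f) x = OMap (S_fun g \<odot> discr_map h) x"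
      using x st liftable_Ident[OF fg(1) x] hD(3) by simp
  qed (use st in simp_all)
  have jT: "T_fun g \<odot> ?j = k \<odot> T_fun f"
  proof (rule J_eqI[where f = f])
    show "is_functor (T_fun g \<odot> ?j)" "is_functor (k \<odot> T_fun f)"
      using jF TS F st by (auto intro!: is_functor_fcomp)
    fix a u assume u: "liftable f a u"
    then show "OMap (T_fun g \<odot> ?j) (enc (a, u)) = OMap (k \<odot> T_fun f) (enc (a, u))"
      using li uC kD(6) by (simp add: Obj_JI)
    fix v assume "composable (Tgt f) v u"
    then show "AMap (T_fun g \<odot> ?j) (enc (enc (a, u), v)) = AMap (k \<odot> T_fun f) (enc (enc (a, u), v))"
      using li u kD(9) by (simp add: Arr_JI)
  qed (use st in simp_all)
  show e: "J_map s = ?j"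
    unfolding J_map_def
  proof (rule the_equality)
    show "in_hom CAT ?j (J_cat (Sdom s)) (J_cat (Scod s)) \<and>
      ?j \<odot> S_fun (Sdom s) = S_fun (Scod s) \<odot> discr_map (sq_top s) \<and>
      T_fun (Scod s) \<odot> ?j = sq_bot s \<odot> T_fun (Sdom s)"
      using Arr_CAT_in_hom[OF j] jS jT by simp
    fix j' assume "in_hom CAT j' (J_cat (Sdom s)) (J_cat (Scod s)) \<and>
      j' \<odot> S_fun (Sdom s) = S_fun (Scod s) \<odot> discr_map (sq_top s) \<and>
      T_fun (Scod s) \<odot> j' = sq_bot s \<odot> T_fun (Sdom s)"
    then show "j' = ?j"
      using J_filler_unique[OF fg(1) T_discrete_opfibration[OF fg(2)], of j' ?j] jF jS jT
      by (simp add: in_hom_CAT_iff)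
  qed
  show "J_map s \<in> Arr CAT" "J_map s \<odot> S_fun (Sdom s) = S_fun (Scod s) \<odot> discr_map (sq_top s)"
    "T_fun (Scod s) \<odot> J_map s = sq_bot s \<odot> T_fun (Sdom s)"
    unfolding e using j jS jT by simp_all
qed

section \<open>Objects of \<open>J (T f)\<close> as composable pairs, and \<nu> as their
  composition\<close>

lemma liftable_T:
  fixes f :: "'u::infinite small_funct"
  shows "liftable (T_fun f) x v \<longleftrightarrow>
     (\<exists>a u. x = enc (a, u) \<and> liftable f a u \<and> composable (Tgt f) v u)"
  by (auto simp: liftable_def[of "T_fun f"] Obj_J composable_def) (auto simp: liftable_def)

text \<open>Lifting \<open>v\<close> at the object \<open>(a, u)\<close> along the discrete
  opfibration \<open>T_fun f\<close> ends at \<open>(a, v \<circ> u)\<close>, and this forces the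
  formula for \<nu>. Associativity in \<open>Tgt f\<close> makes it a functor. As with
  \<open>J_map\<close>, the \<open>THE\<close> is resolved by
  \<open>J_filler_unique\<close>.\<close>

lemma
  fixes f :: "'u::infinite small_funct"
  assumes f: "f \<in> Arr CAT"
  shows nu_in_CAT: "nu_fun f \<in> Arr CAT"
    and nu_simps [simp]: "Src (nu_fun f) = J_cat (T_fun f)" "Tgt (nu_fun f) = J_cat f"
    and nu_S: "nu_fun f \<odot> S_fun (T_fun f) = iota (J_cat f)"
    and nu_Obj: "liftable f a u \<Longrightarrow> composable (Tgt f) v u \<Longrightarrow>
      OMap (nu_fun f) (enc (enc (a, u), v)) = enc (a, Comp (Tgt f) v u)"
    and nu_Arr: "liftable f a u \<Longrightarrow> composable (Tgt f) v u \<Longrightarrow> composable (Tgt f) w v \<Longrightarrow>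
      AMap (nu_fun f) (enc (enc (enc (a, u), v), w)) = enc (enc (a, Comp (Tgt f) v u), w)"
proof -
  define n where "n = J_out (T_fun f) (J_cat f)
      (\<lambda>x v. case dec x of (a, u) \<Rightarrow> enc (a, Comp (Tgt f) v u))
      (\<lambda>x v w. case dec x of (a, u) \<Rightarrow> enc (enc (a, Comp (Tgt f) v u), w))"
  have B: "category (Tgt f)" and eJ: "ext_category (J_cat f)"
    using f by (simp_all add: Arr_CAT_iff ext_categoryD ext_category_J)
  have Tf: "T_fun f \<in> Arr CAT"
    using f by (rule T_in_CAT)
  note li = liftable_Comp[OF f] and cc = composable_Comp'[OF B]
  have nC: "n \<in> Arr CAT"
    unfolding n_def
  proof (rule J_out_in_CAT)
    fix x v w assume "liftable (T_fun f) x v" "composable (Tgt (T_fun f)) w v"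
    then show "in_hom (J_cat f) (case dec x of (a, u) \<Rightarrow> enc (enc (a, Comp (Tgt f) v u), w))
        (case dec x of (a, u) \<Rightarrow> enc (a, Comp (Tgt f) v u))
        (case dec x of (a, u) \<Rightarrow> enc (a, Comp (Tgt f) (Comp (Tgt (T_fun f)) w v) u))"
      by (auto simp: liftable_T in_hom_def Arr_JI Dom_J Cod_J li cc Comp_assoc[OF B])
  next
    fix x v assume "liftable (T_fun f) x v"
    then show "(case dec x of (a, u) \<Rightarrow> enc (enc (a, Comp (Tgt f) v u),
            Ident (Tgt (T_fun f)) (Cod (Tgt (T_fun f)) v))) =
        Ident (J_cat f) (case dec x of (a, u) \<Rightarrow> enc (a, Comp (Tgt f) v u))"
      by (auto simp: liftable_T Ident_J li Cod_Comp[OF B])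
  next
    fix x v w z
    assume "liftable (T_fun f) x v" and wv: "composable (Tgt (T_fun f)) w v"
      and zw: "composable (Tgt (T_fun f)) z w"
    then obtain a u where x: "x = enc (a, u)" and a: "liftable f a u" "composable (Tgt f) v u"
      by (auto simp: liftable_T)
    have "composable (Tgt f) z (Comp (Tgt f) w (Comp (Tgt f) v u))"
        "liftable f a (Comp (Tgt f) w (Comp (Tgt f) v u))"
      using a wv zw li cc by simp_all
    then show "(case dec x of (a, u) \<Rightarrow> enc (enc (a, Comp (Tgt f) v u), Comp (Tgt (T_fun f)) z w)) =
        Comp (J_cat f)
          (case dec x of (a, u) \<Rightarrow> enc (enc (a, Comp (Tgt f) (Comp (Tgt (T_fun f)) w v) u), z))
          (case dec x of (a, u) \<Rightarrow> enc (enc (a, Comp (Tgt f) v u), w))"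
      using a wv zw x Comp_assoc[OF B, of w v u] Comp_J[of f a "Comp (Tgt f) v u" w z] li cc
      by simp
  qed (use Tf eJ li in \<open>auto simp: liftable_T Obj_JI\<close>)
  have n: "is_functor n" "Src n = J_cat (T_fun f)" "Tgt n = J_cat f"
    using nC by (simp_all add: Arr_CAT_iff n_def)
  have no: "OMap n (enc (enc (a, u), v)) = enc (a, Comp (Tgt f) v u)"
    if "liftable f a u" "composable (Tgt f) v u" for a u v
    using J_out_simps(3)[of "T_fun f" "enc (a, u)" v] that by (simp add: n_def liftable_T)
  have na: "AMap n (enc (enc (enc (a, u), v), w)) = enc (enc (a, Comp (Tgt f) v u), w)"
    if "liftable f a u" "composable (Tgt f) v u" "composable (Tgt f) w v" for a u v w
    using J_out_simps(4)[of "T_fun f" "enc (a, u)" v w] that by (simp add: n_def liftable_T)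
  have nS: "n \<odot> S_fun (T_fun f) = iota (J_cat f)"
  proof (rule funct_discr_eqI)
    show "is_functor (n \<odot> S_fun (T_fun f))" "is_functor (iota (J_cat f))"
      using n is_functor_S[OF Tf] iota_in_CAT[OF eJ]
      by (auto intro!: is_functor_fcomp simp: Arr_CAT_iff)
    fix x assume x: "x \<in> Obj (J_cat f)"
    then obtain a u where a: "x = enc (a, u)" "liftable f a u"
      by (auto simp: Obj_J)
    then have "u \<in> Arr (Tgt f)"
      by (simp add: liftable_def)
    then show "OMap (n \<odot> S_fun (T_fun f)) x = OMap (iota (J_cat f)) x"
      using a x no by (simp add: composable_Ident[OF B] Ident_Comp'[OF B])
  qed (use n in simp_all)
  have nT: "T_fun f \<odot> n = T_fun (T_fun f)"
  proof (rule J_eqI[where f = "T_fun f"])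
    show "is_functor (T_fun f \<odot> n)" "is_functor (T_fun (T_fun f))"
      using n is_functor_T[OF Tf] is_functor_T[OF f] by (auto intro!: is_functor_fcomp)
    fix x v assume xv: "liftable (T_fun f) x v"
    then obtain a u where a: "x = enc (a, u)" "liftable f a u" "composable (Tgt f) v u"
      by (auto simp: liftable_T)
    then show "OMap (T_fun f \<odot> n) (enc (x, v)) = OMap (T_fun (T_fun f)) (enc (x, v))"
      using xv no by (simp add: Obj_JI n li Cod_Comp[OF B])
    fix w assume "composable (Tgt (T_fun f)) w v"
    then show "AMap (T_fun f \<odot> n) (enc (enc (x, v), w)) = AMap (T_fun (T_fun f)) (enc (enc (x, v), w))"
      using a xv na by (simp add: Arr_JI n li cc)
  qed (use n in simp_all)
  have e: "nu_fun f = n"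
    unfolding nu_fun_def
  proof (rule the_equality)
    show "in_hom CAT n (J_cat (T_fun f)) (J_cat f) \<and>
        n \<odot> S_fun (T_fun f) = iota (J_cat f) \<and> T_fun f \<odot> n = T_fun (T_fun f)"
      using nC n nS nT by (simp add: in_hom_def)
    fix n' assume "in_hom CAT n' (J_cat (T_fun f)) (J_cat f) \<and>
        n' \<odot> S_fun (T_fun f) = iota (J_cat f) \<and> T_fun f \<odot> n' = T_fun (T_fun f)"
    then show "n' = n"
      using J_filler_unique[OF Tf T_discrete_opfibration[OF f], of n' n] n nS nT
      by (simp add: in_hom_CAT_iff)
  qed
  show "nu_fun f \<in> Arr CAT" "Src (nu_fun f) = J_cat (T_fun f)" "Tgt (nu_fun f) = J_cat f"
    "nu_fun f \<odot> S_fun (T_fun f) = iota (J_cat f)"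
    unfolding e using nC n nS by simp_all
  show "liftable f a u \<Longrightarrow> composable (Tgt f) v u \<Longrightarrow>
      OMap (nu_fun f) (enc (enc (a, u), v)) = enc (a, Comp (Tgt f) v u)"
    "liftable f a u \<Longrightarrow> composable (Tgt f) v u \<Longrightarrow> composable (Tgt f) w v \<Longrightarrow>
      AMap (nu_fun f) (enc (enc (enc (a, u), v), w)) = enc (enc (a, Comp (Tgt f) v u), w)"
    unfolding e using no na by simp_all
qed

lemma fcomp_in_CAT:
  "F \<in> Arr CAT \<Longrightarrow> G \<in> Arr CAT \<Longrightarrow> Src G = Tgt F \<Longrightarrow> G \<odot> F \<in> Arr CAT"
  by (simp add: Arr_CAT_iff is_functor_fcomp)

lemma idf_in_CAT: "ext_category C \<Longrightarrow> idf C \<in> Arr CAT"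
  by (simp add: Arr_CAT_iff is_functor_idf ext_categoryD)

lemma fcomp_assoc_CAT:
  assumes "F \<in> Arr CAT" "G \<in> Arr CAT" "H \<in> Arr CAT" "Src G = Tgt F" "Src H = Tgt G"
  shows "(H \<odot> G) \<odot> F = H \<odot> G \<odot> F"
  using assms by (simp add: Arr_CAT_iff fcomp_assoc)

lemma fcomp_idf_CAT: "F \<in> Arr CAT \<Longrightarrow> Src F = C \<Longrightarrow> F \<odot> idf C = F"
  and idf_fcomp_CAT: "F \<in> Arr CAT \<Longrightarrow> Tgt F = C \<Longrightarrow> idf C \<odot> F = F"
  by (simp_all add: Arr_CAT_iff fcomp_idf idf_fcomp)

lemma Arr_CAT2_iff:
  "s \<in> Arr CAT2 \<longleftrightarrow> Sdom s \<in> Arr CAT \<and> Scod s \<in> Arr CAT \<and> sq_top s \<in> Arr CAT \<and> sq_bot s \<in> Arr CAT \<and>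
     Src (sq_top s) = Src (Sdom s) \<and> Tgt (sq_top s) = Src (Scod s) \<and>
     Src (sq_bot s) = Tgt (Sdom s) \<and> Tgt (sq_bot s) = Tgt (Scod s) \<and>
     sq_bot s \<odot> Sdom s = Scod s \<odot> sq_top s"
  by (auto simp: Arr_arrow_category in_hom_def)

section \<open>Functoriality of \<open>J\<close>\<close>

lemma J_map_simps:
  fixes s :: "'u::infinite square"
  assumes "s \<in> Arr CAT2"
  shows "Src (J_map s) = J_cat (Sdom s)" "Tgt (J_map s) = J_cat (Scod s)"
    "liftable (Sdom s) a u \<Longrightarrow> OMap (J_map s) (enc (a, u)) = enc (OMap (sq_top s) a, AMap (sq_bot s) u)"
    "liftable (Sdom s) a u \<Longrightarrow> composable (Tgt (Sdom s)) v u \<Longrightarrow>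
       AMap (J_map s) (enc (enc (a, u), v)) =
         enc (enc (OMap (sq_top s) a, AMap (sq_bot s) u), AMap (sq_bot s) v)"
  by (simp_all add: J_map_eq[OF assms])

text \<open>The rule \<open>S_simps(3)\<close> is switched off, here and in later proofs about
  \<open>E\<close>, so that the value of \<open>S_fun\<close> at an object is not unfolded into its
  code and compatibility equations can still be matched.\<close>

lemma J_map_S_Obj:
  fixes s :: "'u::infinite square"
  assumes "s \<in> Arr CAT2" "a \<in> Obj (Src (Sdom s))"
  shows "OMap (J_map s) (OMap (S_fun (Sdom s)) a) = OMap (S_fun (Scod s)) (OMap (sq_top s) a)"
  using arg_cong[OF J_map_S[OF assms(1)], of "\<lambda>H. OMap H a"] assms
  by (simp add: Arr_CAT2_iff del: S_simps(3))

lemma J_map_idf: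
  fixes f :: "'u::infinite small_funct"
  assumes f: "f \<in> Arr CAT"
  shows "J_map \<lparr>Sdom = f, Scod = f, Smap = (idf (Src f), idf (Tgt f))\<rparr> = idf (J_cat f)"
proof -
  let ?s = "\<lparr>Sdom = f, Scod = f, Smap = (idf (Src f), idf (Tgt f))\<rparr>"
  have s: "?s \<in> Arr CAT2"
    using f by (simp add: Arr_CAT2_iff idf_in_CAT fcomp_idf_CAT idf_fcomp_CAT)
      (simp add: Arr_CAT_iff is_functor_idf ext_categoryD)
  show ?thesis
    by (rule J_eqI[where f = f])
      (use f J_map_in_CAT[OF s] J_map_simps[OF s] in
        \<open>auto simp: Arr_CAT_iff is_functor_idf ext_categoryD ext_category_J[OF f] Obj_JI Arr_JI
          liftable_def[of f] composable_def\<close>)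
qed

lemma Comp_CAT2:
  assumes "s \<in> Arr CAT2" "t \<in> Arr CAT2" "Scod s = Sdom t"
  shows "\<lparr>Sdom = Sdom s, Scod = Scod t, Smap = (sq_top t \<odot> sq_top s, sq_bot t \<odot> sq_bot s)\<rparr>
     \<in> Arr CAT2"
  using Comp_in[OF category_arrow_category[OF category_CAT], of t s] assms
  by (simp add: composable_def)

text \<open>Besides giving functoriality of \<open>E\<close>, this later splits
  \<open>J \<langle>q, 1\<rangle>\<close> for \<open>q = p \<odot> \<alpha>\<close> as
  \<open>J \<langle>p, 1\<rangle>\<close> after the invertible
  \<open>J \<langle>\<alpha>, 1\<rangle>\<close>.\<close>

lemma J_map_comp:
  fixes s t :: "'u::infinite square"
  assumes s: "s \<in> Arr CAT2" and t: "t \<in> Arr CAT2" and st: "Scod s = Sdom t"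
  shows "J_map \<lparr>Sdom = Sdom s, Scod = Scod t,
      Smap = (sq_top t \<odot> sq_top s, sq_bot t \<odot> sq_bot s)\<rparr> = J_map t \<odot> J_map s"
proof -
  note ts = Comp_CAT2[OF s t st]
  have c: "composable (Tgt (Sdom t)) (AMap (sq_bot s) v) (AMap (sq_bot s) u)"
    if "composable (Tgt (Sdom s)) v u" for v u
    using s st that is_functorD(9)[of "sq_bot s"] by (simp add: Arr_CAT2_iff Arr_CAT_iff)
  show ?thesis
  proof (rule J_eqI[where f = "Sdom s"])
    show "is_functor (J_map t \<odot> J_map s)"
      using J_map_in_CAT[OF s] J_map_in_CAT[OF t] st
      by (auto intro!: is_functor_fcomp simp: Arr_CAT_iff J_map_simps[OF s] J_map_simps[OF t])
    fix a u assume a: "liftable (Sdom s) a u"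
    then have i: "a \<in> Obj (Src (sq_top s))" "u \<in> Arr (Src (sq_bot s))"
      using s by (auto simp: liftable_def Arr_CAT2_iff)
    note l = liftable_square[OF s a, unfolded st]
    show "OMap (J_map \<lparr>Sdom = Sdom s, Scod = Scod t,
        Smap = (sq_top t \<odot> sq_top s, sq_bot t \<odot> sq_bot s)\<rparr>) (enc (a, u)) =
        OMap (J_map t \<odot> J_map s) (enc (a, u))"
      using a l i st
      by (simp add: J_map_simps(3)[OF ts] J_map_simps[OF s] J_map_simps[OF t] Obj_JI)
    fix v assume v: "composable (Tgt (Sdom s)) v u"
    then have "v \<in> Arr (Src (sq_bot s))"
      using s by (simp add: composable_def Arr_CAT2_iff)
    then show "AMap (J_map \<lparr>Sdom = Sdom s, Scod = Scod t,
        Smap = (sq_top t \<odot> sq_top s, sq_bot t \<odot> sq_bot s)\<rparr>) (enc (enc (a, u), v)) =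
        AMap (J_map t \<odot> J_map s) (enc (enc (a, u), v))"
      using a l i v c[OF v] st
      by (simp add: J_map_simps(4)[OF ts] J_map_simps[OF s] J_map_simps[OF t] Arr_JI)
  qed (use J_map_in_CAT[OF ts] st in
      \<open>simp_all add: Arr_CAT_iff J_map_simps[OF s] J_map_simps[OF t] J_map_simps(1,2)[OF ts]\<close>)
qed

section \<open>Chaotic categories\<close>

text \<open>An arrow is just the code of its pair of endpoints, so there is exactly one between any
  two objects. The construction is right adjoint to taking the set of objects, and therefore lets
  the universal property of a pushout of categories be probed on objects alone.\<close>

definition chaotic :: "'u set \<Rightarrow> 'u small_cat" where
  "chaotic X = \<lparr>Obj = X, Arr = enc ` (X \<times> X),
     Dom = restrict (\<lambda>m. fst (dec m)) (enc ` (X \<times> X)),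
     Cod = restrict (\<lambda>m. snd (dec m)) (enc ` (X \<times> X)),
     Ident = (\<lambda>x\<in>X. enc (x, x)),
     Comp = (\<lambda>n m. if n \<in> enc ` (X \<times> X) \<and> m \<in> enc ` (X \<times> X) \<and> fst (dec n) = snd (dec m)
        then enc (fst (dec m), snd (dec n)) else undefined)\<rparr>"

lemma ext_category_chaotic: "ext_category (chaotic X :: 'u::infinite small_cat)"
proof -
  have "category (chaotic X)"
    by (rule categoryI) (auto simp: chaotic_def composable_def in_hom_def)
  then show ?thesis
    by (auto simp: ext_category_def) (auto simp: chaotic_def composable_def)
qed

definition to_chaotic :: "'u small_cat \<Rightarrow> 'u set \<Rightarrow> ('u \<Rightarrow> 'u) \<Rightarrow> 'u small_funct" where
  "to_chaotic A X h = \<lparr>Src = A, Tgt = chaotic X, OMap = restrict h (Obj A),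
     AMap = (\<lambda>m\<in>Arr A. enc (h (Dom A m), h (Cod A m)))\<rparr>"

lemma to_chaotic_simps [simp]: "Src (to_chaotic A X h) = A" "Tgt (to_chaotic A X h) = chaotic X"
  "x \<in> Obj A \<Longrightarrow> OMap (to_chaotic A X h) x = h x"
  by (simp_all add: to_chaotic_def)

lemma to_chaotic_in_CAT:
  fixes A :: "'u::infinite small_cat"
  assumes A: "ext_category A" and h: "h ` Obj A \<subseteq> X"
  shows "to_chaotic A X h \<in> Arr CAT"
proof -
  have A': "category A"
    using A by (rule ext_categoryD)
  have "h x \<in> X" if "x \<in> Obj A" for x
    using that h by auto
  moreover have "m \<in> Arr A \<and> n \<in> Arr A \<and> Dom A n = Cod A m" if "composable A n m" for m n
    using that by (auto simp: composable_def)
  ultimately have "is_functor (to_chaotic A X h)"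
    unfolding is_functor_def
    using A' ext_categoryD[OF ext_category_chaotic]
    by (auto simp: to_chaotic_def category_simps) (auto simp: chaotic_def category_simps)
  then show ?thesis
    using A ext_category_chaotic by (simp add: Arr_CAT_iff)
qed

text \<open>In a chaotic category the endpoints of an arrow determine it, and functors preserve
  endpoints.\<close>

lemma funct_chaotic_eqI:
  fixes F G :: "'u::infinite small_funct"
  assumes F: "is_functor F" and G: "is_functor G"
    and st: "Src F = Src G" "Tgt F = chaotic X" "Tgt G = chaotic X"
    and o: "\<And>x. x \<in> Obj (Src F) \<Longrightarrow> OMap F x = OMap G x"
  shows "F = G"
proof (rule funct_eqI[OF F G])
  have e: "n = enc (Dom (chaotic X) n, Cod (chaotic X) n)" if "n \<in> Arr (chaotic X)" for n
    using that by (auto simp: chaotic_def)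
  fix m assume m: "m \<in> Arr (Src F)"
  have "Dom (Src F) m \<in> Obj (Src F)" "Cod (Src F) m \<in> Obj (Src F)"
    using m is_functorD(1)[OF F] by (simp_all add: Dom_in Cod_in)
  then have "Dom (chaotic X) (AMap F m) = Dom (chaotic X) (AMap G m)"
      "Cod (chaotic X) (AMap F m) = Cod (chaotic X) (AMap G m)"
    using m is_functorD(5,6)[OF F, of m] is_functorD(5,6)[OF G, of m] o st by simp_all
  then show "AMap F m = AMap G m"
    using e[of "AMap F m"] e[of "AMap G m"] m is_functorD(4)[OF F] is_functorD(4)[OF G] st by simp
qed (use st o in simp_all)

section \<open>The monad\<close>

locale chosen_pushouts =
  fixes po :: "('u::infinite) po"
  assumes pushouts: "pushout_choice CAT po"
begin

lemma pushout_E: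
  assumes "f \<in> Arr CAT"
  shows "is_pushout CAT (iota (Src f)) (S_fun f) (L_fun po f) (alpha_fun po f)"
  using pushouts iota_in_CAT[of "Src f"] S_in_CAT[OF assms] assms
  unfolding pushout_choice_def L_fun_def alpha_fun_def by (simp add: Arr_CAT_iff)

lemma
  assumes "f \<in> Arr CAT"
  shows L_in_CAT: "L_fun po f \<in> Arr CAT" and alpha_in_CAT: "alpha_fun po f \<in> Arr CAT"
    and L_simps [simp]: "Src (L_fun po f) = Src f" "Tgt (L_fun po f) = E_cat po f"
    and alpha_simps [simp]: "Src (alpha_fun po f) = J_cat f" "Tgt (alpha_fun po f) = E_cat po f"
    and L_iota: "L_fun po f \<odot> iota (Src f) = alpha_fun po f \<odot> S_fun f"
  using pushout_E[OF assms] by (auto simp: is_pushout_def composable_def E_cat_def)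

lemma ext_category_E: "f \<in> Arr CAT \<Longrightarrow> ext_category (E_cat po f)"
  using L_in_CAT[of f] by (simp add: Arr_CAT_iff)

lemma L_Obj:
  assumes "f \<in> Arr CAT" "a \<in> Obj (Src f)"
  shows "OMap (L_fun po f) a = OMap (alpha_fun po f) (OMap (S_fun f) a)"
  using arg_cong[OF L_iota[OF assms(1)], of "\<lambda>H. OMap H a"] assms(2) by (simp del: S_simps(3))

text \<open>The cocone condition is an equation between functors out of a discrete category, so by
  \<open>funct_discr_eqI\<close> it needs checking on objects only. The functors \<open>R f\<close>,
  \<open>E \<langle>h, k\<rangle>\<close>, \<mu> and the algebra structures all arise from this form
  of the universal property.\<close>

lemma E_mediator:
  assumes f: "f \<in> Arr CAT" and p: "p \<in> Arr CAT" "Src p = Src f"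
    and q: "q \<in> Arr CAT" "Src q = J_cat f" "Tgt p = Tgt q"
    and pq: "\<And>a. a \<in> Obj (Src f) \<Longrightarrow> OMap p a = OMap q (OMap (S_fun f) a)"
  shows "\<exists>!m. in_hom CAT m (E_cat po f) (Tgt q) \<and> m \<odot> L_fun po f = p \<and> m \<odot> alpha_fun po f = q"
proof -
  have c: "iota (Src f) \<in> Arr CAT" "S_fun f \<in> Arr CAT"
    using f iota_in_CAT[of "Src f"] S_in_CAT[OF f] by (simp_all add: Arr_CAT_iff)
  have e: "p \<odot> iota (Src f) = q \<odot> S_fun f"
    by (rule funct_discr_eqI[where A = "Src f"])
      (use p q c pq in \<open>auto intro!: is_functor_fcomp simp: Arr_CAT_iff simp del: S_simps(3)\<close>)
  have "composable CAT p (iota (Src f)) \<and> composable CAT q (S_fun f) \<and> Cod CAT p = Cod CAT q \<and>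
      Comp CAT p (iota (Src f)) = Comp CAT q (S_fun f)"
    using p q c e by (simp add: composable_def)
  then have "\<exists>!m. in_hom CAT m (Cod CAT (L_fun po f)) (Cod CAT p) \<and>
      Comp CAT m (L_fun po f) = p \<and> Comp CAT m (alpha_fun po f) = q"
    using pushout_E[OF f] unfolding is_pushout_def by blast
  then show ?thesis
    using f q(3) by simp
qed

text \<open>The two legs are jointly epic: \<open>m\<close> and \<open>n\<close> both mediate the
  cocone that \<open>m\<close> induces.\<close>

lemma E_eqI:
  assumes f: "f \<in> Arr CAT" and m: "m \<in> Arr CAT" "Src m = E_cat po f"
    and n: "n \<in> Arr CAT" "Src n = E_cat po f" "Tgt m = Tgt n"
    and e: "m \<odot> L_fun po f = n \<odot> L_fun po f" "m \<odot> alpha_fun po f = n \<odot> alpha_fun po f"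
  shows "m = n"
proof -
  have "\<exists>!l. in_hom CAT l (E_cat po f) (Tgt (m \<odot> alpha_fun po f)) \<and>
      l \<odot> L_fun po f = m \<odot> L_fun po f \<and> l \<odot> alpha_fun po f = m \<odot> alpha_fun po f"
  proof (rule E_mediator[OF f])
    fix a assume a: "a \<in> Obj (Src f)"
    then have "OMap (S_fun f) a \<in> Obj (J_cat f)"
      using is_functorD(3)[OF is_functor_S[OF f], of a] by (simp del: S_simps(3))
    then show "OMap (m \<odot> L_fun po f) a = OMap (m \<odot> alpha_fun po f) (OMap (S_fun f) a)"
      using a f by (simp add: L_Obj del: S_simps(3))
  qed (use f m in \<open>simp_all add: fcomp_in_CAT L_in_CAT alpha_in_CAT\<close>)
  moreover have "in_hom CAT m (E_cat po f) (Tgt (m \<odot> alpha_fun po f))"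
      "in_hom CAT n (E_cat po f) (Tgt (m \<odot> alpha_fun po f))"
    using m n by (simp_all add: in_hom_def)
  ultimately show ?thesis
    using e by metis
qed

text \<open>Functors into a chaotic category are maps on objects, so that \<open>Obj\<close> turns the pushout
  defining \<open>E f\<close> into a pushout of sets along a bijection.\<close>

lemma alpha_bij:
  assumes f: "f \<in> Arr CAT"
  shows "bij_betw (OMap (alpha_fun po f)) (Obj (J_cat f)) (Obj (E_cat po f))"
proof -
  let ?L = "L_fun po f" and ?al = "alpha_fun po f" and ?J = "Obj (J_cat f)" and ?E = "Obj (E_cat po f)"
  have e: "ext_category (Src f)" "ext_category (J_cat f)" "ext_category (E_cat po f)"
    using f by (simp_all add: Arr_CAT_iff ext_category_J ext_category_E)
  have S: "OMap (S_fun f) a \<in> ?J" if "a \<in> Obj (Src f)" for a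
    using that is_functorD(3)[OF is_functor_S[OF f]] by (simp del: S_simps(3))
  have al: "OMap ?al y \<in> ?E" if "y \<in> ?J" for y
    using that alpha_in_CAT[OF f] is_functorD(3)[of ?al] f by (simp add: Arr_CAT_iff)
  have L: "OMap ?L a \<in> ?E" if "a \<in> Obj (Src f)" for a
    using that L_in_CAT[OF f] is_functorD(3)[of ?L] f by (simp add: Arr_CAT_iff)
  \<comment> \<open>A cocone into the chaotic category on the objects of \<open>J f\<close>, with
    the identity as its second leg. Its mediator \<open>r\<close> is then a left inverse of \<alpha>
    on objects.\<close>
  define p where "p = to_chaotic (Src f) ?J (OMap (S_fun f))"
  define q where "q = to_chaotic (J_cat f) ?J (\<lambda>y. y)"
  have "\<exists>!r. in_hom CAT r (E_cat po f) (Tgt q) \<and> r \<odot> ?L = p \<and> r \<odot> ?al = q"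
    by (rule E_mediator[OF f])
      (use S e in \<open>auto simp: p_def q_def simp del: S_simps(3) intro!: to_chaotic_in_CAT\<close>)
  then obtain r where r: "r \<in> Arr CAT" "Src r = E_cat po f" "Tgt r = chaotic ?J"
      "r \<odot> ?L = p" "r \<odot> ?al = q"
    by (auto simp: in_hom_def q_def)
  have r_al: "OMap r (OMap ?al y) = y" if "y \<in> ?J" for y
    using arg_cong[OF r(5), of "\<lambda>H. OMap H y"] that f by (simp add: q_def)
  have rE: "OMap r x \<in> ?J" if "x \<in> ?E" for x
    using is_functorD(3)[of r x] r that by (simp add: Arr_CAT_iff chaotic_def)
  \<comment> \<open>On objects, \<open>m\<close> is \<alpha> after \<open>r\<close> and
    \<open>n\<close> is the identity. They agree after both legs, after \<open>L f\<close> because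
    \<open>L a = \<alpha> (S a)\<close>; so \<open>m = n\<close>, and \<open>r\<close> is a right
    inverse as well.\<close>
  define m where "m = to_chaotic (E_cat po f) ?E (\<lambda>x. OMap ?al (OMap r x))"
  define n where "n = to_chaotic (E_cat po f) ?E (\<lambda>x. x)"
  have mn: "m \<in> Arr CAT" "n \<in> Arr CAT"
    unfolding m_def n_def using e rE al by (auto intro!: to_chaotic_in_CAT)
  have F: "is_functor (m \<odot> ?L)" "is_functor (n \<odot> ?L)" "is_functor (m \<odot> ?al)" "is_functor (n \<odot> ?al)"
    using mn L_in_CAT[OF f] alpha_in_CAT[OF f] f
    by (auto simp: Arr_CAT_iff m_def n_def intro!: is_functor_fcomp)
  have "m = n"
  proof (rule E_eqI[OF f])
    show "m \<odot> ?L = n \<odot> ?L"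
      by (rule funct_chaotic_eqI[where X = ?E])
        (use F L S L_Obj[OF f] r_al f in \<open>simp_all add: m_def n_def del: S_simps(3)\<close>)
    show "m \<odot> ?al = n \<odot> ?al"
      by (rule funct_chaotic_eqI[where X = ?E])
        (use F al r_al f in \<open>simp_all add: m_def n_def\<close>)
  qed (use mn in \<open>simp_all add: m_def n_def\<close>)
  from arg_cong[OF this, of OMap] have al_r: "OMap ?al (OMap r x) = x" if "x \<in> ?E" for x
    using that by (auto dest!: fun_cong[of _ _ x] simp: m_def n_def to_chaotic_def)
  show ?thesis
    by (rule bij_betw_byWitness[where f' = "OMap r"]) (use al_r r_al al rE in auto)
qed

lemma
  assumes f: "f \<in> Arr CAT"
  shows R_in_CAT: "R_fun po f \<in> Arr CAT"
    and R_simps [simp]: "Src (R_fun po f) = E_cat po f" "Tgt (R_fun po f) = Tgt f"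
    and R_L: "R_fun po f \<odot> L_fun po f = f" and R_alpha: "R_fun po f \<odot> alpha_fun po f = T_fun f"
proof -
  have "\<exists>!r. in_hom CAT r (E_cat po f) (Tgt (T_fun f)) \<and> r \<odot> L_fun po f = f \<and>
      r \<odot> alpha_fun po f = T_fun f"
  proof (rule E_mediator[OF f])
    fix a assume a: "a \<in> Obj (Src f)"
    then have "OMap (S_fun f) a \<in> Obj (J_cat f)"
      using is_functorD(3)[OF is_functor_S[OF f], of a] by (simp del: S_simps(3))
    then show "OMap f a = OMap (T_fun f) (OMap (S_fun f) a)"
      using arg_cong[OF T_S[OF f], of "\<lambda>H. OMap H a"] a by (simp del: S_simps(3))
  qed (use f in \<open>simp_all add: T_in_CAT\<close>)
  from theI'[OF this] show "R_fun po f \<in> Arr CAT" "Src (R_fun po f) = E_cat po f"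
      "Tgt (R_fun po f) = Tgt f" "R_fun po f \<odot> L_fun po f = f"
      "R_fun po f \<odot> alpha_fun po f = T_fun f"
    by (simp_all add: R_fun_def in_hom_def)
qed

lemma
  assumes s: "s \<in> Arr CAT2"
  shows E_map_in_CAT: "E_map po s \<in> Arr CAT"
    and E_map_simps: "Src (E_map po s) = E_cat po (Sdom s)" "Tgt (E_map po s) = E_cat po (Scod s)"
    and E_map_L: "E_map po s \<odot> L_fun po (Sdom s) = L_fun po (Scod s) \<odot> sq_top s"
    and E_map_alpha: "E_map po s \<odot> alpha_fun po (Sdom s) = alpha_fun po (Scod s) \<odot> J_map s"
proof -
  let ?f = "Sdom s" and ?g = "Scod s"
  have fg: "?f \<in> Arr CAT" "?g \<in> Arr CAT" "sq_top s \<in> Arr CAT" "Src (sq_top s) = Src ?f"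
      "Tgt (sq_top s) = Src ?g"
    using s by (simp_all add: Arr_CAT2_iff)
  have "\<exists>!e. in_hom CAT e (E_cat po ?f) (Tgt (alpha_fun po ?g \<odot> J_map s)) \<and>
      e \<odot> L_fun po ?f = L_fun po ?g \<odot> sq_top s \<and>
      e \<odot> alpha_fun po ?f = alpha_fun po ?g \<odot> J_map s"
  proof (rule E_mediator[OF fg(1)])
    fix a assume a: "a \<in> Obj (Src ?f)"
    then have "OMap (S_fun ?f) a \<in> Obj (J_cat ?f)" "OMap (sq_top s) a \<in> Obj (Src ?g)"
      using is_functorD(3)[OF is_functor_S[OF fg(1)], of a] is_functorD(3)[of "sq_top s" a] fg
      by (simp_all add: Arr_CAT_iff del: S_simps(3))
    then show "OMap (L_fun po ?g \<odot> sq_top s) a =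
        OMap (alpha_fun po ?g \<odot> J_map s) (OMap (S_fun ?f) a)"
      using a fg J_map_S_Obj[OF s a] L_Obj[OF fg(2)]
      by (simp add: J_map_simps[OF s] del: S_simps(3))
  qed (use fg J_map_in_CAT[OF s] in
      \<open>simp_all add: L_in_CAT alpha_in_CAT fcomp_in_CAT J_map_simps[OF s]\<close>)
  from theI'[OF this] show "E_map po s \<in> Arr CAT" "Src (E_map po s) = E_cat po ?f"
      "Tgt (E_map po s) = E_cat po ?g" "E_map po s \<odot> L_fun po ?f = L_fun po ?g \<odot> sq_top s"
      "E_map po s \<odot> alpha_fun po ?f = alpha_fun po ?g \<odot> J_map s"
    using fg by (simp_all add: E_map_def in_hom_def)
qed

text \<open>On the leg \<open>L\<close> the claim is the square \<open>s\<close> itself, on the leg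
  \<alpha> it is \<open>T_J_map\<close>.\<close>

lemma R_E_map:
  assumes s: "s \<in> Arr CAT2"
  shows "sq_bot s \<odot> R_fun po (Sdom s) = R_fun po (Scod s) \<odot> E_map po s"
proof -
  let ?f = "Sdom s" and ?g = "Scod s"
  have fg: "?f \<in> Arr CAT" "?g \<in> Arr CAT" "sq_top s \<in> Arr CAT" "Src (sq_top s) = Src ?f"
      "Tgt (sq_top s) = Src ?g" "sq_bot s \<in> Arr CAT" "Src (sq_bot s) = Tgt ?f"
      "Tgt (sq_bot s) = Tgt ?g" "sq_bot s \<odot> ?f = ?g \<odot> sq_top s"
    using s by (simp_all add: Arr_CAT2_iff)
  note C = R_in_CAT L_in_CAT alpha_in_CAT E_map_in_CAT[OF s] J_map_in_CAT[OF s]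
    E_map_simps[OF s] J_map_simps[OF s] fcomp_in_CAT fg(1-8)
  show ?thesis
  proof (rule E_eqI[OF fg(1)])
    have "(R_fun po ?g \<odot> E_map po s) \<odot> L_fun po ?f = R_fun po ?g \<odot> L_fun po ?g \<odot> sq_top s"
      by (simp add: C fcomp_assoc_CAT E_map_L[OF s])
    also have "\<dots> = ?g \<odot> sq_top s"
      using fcomp_assoc_CAT[of "sq_top s" "L_fun po ?g" "R_fun po ?g"] by (simp add: C R_L)
    finally show "(sq_bot s \<odot> R_fun po ?f) \<odot> L_fun po ?f = (R_fun po ?g \<odot> E_map po s) \<odot> L_fun po ?f"
      by (simp add: C fcomp_assoc_CAT R_L fg(9))
    have "(R_fun po ?g \<odot> E_map po s) \<odot> alpha_fun po ?f = R_fun po ?g \<odot> alpha_fun po ?g \<odot> J_map s"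
      by (simp add: C fcomp_assoc_CAT E_map_alpha[OF s])
    also have "\<dots> = T_fun ?g \<odot> J_map s"
      using fcomp_assoc_CAT[of "J_map s" "alpha_fun po ?g" "R_fun po ?g"] by (simp add: C R_alpha)
    finally show "(sq_bot s \<odot> R_fun po ?f) \<odot> alpha_fun po ?f =
        (R_fun po ?g \<odot> E_map po s) \<odot> alpha_fun po ?f"
      by (simp add: C fcomp_assoc_CAT R_alpha T_J_map[OF s])
  qed (simp_all add: C)
qed

lemma E_map_idf:
  assumes f: "f \<in> Arr CAT"
  shows "E_map po \<lparr>Sdom = f, Scod = f, Smap = (idf (Src f), idf (Tgt f))\<rparr> = idf (E_cat po f)"
proof -
  let ?s = "\<lparr>Sdom = f, Scod = f, Smap = (idf (Src f), idf (Tgt f))\<rparr>"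
  have s: "?s \<in> Arr CAT2"
    using Ident_in[OF category_arrow_category[OF category_CAT], of f] f by (simp add: CAT_Obj_Ident)
  show ?thesis
    by (rule E_eqI[OF f])
      (use E_map_in_CAT[OF s] E_map_simps[OF s] E_map_L[OF s] E_map_alpha[OF s] in
        \<open>simp_all add: f idf_in_CAT ext_category_E L_in_CAT alpha_in_CAT J_map_idf
          fcomp_idf_CAT idf_fcomp_CAT\<close>)
qed

lemma E_map_comp:
  assumes s: "s \<in> Arr CAT2" and t: "t \<in> Arr CAT2" and st: "Scod s = Sdom t"
  shows "E_map po \<lparr>Sdom = Sdom s, Scod = Scod t,
      Smap = (sq_top t \<odot> sq_top s, sq_bot t \<odot> sq_bot s)\<rparr> = E_map po t \<odot> E_map po s"
    (is "E_map po ?ts = _")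
proof -
  note ts = Comp_CAT2[OF s t st]
  have fg: "Sdom s \<in> Arr CAT" "Sdom t \<in> Arr CAT" "Scod t \<in> Arr CAT" "sq_top s \<in> Arr CAT"
      "sq_top t \<in> Arr CAT" "Src (sq_top s) = Src (Sdom s)" "Tgt (sq_top s) = Src (Sdom t)"
      "Src (sq_top t) = Src (Sdom t)" "Tgt (sq_top t) = Src (Scod t)"
    using s t st by (simp_all add: Arr_CAT2_iff)
  note C = L_in_CAT alpha_in_CAT E_map_in_CAT[OF s] J_map_in_CAT[OF s] E_map_in_CAT[OF t]
    J_map_in_CAT[OF t] E_map_in_CAT[OF ts] E_map_simps[OF s, unfolded st] E_map_simps[OF t]
    E_map_simps[OF ts] J_map_simps[OF s, unfolded st] J_map_simps[OF t] fcomp_in_CAT fg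
  show ?thesis
  proof (rule E_eqI[OF fg(1)])
    have "(E_map po t \<odot> E_map po s) \<odot> L_fun po (Sdom s) =
        (E_map po t \<odot> L_fun po (Sdom t)) \<odot> sq_top s"
      using E_map_L[OF s] st by (simp add: C fcomp_assoc_CAT)
    also have "\<dots> = L_fun po (Scod t) \<odot> sq_top t \<odot> sq_top s"
      by (simp add: E_map_L[OF t] C fcomp_assoc_CAT)
    finally show "E_map po ?ts \<odot> L_fun po (Sdom s) = (E_map po t \<odot> E_map po s) \<odot> L_fun po (Sdom s)"
      using E_map_L[OF ts] by simp
    have "(E_map po t \<odot> E_map po s) \<odot> alpha_fun po (Sdom s) =
        (E_map po t \<odot> alpha_fun po (Sdom t)) \<odot> J_map s"
      using E_map_alpha[OF s] st by (simp add: C fcomp_assoc_CAT)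
    also have "\<dots> = alpha_fun po (Scod t) \<odot> J_map t \<odot> J_map s"
      by (simp add: E_map_alpha[OF t] C fcomp_assoc_CAT)
    finally show "E_map po ?ts \<odot> alpha_fun po (Sdom s) =
        (E_map po t \<odot> E_map po s) \<odot> alpha_fun po (Sdom s)"
      using E_map_alpha[OF ts] J_map_comp[OF s t st] by simp
  qed (simp_all add: C)
qed

lemma R_functor_simps [simp]:
  "Src (R_functor po) = CAT2" "Tgt (R_functor po) = CAT2"
  "f \<in> Arr CAT \<Longrightarrow> OMap (R_functor po) f = R_fun po f"
  "s \<in> Arr CAT2 \<Longrightarrow> AMap (R_functor po) s =
     \<lparr>Sdom = R_fun po (Sdom s), Scod = R_fun po (Scod s), Smap = (E_map po s, sq_bot s)\<rparr>"
  by (simp_all add: R_functor_def)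

lemma is_functor_R: "is_functor (R_functor po)"
proof -
  have C: "category CAT2"
    by (rule category_arrow_category[OF category_CAT])
  have Rs: "\<lparr>Sdom = R_fun po (Sdom s), Scod = R_fun po (Scod s), Smap = (E_map po s, sq_bot s)\<rparr>
      \<in> Arr CAT2" if s: "s \<in> Arr CAT2" for s
    using s E_map_in_CAT[OF s] E_map_simps[OF s] R_E_map[OF s] by (simp add: Arr_CAT2_iff R_in_CAT)
  show ?thesis
    unfolding is_functor_def
  proof (intro conjI ballI allI impI)
    show "OMap (R_functor po) \<in> Obj (Src (R_functor po)) \<rightarrow>\<^sub>E Obj (Tgt (R_functor po))"
        "AMap (R_functor po) \<in> Arr (Src (R_functor po)) \<rightarrow>\<^sub>E Arr (Tgt (R_functor po))"
      using Rs R_in_CAT by (auto simp: R_functor_def)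
  next
    fix s assume "s \<in> Arr (Src (R_functor po))"
    then show "Dom (Tgt (R_functor po)) (AMap (R_functor po) s) =
        OMap (R_functor po) (Dom (Src (R_functor po)) s)"
      "Cod (Tgt (R_functor po)) (AMap (R_functor po) s) =
        OMap (R_functor po) (Cod (Src (R_functor po)) s)"
      by (simp_all add: Arr_CAT2_iff[THEN iffD1])
  next
    fix f assume "f \<in> Obj (Src (R_functor po))"
    then show "AMap (R_functor po) (Ident (Src (R_functor po)) f) =
        Ident (Tgt (R_functor po)) (OMap (R_functor po) f)"
      using Ident_in[OF C, of f] by (simp add: CAT_Obj_Ident E_map_idf)
  next
    fix s t assume "composable (Src (R_functor po)) t s"
    then show "AMap (R_functor po) (Comp (Src (R_functor po)) t s) =
        Comp (Tgt (R_functor po)) (AMap (R_functor po) t) (AMap (R_functor po) s)"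
      using Comp_in[OF C, of t s] E_map_comp[of s t] by (simp add: composable_def)
  qed (simp_all add: C)
qed

section \<open>The inverse of \<open>J \<langle>\<alpha>, 1\<rangle>\<close> and the
  multiplication\<close>

lemma alpha_square:
  assumes "f \<in> Arr CAT"
  shows "\<lparr>Sdom = T_fun f, Scod = R_fun po f, Smap = (alpha_fun po f, idf (Tgt f))\<rparr> \<in> Arr CAT2"
  using assms T_in_CAT[OF assms]
  by (simp add: Arr_CAT2_iff R_in_CAT alpha_in_CAT R_alpha idf_fcomp_CAT)
    (simp add: Arr_CAT_iff is_functor_idf ext_categoryD)

text \<open>The functor \<open>j\<close> replaces the first component \<open>y\<close> of a code by
  \<open>\<alpha> y\<close> and leaves the arrows of \<open>Tgt f\<close> alone. Since \<alpha> is
  bijective on objects and \<open>R f \<odot> \<alpha> = T f\<close>, this is a bijective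
  relabelling of objects and of arrows. Being invertible, \<open>j\<close> has the value of
  \<open>inverse_arrow\<close> as its actual inverse.\<close>

lemma J_alpha_inverse:
  assumes f: "f \<in> Arr CAT"
  defines "j \<equiv> J_map \<lparr>Sdom = T_fun f, Scod = R_fun po f, Smap = (alpha_fun po f, idf (Tgt f))\<rparr>"
  defines "i \<equiv> inverse_arrow CAT j"
  shows "i \<in> Arr CAT" "Src i = J_cat (R_fun po f)" "Tgt i = J_cat (T_fun f)"
    "i \<odot> j = idf (J_cat (T_fun f))" "j \<odot> i = idf (J_cat (R_fun po f))"
proof -
  note s = alpha_square[OF f] and al = alpha_bij[OF f]
  have jC: "j \<in> Arr CAT" and jst: "Src j = J_cat (T_fun f)" "Tgt j = J_cat (R_fun po f)"
    unfolding j_def using J_map_in_CAT[OF s] J_map_simps[OF s] by simp_all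
  have jo: "OMap j (enc (y, u)) = enc (OMap (alpha_fun po f) y, u)" if "liftable (T_fun f) y u" for y u
    using J_map_simps(3)[OF s, of y u] that by (simp add: j_def) (simp add: liftable_def)
  have ja: "AMap j (enc (enc (y, u), v)) = enc (enc (OMap (alpha_fun po f) y, u), v)"
    if "liftable (T_fun f) y u" "composable (Tgt f) v u" for y u v
    using J_map_simps(4)[OF s, of y u v] that by (simp add: j_def) (simp add: liftable_def composable_def)
  \<comment> \<open>This is the surjectivity: every object of \<open>E f\<close> is some
    \<open>\<alpha> y\<close>, and \<open>R f (\<alpha> y) = T f y\<close> makes an arrow out of the
    former image an arrow out of the latter.\<close>
  have li: "\<exists>y. x = OMap (alpha_fun po f) y \<and> liftable (T_fun f) y u" if "liftable (R_fun po f) x u" for x u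
  proof -
    have x: "x \<in> Obj (E_cat po f)" "u \<in> Arr (Tgt f)" "Dom (Tgt f) u = OMap (R_fun po f) x"
      using that f by (simp_all add: liftable_def)
    then obtain y where y: "y \<in> Obj (J_cat f)" "x = OMap (alpha_fun po f) y"
      using al by (auto simp: bij_betw_def)
    then have "OMap (R_fun po f) x = OMap (T_fun f) y"
      using arg_cong[OF R_alpha[OF f], of "\<lambda>H. OMap H y"] f by simp
    then show ?thesis
      using x y by (auto simp: liftable_def)
  qed
  have inj: "y = y'" if "OMap (alpha_fun po f) y = OMap (alpha_fun po f) y'"
      "liftable (T_fun f) y u" "liftable (T_fun f) y' u'" for y y' u u'
    using al that by (auto simp: bij_betw_def liftable_def dest: inj_onD)
  have jF: "is_functor j"
    using jC by (simp add: Arr_CAT_iff)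
  have "bij_betw (OMap j) (Obj (J_cat (T_fun f))) (Obj (J_cat (R_fun po f)))"
    unfolding bij_betw_def
  proof
    show "inj_on (OMap j) (Obj (J_cat (T_fun f)))"
      by (rule inj_onI) (auto simp: Obj_J jo dest: inj)
    show "OMap j ` Obj (J_cat (T_fun f)) = Obj (J_cat (R_fun po f))"
    proof
      show "OMap j ` Obj (J_cat (T_fun f)) \<subseteq> Obj (J_cat (R_fun po f))"
        using is_functorD(3)[OF jF] jst by auto
      show "Obj (J_cat (R_fun po f)) \<subseteq> OMap j ` Obj (J_cat (T_fun f))"
      proof
        fix z assume "z \<in> Obj (J_cat (R_fun po f))"
        then obtain x u where "z = enc (x, u)" "liftable (R_fun po f) x u"
          by (auto simp: Obj_J)
        moreover from li[OF this(2)] obtain y where "x = OMap (alpha_fun po f) y" "liftable (T_fun f) y u"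
          by blast
        ultimately have "z = enc (OMap (alpha_fun po f) y, u)" "liftable (T_fun f) y u"
          by simp_all
        then show "z \<in> OMap j ` Obj (J_cat (T_fun f))"
          using jo[of y u] Obj_JI[of "T_fun f" y u] by force
      qed
    qed
  qed
  moreover have "bij_betw (AMap j) (Arr (J_cat (T_fun f))) (Arr (J_cat (R_fun po f)))"
    unfolding bij_betw_def
  proof
    show "inj_on (AMap j) (Arr (J_cat (T_fun f)))"
      by (rule inj_onI) (auto simp: Arr_J ja dest: inj)
    show "AMap j ` Arr (J_cat (T_fun f)) = Arr (J_cat (R_fun po f))"
    proof
      show "AMap j ` Arr (J_cat (T_fun f)) \<subseteq> Arr (J_cat (R_fun po f))"
        using is_functorD(4)[OF jF] jst by auto
      show "Arr (J_cat (R_fun po f)) \<subseteq> AMap j ` Arr (J_cat (T_fun f))"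
      proof
        fix z assume "z \<in> Arr (J_cat (R_fun po f))"
        then obtain x u v where "z = enc (enc (x, u), v)" "liftable (R_fun po f) x u"
            "composable (Tgt f) v u"
          using f by (auto simp: Arr_J)
        moreover from li[OF this(2)] obtain y where "x = OMap (alpha_fun po f) y" "liftable (T_fun f) y u"
          by blast
        ultimately have "z = enc (enc (OMap (alpha_fun po f) y, u), v)"
            "liftable (T_fun f) y u" "composable (Tgt f) v u"
          by simp_all
        then show "z \<in> AMap j ` Arr (J_cat (T_fun f))"
          using ja[of y u v] Arr_JI[of "T_fun f" y u v] by force
      qed
    qed
  qed
  ultimately obtain k where k: "is_functor k" "Src k = J_cat (R_fun po f)" "Tgt k = J_cat (T_fun f)"
      "k \<odot> j = idf (J_cat (T_fun f))" "j \<odot> k = idf (J_cat (R_fun po f))"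
    using bij_functor_inverse[OF jF] unfolding jst by blast
  have kC: "k \<in> Arr CAT"
    using k jC jst by (simp add: Arr_CAT_iff)
  have "i = k"
    unfolding i_def
    by (rule inverse_arrow_eqI[OF category_CAT jC])
      (use k kC jst in \<open>simp add: is_inverse_def in_hom_def CAT_Obj_Ident\<close>)
  then show "i \<in> Arr CAT" "Src i = J_cat (R_fun po f)" "Tgt i = J_cat (T_fun f)"
      "i \<odot> j = idf (J_cat (T_fun f))" "j \<odot> i = idf (J_cat (R_fun po f))"
    using k kC by simp_all
qed

lemma
  assumes f: "f \<in> Arr CAT"
  shows mu_in_CAT: "mu_fun po f \<in> Arr CAT"
    and mu_simps [simp]: "Src (mu_fun po f) = E_cat po (R_fun po f)" "Tgt (mu_fun po f) = E_cat po f"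
    and mu_L: "mu_fun po f \<odot> L_fun po (R_fun po f) = idf (E_cat po f)"
    and mu_alpha: "mu_fun po f \<odot> alpha_fun po (R_fun po f) = alpha_fun po f \<odot> nu_fun f \<odot>
       inverse_arrow CAT
         (J_map \<lparr>Sdom = T_fun f, Scod = R_fun po f, Smap = (alpha_fun po f, idf (Tgt f))\<rparr>)"
proof -
  let ?s = "\<lparr>Sdom = T_fun f, Scod = R_fun po f, Smap = (alpha_fun po f, idf (Tgt f))\<rparr>"
  let ?i = "inverse_arrow CAT (J_map ?s)"
  note s = alpha_square[OF f] and i = J_alpha_inverse[OF f] and Rf = R_in_CAT[OF f]
    and Tf = T_in_CAT[OF f]
  have e: "ext_category (E_cat po f)"
    using f by (rule ext_category_E)
  have "\<exists>!m. in_hom CAT m (E_cat po (R_fun po f)) (Tgt (alpha_fun po f \<odot> nu_fun f \<odot> ?i)) \<and>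
      m \<odot> L_fun po (R_fun po f) = idf (E_cat po f) \<and>
      m \<odot> alpha_fun po (R_fun po f) = alpha_fun po f \<odot> nu_fun f \<odot> ?i"
  proof (rule E_mediator[OF Rf])
    fix a assume "a \<in> Obj (Src (R_fun po f))"
    then have a: "a \<in> Obj (E_cat po f)"
      using f by simp
    then obtain y where y: "y \<in> Obj (J_cat f)" "a = OMap (alpha_fun po f) y"
      using alpha_bij[OF f] by (auto simp: bij_betw_def)
    let ?y = "OMap (S_fun (T_fun f)) y" and ?a = "OMap (S_fun (R_fun po f)) a"
    have yJ: "?y \<in> Obj (J_cat (T_fun f))" and aJ: "?a \<in> Obj (J_cat (R_fun po f))"
      using is_functorD(3)[OF is_functor_S[OF Tf], of y] is_functorD(3)[OF is_functor_S[OF Rf], of a]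
        y(1) a f by (simp_all del: S_simps(3))
    \<comment> \<open>With \<open>a = \<alpha> y\<close>:
      \<open>J \<langle>\<alpha>, 1\<rangle>\<close> commutes with \<open>S\<close>, so its inverse
      sends \<open>S a\<close> back to \<open>S y\<close>; then \<nu> sends \<open>S y\<close> to
      \<open>y\<close>, and \<alpha> returns \<open>a\<close>. This is the compatibility of the two
      legs that define \<mu>.\<close>
    have "OMap (J_map ?s) ?y = ?a"
      using J_map_S_Obj[OF s, of y] y by (simp del: S_simps(3))
    then have "OMap ?i ?a = ?y"
      using arg_cong[OF i(4), of "\<lambda>H. OMap H ?y"] yJ J_map_simps(1)[OF s] by (simp del: S_simps(3))
    moreover have "OMap (nu_fun f) ?y = y"
      using arg_cong[OF nu_S[OF f], of "\<lambda>H. OMap H y"] y(1) by (simp del: S_simps(3))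
    ultimately show "OMap (idf (E_cat po f)) a = OMap (alpha_fun po f \<odot> nu_fun f \<odot> ?i) ?a"
      using a aJ y yJ i(2) f by (simp del: S_simps(3))
  qed (use f e i nu_in_CAT[OF f] in \<open>simp_all add: idf_in_CAT fcomp_in_CAT alpha_in_CAT\<close>)
  from theI'[OF this] show "mu_fun po f \<in> Arr CAT" "Src (mu_fun po f) = E_cat po (R_fun po f)"
      "Tgt (mu_fun po f) = E_cat po f" "mu_fun po f \<odot> L_fun po (R_fun po f) = idf (E_cat po f)"
      "mu_fun po f \<odot> alpha_fun po (R_fun po f) = alpha_fun po f \<odot> nu_fun f \<odot> ?i"
    using f by (simp_all add: mu_fun_def in_hom_def)
qed

end

section \<open>Delta lenses as functors out of \<open>J f\<close>\<close>

text \<open>An algebra structure on \<open>f\<close>, restricted along \<open>alpha_fun po f\<close>.\<close>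

definition J_algebra :: "'u small_funct \<Rightarrow> 'u small_funct \<Rightarrow> bool" where
  "J_algebra f q \<longleftrightarrow> q \<in> Arr CAT \<and> Src q = J_cat f \<and> Tgt q = Src f \<and>
     q \<odot> S_fun f = iota (Src f) \<and> f \<odot> q = T_fun f \<and>
     q \<odot> nu_fun f = q \<odot> J_map \<lparr>Sdom = T_fun f, Scod = f, Smap = (q, idf (Tgt f))\<rparr>"

definition lens_J :: "'u small_funct \<Rightarrow> ('u \<Rightarrow> 'u \<Rightarrow> 'u) \<Rightarrow> 'u small_funct" where
  "lens_J f \<phi> = J_out f (Src f) (\<lambda>a u. Cod (Src f) (\<phi> a u)) (\<lambda>a u v. \<phi> (Cod (Src f) (\<phi> a u)) v)"

text \<open>The default \<open>undefined\<close> is the one \<open>is_lens\<close> prescribes, so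
  that a lifting is recovered as a function and not only on its domain.\<close>

definition J_lift :: "'u small_funct \<Rightarrow> 'u small_funct \<Rightarrow> 'u \<Rightarrow> 'u \<Rightarrow> 'u" where
  "J_lift f q a u =
     (if liftable f a u then AMap q (enc (enc (a, Ident (Tgt f) (OMap f a)), u)) else undefined)"

lemma lensD:
  assumes "is_lens (f, \<phi>)"
  shows "f \<in> Arr CAT" "is_functor f" "category (Src f)" "category (Tgt f)"
    "liftable f a u \<Longrightarrow> \<phi> a u \<in> Arr (Src f)" "liftable f a u \<Longrightarrow> Dom (Src f) (\<phi> a u) = a"
    "liftable f a u \<Longrightarrow> AMap f (\<phi> a u) = u"
    "a \<in> Obj (Src f) \<Longrightarrow> \<phi> a (Ident (Tgt f) (OMap f a)) = Ident (Src f) a"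
    "liftable f a u \<Longrightarrow> composable (Tgt f) v u \<Longrightarrow>
       \<phi> a (Comp (Tgt f) v u) = Comp (Src f) (\<phi> (Cod (Src f) (\<phi> a u)) v) (\<phi> a u)"
    "\<not> liftable f a u \<Longrightarrow> \<phi> a u = undefined"
  using assms by (simp_all add: is_lens_def Arr_CAT_iff ext_categoryD)

text \<open>The last conclusion is (L3) read on codomains,
  \<open>p (a, v \<circ> u) = p (p (a, u), v)\<close>. It becomes the object part of the
  multiplication law.\<close>

lemma lens_lift:
  assumes l: "is_lens (f, \<phi>)" and a: "liftable f a u"
  shows "Cod (Src f) (\<phi> a u) \<in> Obj (Src f)" "OMap f (Cod (Src f) (\<phi> a u)) = Cod (Tgt f) u"
    "composable (Tgt f) v u \<Longrightarrow> liftable f (Cod (Src f) (\<phi> a u)) v"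
    "composable (Tgt f) v u \<Longrightarrow>
       Cod (Src f) (\<phi> a (Comp (Tgt f) v u)) = Cod (Src f) (\<phi> (Cod (Src f) (\<phi> a u)) v)"
proof -
  note D = lensD[OF l]
  show o: "Cod (Src f) (\<phi> a u) \<in> Obj (Src f)"
    using Cod_in[OF D(3)] D(5)[OF a] by simp
  show fo: "OMap f (Cod (Src f) (\<phi> a u)) = Cod (Tgt f) u"
    using is_functorD(6)[OF D(2) D(5)[OF a]] D(7)[OF a] by simp
  show li: "liftable f (Cod (Src f) (\<phi> a u)) v" if "composable (Tgt f) v u" for v
    using that o fo by (simp add: liftable_def composable_def)
  assume v: "composable (Tgt f) v u"
  have "composable (Src f) (\<phi> (Cod (Src f) (\<phi> a u)) v) (\<phi> a u)"
    using D(5,6)[OF li[OF v]] D(5)[OF a] by (simp add: composable_def)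
  then show "Cod (Src f) (\<phi> a (Comp (Tgt f) v u)) = Cod (Src f) (\<phi> (Cod (Src f) (\<phi> a u)) v)"
    using D(9)[OF a v] Cod_Comp[OF D(3)] by simp
qed

lemma lens_J_simps [simp]:
  fixes f :: "'u::infinite small_funct"
  shows "Src (lens_J f \<phi>) = J_cat f" "Tgt (lens_J f \<phi>) = Src f"
    "liftable f a u \<Longrightarrow> OMap (lens_J f \<phi>) (enc (a, u)) = Cod (Src f) (\<phi> a u)"
    "liftable f a u \<Longrightarrow> composable (Tgt f) v u \<Longrightarrow>
       AMap (lens_J f \<phi>) (enc (enc (a, u), v)) = \<phi> (Cod (Src f) (\<phi> a u)) v"
  by (simp_all add: lens_J_def)

lemma composable_liftable_Ident:
  assumes f: "f \<in> Arr CAT" and a: "liftable f a u"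
  shows "composable (Tgt f) u (Ident (Tgt f) (OMap f a))"
    "Comp (Tgt f) u (Ident (Tgt f) (OMap f a)) = u"
    "composable (Tgt f) (Ident (Tgt f) (Cod (Tgt f) u)) u"
    "Comp (Tgt f) (Ident (Tgt f) (Cod (Tgt f) u)) u = u"
proof -
  have "category (Tgt f)" "u \<in> Arr (Tgt f)" "Dom (Tgt f) u = OMap f a"
    using f a by (auto simp: Arr_CAT_iff ext_categoryD liftable_def)
  then show "composable (Tgt f) u (Ident (Tgt f) (OMap f a))"
    "Comp (Tgt f) u (Ident (Tgt f) (OMap f a)) = u"
    "composable (Tgt f) (Ident (Tgt f) (Cod (Tgt f) u)) u"
    "Comp (Tgt f) (Ident (Tgt f) (Cod (Tgt f) u)) u = u"
    by (simp_all add: composable_Ident composable_Ident2 Comp_Ident' Ident_Comp')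
qed

lemma J_algebra_square:
  fixes f :: "'u::infinite small_funct"
  assumes "f \<in> Arr CAT" "q \<in> Arr CAT" "Src q = J_cat f" "Tgt q = Src f" "f \<odot> q = T_fun f"
  shows "\<lparr>Sdom = T_fun f, Scod = f, Smap = (q, idf (Tgt f))\<rparr> \<in> Arr CAT2"
  using assms T_in_CAT[OF assms(1)]
  by (simp add: Arr_CAT2_iff idf_fcomp_CAT) (simp add: Arr_CAT_iff is_functor_idf ext_categoryD)

text \<open>By \<open>liftable_T\<close> both sides live on composable pairs \<open>u\<close>,
  \<open>v\<close> out of \<open>f a\<close>. There \<nu> composes the pair, while
  \<open>J \<langle>q, 1\<rangle>\<close> replaces \<open>(a, u)\<close> by its image under
  \<open>q\<close>; evaluating on codes gives the two families of equations.\<close>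

lemma J_law_iff:
  fixes f :: "'u::infinite small_funct"
  assumes f: "f \<in> Arr CAT" and q: "q \<in> Arr CAT" "Src q = J_cat f" "Tgt q = Src f"
    and qT: "f \<odot> q = T_fun f"
  shows "q \<odot> nu_fun f = q \<odot> J_map \<lparr>Sdom = T_fun f, Scod = f, Smap = (q, idf (Tgt f))\<rparr> \<longleftrightarrow>
    (\<forall>a u v. liftable f a u \<and> composable (Tgt f) v u \<longrightarrow>
       OMap q (enc (a, Comp (Tgt f) v u)) = OMap q (enc (OMap q (enc (a, u)), v))) \<and>
    (\<forall>a u v w. liftable f a u \<and> composable (Tgt f) v u \<and> composable (Tgt f) w v \<longrightarrow>
       AMap q (enc (enc (a, Comp (Tgt f) v u), w)) = AMap q (enc (enc (OMap q (enc (a, u)), v), w)))"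
    (is "?L = ?R \<longleftrightarrow> ?O \<and> ?A")
proof -
  note s = J_algebra_square[OF f q qT] and nu = nu_in_CAT[OF f]
  have F: "is_functor ?L" "is_functor ?R"
    using f q nu J_map_in_CAT[OF s] J_map_simps[OF s]
    by (auto simp: Arr_CAT_iff intro!: is_functor_fcomp)
  have LR: "OMap ?L (enc (enc (a, u), v)) = OMap q (enc (a, Comp (Tgt f) v u))"
    "OMap ?R (enc (enc (a, u), v)) = OMap q (enc (OMap q (enc (a, u)), v))"
    if "liftable f a u" "composable (Tgt f) v u" for a u v
  proof -
    have l: "liftable (T_fun f) (enc (a, u)) v" "v \<in> Arr (Tgt f)"
      using that by (auto simp: liftable_T composable_def)
    then show "OMap ?L (enc (enc (a, u), v)) = OMap q (enc (a, Comp (Tgt f) v u))"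
      using that f by (simp add: Obj_JI nu_Obj)
    show "OMap ?R (enc (enc (a, u), v)) = OMap q (enc (OMap q (enc (a, u)), v))"
      using l J_map_simps(1,3)[OF s] by (simp add: Obj_JI)
  qed
  have LRa: "AMap ?L (enc (enc (enc (a, u), v), w)) = AMap q (enc (enc (a, Comp (Tgt f) v u), w))"
    "AMap ?R (enc (enc (enc (a, u), v), w)) = AMap q (enc (enc (OMap q (enc (a, u)), v), w))"
    if "liftable f a u" "composable (Tgt f) v u" "composable (Tgt f) w v" for a u v w
  proof -
    have l: "liftable (T_fun f) (enc (a, u)) v" "v \<in> Arr (Tgt f)" "w \<in> Arr (Tgt f)"
      using that by (auto simp: liftable_T composable_def)
    then show "AMap ?L (enc (enc (enc (a, u), v), w)) = AMap q (enc (enc (a, Comp (Tgt f) v u), w))"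
      using that f by (simp add: Arr_JI nu_Arr)
    show "AMap ?R (enc (enc (enc (a, u), v), w)) = AMap q (enc (enc (OMap q (enc (a, u)), v), w))"
      using l that J_map_simps(1,4)[OF s] by (simp add: Arr_JI)
  qed
  show ?thesis
  proof
    assume "?L = ?R"
    then show "?O \<and> ?A"
      using LR LRa by metis
  next
    assume "?O \<and> ?A"
    then show "?L = ?R"
      by (intro J_eqI[where f = "T_fun f", OF F])
        (use f J_map_simps(1)[OF s] LR LRa in \<open>auto simp: liftable_T\<close>)
  qed
qed

text \<open>Each axiom has its place: (L3) gives composites and their endpoints, (L2) gives
  identities and \<open>q \<odot> S_fun f = iota (Src f)\<close>, (L1) gives
  \<open>f \<odot> q = T_fun f\<close>. The multiplication law needs just that endpoints of lifts
  compose, because \<open>lens_J\<close> treats an arrow out of \<open>(a, u)\<close> only through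
  the endpoint of \<open>\<phi> a u\<close>.\<close>

lemma lens_J_algebra:
  fixes f :: "'u::infinite small_funct"
  assumes l: "is_lens (f, \<phi>)"
  shows "J_algebra f (lens_J f \<phi>)" "J_lift f (lens_J f \<phi>) = \<phi>"
proof -
  note D = lensD[OF l] and P = lens_lift[OF l] and f = lensD(1)[OF l] and B = lensD(4)[OF l]
  let ?q = "lens_J f \<phi>"
  have eA: "ext_category (Src f)"
    using f by (simp add: Arr_CAT_iff)
  have q: "?q \<in> Arr CAT"
    unfolding lens_J_def
  proof (rule J_out_in_CAT[OF f eA])
    fix a u v assume a: "liftable f a u" "composable (Tgt f) v u"
    then show "in_hom (Src f) (\<phi> (Cod (Src f) (\<phi> a u)) v) (Cod (Src f) (\<phi> a u))
        (Cod (Src f) (\<phi> a (Comp (Tgt f) v u)))"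
      using D(5,6)[OF P(3)[OF a]] P(4)[OF a] by (simp add: in_hom_def)
    fix w assume w: "composable (Tgt f) w v"
    show "\<phi> (Cod (Src f) (\<phi> a u)) (Comp (Tgt f) w v) =
        Comp (Src f) (\<phi> (Cod (Src f) (\<phi> a (Comp (Tgt f) v u))) w) (\<phi> (Cod (Src f) (\<phi> a u)) v)"
      using D(9)[OF P(3)[OF a] w] P(4)[OF a] by simp
  next
    fix a u assume a: "liftable f a u"
    then show "Cod (Src f) (\<phi> a u) \<in> Obj (Src f)"
      by (rule P(1))
    show "\<phi> (Cod (Src f) (\<phi> a u)) (Ident (Tgt f) (Cod (Tgt f) u)) =
        Ident (Src f) (Cod (Src f) (\<phi> a u))"
      using D(8)[OF P(1)[OF a]] P(2)[OF a] by simp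
  qed
  have qS: "?q \<odot> S_fun f = iota (Src f)"
  proof (rule funct_discr_eqI)
    show "is_functor (?q \<odot> S_fun f)" "is_functor (iota (Src f))"
      using q is_functor_S[OF f] iota_in_CAT[OF eA] by (auto simp: Arr_CAT_iff intro!: is_functor_fcomp)
    fix a assume a: "a \<in> Obj (Src f)"
    then show "OMap (?q \<odot> S_fun f) a = OMap (iota (Src f)) a"
      using liftable_Ident[OF f a] D(8)[OF a] by (simp add: Cod_Ident[OF D(3)])
  qed simp_all
  have qT: "f \<odot> ?q = T_fun f"
  proof (rule J_eqI[where f = f])
    show "is_functor (f \<odot> ?q)" "is_functor (T_fun f)"
      using q D(2) is_functor_T[OF f] by (auto simp: Arr_CAT_iff intro!: is_functor_fcomp)
  qed (use P D(7) in \<open>simp_all add: Obj_JI Arr_JI\<close>)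
  have "?q \<odot> nu_fun f = ?q \<odot> J_map \<lparr>Sdom = T_fun f, Scod = f, Smap = (?q, idf (Tgt f))\<rparr>"
    by (subst J_law_iff[OF f q _ _ qT])
      (use P liftable_Comp[OF f] composable_Comp'[OF B] in simp_all)
  then show "J_algebra f ?q"
    using q qS qT by (simp add: J_algebra_def)
  \<comment> \<open>The arrow \<open>u\<close> out of \<open>(a, 1)\<close> is sent to the lift of
    \<open>u\<close> at the endpoint of \<open>\<phi> a 1\<close>, and that endpoint is
    \<open>a\<close> by (L2).\<close>
  have "J_lift f ?q a u = \<phi> a u" for a u
  proof (cases "liftable f a u")
    case True
    then have a: "a \<in> Obj (Src f)"
      by (simp add: liftable_def)
    show ?thesis
      using True liftable_Ident[OF f a] composable_liftable_Ident[OF f True] D(8)[OF a] D(3) a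
      by (simp add: J_lift_def Cod_Ident)
  qed (simp add: J_lift_def D(10))
  then show "J_lift f ?q = \<phi>"
    by blast
qed

text \<open>Evaluation at the arrow \<open>u : (a, 1) \<rightarrow> (a, u)\<close> turns
  \<open>f \<odot> q = T_fun f\<close> into (L1) and \<open>q \<odot> S_fun f = iota (Src f)\<close>
  into the condition on the domain of a lift; (L2) is preservation of identities.\<close>

lemma J_algebra_lens:
  fixes f :: "'u::infinite small_funct"
  assumes f: "f \<in> Arr CAT" and al: "J_algebra f q"
  shows "is_lens (f, J_lift f q)" "lens_J f (J_lift f q) = q"
proof -
  let ?\<phi> = "J_lift f q"
  let ?i = "\<lambda>a. Ident (Tgt f) (OMap f a)"
  have q: "q \<in> Arr CAT" "Src q = J_cat f" "Tgt q = Src f" and qS: "q \<odot> S_fun f = iota (Src f)"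
    and qT: "f \<odot> q = T_fun f"
    and law: "q \<odot> nu_fun f = q \<odot> J_map \<lparr>Sdom = T_fun f, Scod = f, Smap = (q, idf (Tgt f))\<rparr>"
    using al by (auto simp: J_algebra_def)
  have qF: "is_functor q" and fF: "is_functor f" and A: "category (Src f)" and B: "category (Tgt f)"
    using q f by (simp_all add: Arr_CAT_iff ext_categoryD)
  note qD = is_functorD[OF qF, unfolded q(2,3)]
  have lawA: "AMap q (enc (enc (a, Comp (Tgt f) v u), w)) = AMap q (enc (enc (OMap q (enc (a, u)), v), w))"
    if "liftable f a u" "composable (Tgt f) v u" "composable (Tgt f) w v" for a u v w
    using law that unfolding J_law_iff[OF f q qT] by blast
  have qS': "OMap q (enc (a, ?i a)) = a" if "a \<in> Obj (Src f)" for a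
    using arg_cong[OF qS, of "\<lambda>H. OMap H a"] that by simp
  have qT': "OMap f (OMap q (enc (a, u))) = Cod (Tgt f) u" if "liftable f a u" for a u
    using arg_cong[OF qT, of "\<lambda>H. OMap H (enc (a, u))"] that q by (simp add: Obj_JI)
  have lift: "?\<phi> a u = AMap q (enc (enc (a, ?i a), u))" "?\<phi> a u \<in> Arr (Src f)"
      "Dom (Src f) (?\<phi> a u) = a" "Cod (Src f) (?\<phi> a u) = OMap q (enc (a, u))" "AMap f (?\<phi> a u) = u"
    if u: "liftable f a u" for a u
  proof -
    have a: "a \<in> Obj (Src f)"
      using u by (simp add: liftable_def)
    note i = liftable_Ident[OF f a] composable_liftable_Ident(1,2)[OF f u]
    note m = Arr_JI[OF i(1,2)]
    show e: "?\<phi> a u = AMap q (enc (enc (a, ?i a), u))"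
      using u by (simp add: J_lift_def)
    show "?\<phi> a u \<in> Arr (Src f)" "Dom (Src f) (?\<phi> a u) = a"
        "Cod (Src f) (?\<phi> a u) = OMap q (enc (a, u))"
      unfolding e using qD(4-6)[OF m] i qS'[OF a] by (simp_all add: Dom_J Cod_J)
    show "AMap f (?\<phi> a u) = u"
      unfolding e using arg_cong[OF qT, of "\<lambda>H. AMap H (enc (enc (a, ?i a), u))"] m i q by simp
  qed
  \<comment> \<open>The law is used at the pair \<open>u\<close>, \<open>1\<close>. Composing with
    the identity leaves \<open>(a, u)\<close> unchanged, so the arrow \<open>w\<close> out of
    \<open>(a, u)\<close> has the same image as the arrow \<open>w\<close> out of
    \<open>(q (a, u), 1)\<close>, and the latter is a lift by definition.\<close>
  have arr: "AMap q (enc (enc (a, u), w)) = ?\<phi> (Cod (Src f) (?\<phi> a u)) w"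
    if u: "liftable f a u" and w: "composable (Tgt f) w u" for a u w
  proof -
    have qo: "OMap q (enc (a, u)) \<in> Obj (Src f)"
      using qD(3)[OF Obj_JI[OF u]] .
    then have l: "liftable f (OMap q (enc (a, u))) w"
      using w qT'[OF u] by (simp add: liftable_def composable_def)
    have c: "composable (Tgt f) w (Ident (Tgt f) (Cod (Tgt f) u))"
      using w B by (intro composable_Ident2) (simp_all add: composable_def)
    show ?thesis
      using lawA[OF u composable_liftable_Ident(3)[OF f u] c] composable_liftable_Ident(4)[OF f u]
        lift(1)[OF l] lift(4)[OF u] qT'[OF u] by simp
  qed
  show "is_lens (f, ?\<phi>)"
    unfolding is_lens_def split
  proof (intro conjI allI ballI impI)
    fix a assume a: "a \<in> Obj (Src f)"
    note i = liftable_Ident[OF f a]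
    have "Cod (Tgt f) (?i a) = OMap f a"
      using is_functorD(3)[OF fF a] B by (simp add: Cod_Ident)
    then show "?\<phi> a (?i a) = Ident (Src f) a"
      using lift(1)[OF i] Ident_J[OF i] qD(7)[OF Obj_JI[OF i]] qS'[OF a] by simp
  next
    fix a u v assume "liftable f a u \<and> composable (Tgt f) v u"
    then have u: "liftable f a u" and v: "composable (Tgt f) v u"
      by simp_all
    have a: "a \<in> Obj (Src f)"
      using u by (simp add: liftable_def)
    note i = liftable_Ident[OF f a] and ci = composable_liftable_Ident[OF f u]
    \<comment> \<open>In \<open>J f\<close> the arrow \<open>u : (a, 1) \<rightarrow> (a, u)\<close>
      followed by \<open>v : (a, u) \<rightarrow> (a, v \<circ> u)\<close> is the arrow
      \<open>v \<circ> u\<close> out of \<open>(a, 1)\<close>. Applying \<open>q\<close> and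
      rewriting the image of the second factor by \<open>arr\<close> yields (L3).\<close>
    have c: "composable (J_cat f) (enc (enc (a, u), v)) (enc (enc (a, ?i a), u))"
      using Arr_JI[OF u v] Arr_JI[OF i ci(1)] Dom_J[OF u v] Cod_J[OF i ci(1)] ci(2)
      by (simp add: composable_def)
    have "Comp (J_cat f) (enc (enc (a, u), v)) (enc (enc (a, ?i a), u)) =
        enc (enc (a, ?i a), Comp (Tgt f) v u)"
      using Comp_J[OF i ci(1), of v] ci(2) u v by simp
    then have "AMap q (enc (enc (a, ?i a), Comp (Tgt f) v u)) =
        Comp (Src f) (AMap q (enc (enc (a, u), v))) (AMap q (enc (enc (a, ?i a), u)))"
      using qD(8)[OF c] by simp
    then show "?\<phi> a (Comp (Tgt f) v u) = Comp (Src f) (?\<phi> (Cod (Src f) (?\<phi> a u)) v) (?\<phi> a u)"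
      using lift(1)[OF liftable_Comp[OF f u v]] lift(1)[OF u] arr[OF u v] by simp
  qed (use f lift in \<open>auto simp: J_lift_def\<close>)
  \<comment> \<open>The converse construction supplies functoriality of
    \<open>lens_J f ?\<phi>\<close>, after which equality with \<open>q\<close> is a comparison of
    codes by \<open>lift(4)\<close> and \<open>arr\<close>.\<close>
  then have "J_algebra f (lens_J f ?\<phi>)"
    by (rule lens_J_algebra)
  then have "is_functor (lens_J f ?\<phi>)"
    by (simp add: J_algebra_def Arr_CAT_iff)
  then show "lens_J f ?\<phi> = q"
    by (rule J_eqI[where f = f, OF _ qF]) (use q lift(4) arr in simp_all)
qed

text \<open>Backwards, evaluate at the arrow \<open>u\<close> out of \<open>(a, 1)\<close>, where
  \<open>lens_J\<close> takes the value \<open>\<phi> a u\<close>. Forwards, an arrow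
  \<open>v\<close> out of \<open>(a, u)\<close> goes to a lift starting at the endpoint of a lift,
  so preservation of lifts is used twice: once for the endpoint (\<open>mo\<close>) and once for the
  arrow.\<close>

lemma lens_morphism_iff:
  fixes f g :: "'u::infinite small_funct"
  assumes l: "is_lens (f, \<phi>)" "is_lens (g, \<psi>)"
    and s: "\<lparr>Sdom = f, Scod = g, Smap = (h, k)\<rparr> \<in> Arr CAT2"
  shows "(\<forall>a u. liftable f a u \<longrightarrow> AMap h (\<phi> a u) = \<psi> (OMap h a) (AMap k u)) \<longleftrightarrow>
    h \<odot> lens_J f \<phi> = lens_J g \<psi> \<odot> J_map \<lparr>Sdom = f, Scod = g, Smap = (h, k)\<rparr>"
    (is "?l \<longleftrightarrow> ?L = ?R")
proof -
  let ?s = "\<lparr>Sdom = f, Scod = g, Smap = (h, k)\<rparr>"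
  note D = lensD[OF l(1)] and P = lens_lift[OF l(1)] and E = lensD[OF l(2)] and f = lensD(1)[OF l(1)]
  have hk: "is_functor h" "is_functor k" "Src h = Src f" "Tgt h = Src g" "Src k = Tgt f"
      "Tgt k = Tgt g"
    using s by (simp_all add: Arr_CAT2_iff Arr_CAT_iff)
  have kf: "k \<odot> f = g \<odot> h"
    using s by (simp add: Arr_CAT2_iff)
  have sq: "OMap k (OMap f a) = OMap g (OMap h a)" if "a \<in> Obj (Src f)" for a
    using arg_cong[OF kf, of "\<lambda>H. OMap H a"] that hk by simp
  note hD = is_functorD[OF hk(1), unfolded hk] and kD = is_functorD[OF hk(2), unfolded hk]
  have li: "liftable g (OMap h a) (AMap k u)" if "liftable f a u" for a u
    using liftable_square[OF s, of a u] that by simp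
  have Js: "Src (J_map ?s) = J_cat f" "Tgt (J_map ?s) = J_cat g"
    "liftable f a u \<Longrightarrow> OMap (J_map ?s) (enc (a, u)) = enc (OMap h a, AMap k u)"
    "liftable f a u \<Longrightarrow> composable (Tgt f) v u \<Longrightarrow>
       AMap (J_map ?s) (enc (enc (a, u), v)) = enc (enc (OMap h a, AMap k u), AMap k v)" for a u v
    using J_map_simps[OF s] by simp_all
  show ?thesis
  proof
    assume ?l
    then have m: "AMap h (\<phi> a u) = \<psi> (OMap h a) (AMap k u)" if "liftable f a u" for a u
      using that by blast
    have mo: "OMap h (Cod (Src f) (\<phi> a u)) = Cod (Src g) (\<psi> (OMap h a) (AMap k u))"
      if "liftable f a u" for a u
      using hD(6)[OF D(5)[OF that]] m[OF that] by simp
    show "?L = ?R"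
    proof (rule J_eqI[where f = f])
      show "is_functor ?L" "is_functor ?R"
        using hk Js J_map_in_CAT[OF s] lens_J_algebra(1)[OF l(1)] lens_J_algebra(1)[OF l(2)]
        by (auto simp: J_algebra_def Arr_CAT_iff intro!: is_functor_fcomp)
      fix a u assume u: "liftable f a u"
      then show "OMap ?L (enc (a, u)) = OMap ?R (enc (a, u))"
        using mo[OF u] li[OF u] Js by (simp add: Obj_JI)
      fix v assume v: "composable (Tgt f) v u"
      then show "AMap ?L (enc (enc (a, u), v)) = AMap ?R (enc (enc (a, u), v))"
        using u mo[OF u] m[OF P(3)[OF u v]] li[OF u] kD(9)[OF v] Js by (simp add: Arr_JI)
    qed (use hk Js in simp_all)
  next
    assume e: "?L = ?R"
    show ?l
    proof (intro allI impI)
      fix a u assume u: "liftable f a u"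
      then have a: "a \<in> Obj (Src f)"
        by (simp add: liftable_def)
      have ha: "OMap h a \<in> Obj (Src g)"
        using hD(3)[OF a] .
      note i = liftable_Ident[OF f a] composable_liftable_Ident[OF f u]
      have ki: "AMap k (Ident (Tgt f) (OMap f a)) = Ident (Tgt g) (OMap g (OMap h a))"
        using kD(7)[OF is_functorD(3)[OF D(2) a]] sq[OF a] by simp
      note c = composable_liftable_Ident(1)[OF E(1) li[OF u]]
      have "AMap ?L (enc (enc (a, Ident (Tgt f) (OMap f a)), u)) = AMap h (\<phi> a u)"
        using Arr_JI[OF i(1,2)] i(1,2) D(8)[OF a] Cod_Ident[OF D(3) a] by simp
      moreover have "AMap ?R (enc (enc (a, Ident (Tgt f) (OMap f a)), u)) = \<psi> (OMap h a) (AMap k u)"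
        using Arr_JI[OF i(1,2)] i(1,2) Js ki liftable_Ident[OF E(1) ha] c E(8)[OF ha] Cod_Ident[OF E(3) ha]
        by simp
      ultimately show "AMap h (\<phi> a u) = \<psi> (OMap h a) (AMap k u)"
        using e by simp
    qed
  qed
qed

section \<open>The category of delta lenses\<close>

lemma Lens_simps [simp]:
  "Obj Lens = {X. is_lens X}" "Dom Lens = Sdom" "Cod Lens = Scod"
  "Ident Lens X = \<lparr>Sdom = X, Scod = X, Smap = (idf (Src (fst X)), idf (Tgt (fst X)))\<rparr>"
  "Comp Lens t s = \<lparr>Sdom = Sdom s, Scod = Scod t,
        Smap = (fst (Smap t) \<odot> fst (Smap s), snd (Smap t) \<odot> snd (Smap s))\<rparr>"
  by (simp_all add: Lens_def)

definition underlying_square ::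
  "('u lens, 'u small_funct \<times> 'u small_funct) struct_arrow \<Rightarrow> 'u square" where
  "underlying_square s = \<lparr>Sdom = fst (Sdom s), Scod = fst (Scod s), Smap = Smap s\<rparr>"

text \<open>Separating the underlying square from the lifting condition lets identities and
  composites of lens morphisms inherit their squares from \<open>CAT2\<close>, and matches the form
  of algebra morphisms.\<close>

lemma Arr_Lens:
  "s \<in> Arr Lens \<longleftrightarrow> is_lens (Sdom s) \<and> is_lens (Scod s) \<and> underlying_square s \<in> Arr CAT2 \<and>
     (\<forall>a u. liftable (fst (Sdom s)) a u \<longrightarrow>
        AMap (fst (Smap s)) (snd (Sdom s) a u) =
          snd (Scod s) (OMap (fst (Smap s)) a) (AMap (snd (Smap s)) u))"
  unfolding Lens_def underlying_square_def
  by (cases s) (auto simp: Arr_CAT2_iff in_hom_def is_lens_def split: prod.splits)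

lemma category_Lens: "category (Lens :: ('u::infinite lens, _) cat)"
proof (rule categoryI)
  have C2: "category CAT2"
    by (rule category_arrow_category[OF category_CAT])
  fix X :: "'u lens"
  assume "X \<in> Obj Lens"
  moreover obtain f \<phi> where X: "X = (f, \<phi>)"
    by (cases X)
  ultimately have l: "is_lens (f, \<phi>)"
    by simp
  then show "in_hom Lens (Ident Lens X) X X"
    using lensD(1,5)[OF l] Ident_in[OF C2, of f]
    by (auto simp: in_hom_def Arr_Lens X underlying_square_def CAT_Obj_Ident liftable_def)
next
  have C2: "category CAT2"
    by (rule category_arrow_category[OF category_CAT])
  fix s t :: "('u lens, 'u small_funct \<times> 'u small_funct) struct_arrow"
  assume "composable Lens t s"
  then have s: "s \<in> Arr Lens" and t: "t \<in> Arr Lens" and st: "Sdom t = Scod s"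
    by (simp_all add: composable_def)
  have us: "underlying_square s \<in> Arr CAT2" "underlying_square t \<in> Arr CAT2"
    using s t by (simp_all add: Arr_Lens)
  obtain f \<phi> where f: "Sdom s = (f, \<phi>)"
    by (cases "Sdom s")
  have l: "is_lens (f, \<phi>)"
    using s f by (simp add: Arr_Lens)
  have u: "underlying_square (Comp Lens t s) \<in> Arr CAT2"
    using Comp_CAT2[OF us] st by (simp add: underlying_square_def)
  have "AMap (fst (Smap t) \<odot> fst (Smap s)) (\<phi> a u) =
      snd (Scod t) (OMap (fst (Smap t) \<odot> fst (Smap s)) a) (AMap (snd (Smap t) \<odot> snd (Smap s)) u)"
    if a: "liftable f a u" for a u
  proof -
    have "Src (fst (Smap s)) = Src f" "Src (snd (Smap s)) = Tgt f"
      using us(1) f by (simp_all add: Arr_CAT2_iff underlying_square_def)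
    moreover have "AMap (fst (Smap s)) (\<phi> a u) =
        snd (Scod s) (OMap (fst (Smap s)) a) (AMap (snd (Smap s)) u)"
      using s a f by (simp add: Arr_Lens)
    \<comment> \<open>This allows the lifting condition of \<open>t\<close> to be applied to the
      image of \<open>(a, u)\<close> under \<open>s\<close>.\<close>
    moreover have "liftable (fst (Sdom t)) (OMap (fst (Smap s)) a) (AMap (snd (Smap s)) u)"
      using liftable_square[OF us(1), of a u] a f st by (simp add: underlying_square_def)
    ultimately show ?thesis
      using t a lensD(5)[OF l a] st by (simp add: Arr_Lens liftable_def[of f])
  qed
  then show "in_hom Lens (Comp Lens t s) (Dom Lens s) (Cod Lens t)"
    using u s t f by (simp add: in_hom_def Arr_Lens)
next
  fix s t r :: "('u lens, 'u small_funct \<times> 'u small_funct) struct_arrow"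
  assume "composable Lens r t" "composable Lens t s"
  then show "Comp Lens r (Comp Lens t s) = Comp Lens (Comp Lens r t) s"
    by (auto simp: composable_def Arr_Lens Arr_CAT2_iff underlying_square_def fcomp_assoc_CAT)
qed (auto simp: Arr_Lens Arr_CAT2_iff underlying_square_def fcomp_idf_CAT idf_fcomp_CAT)

section \<open>Algebras for the monad as functors out of \<open>J f\<close>\<close>

context chosen_pushouts
begin

abbreviation "R_algebra \<equiv> is_algebra CAT2 (R_functor po) (eta_sq po) (mu_sq po)"

abbreviation "structure_square f p \<equiv> \<lparr>Sdom = R_fun po f, Scod = f, Smap = (p, idf (Tgt f))\<rparr>"

lemma structure_square_in:
  assumes "f \<in> Arr CAT" "p \<in> Arr CAT" "Src p = E_cat po f" "Tgt p = Src f" "f \<odot> p = R_fun po f"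
  shows "structure_square f p \<in> Arr CAT2"
  using assms by (simp add: Arr_CAT2_iff R_in_CAT idf_fcomp_CAT)
    (simp add: Arr_CAT_iff is_functor_idf ext_categoryD)

text \<open>The squares \<eta> and \<mu> have identities at the bottom. The unit law therefore
  forces the bottom of \<open>a\<close> to be an identity, and all remaining content sits in the top
  functor \<open>p\<close>.\<close>

lemma R_algebra_iff:
  "R_algebra (f, a) \<longleftrightarrow> f \<in> Arr CAT \<and> (\<exists>p. a = structure_square f p \<and> p \<in> Arr CAT \<and>
     Src p = E_cat po f \<and> Tgt p = Src f \<and> p \<odot> L_fun po f = idf (Src f) \<and> f \<odot> p = R_fun po f \<and>
     p \<odot> mu_fun po f = p \<odot> E_map po (structure_square f p))" (is "?l \<longleftrightarrow> ?r")
proof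
  assume al: ?l
  then have f: "f \<in> Arr CAT" and a: "a \<in> Arr CAT2" "Sdom a = R_fun po f" "Scod a = f"
    and eta: "Comp CAT2 a (eta_sq po f) = Ident CAT2 f"
    and mu: "Comp CAT2 a (mu_sq po f) = Comp CAT2 a (AMap (R_functor po) a)"
    by (simp_all add: is_algebra_def in_hom_def)
  obtain p k where pk: "Smap a = (p, k)"
    by (cases "Smap a")
  have p: "p \<in> Arr CAT" "k \<in> Arr CAT" "Src p = E_cat po f" "Tgt p = Src f" "Src k = Tgt f"
      "Tgt k = Tgt f" "k \<odot> R_fun po f = f \<odot> p"
    using a pk f by (simp_all add: Arr_CAT2_iff)
  have k: "k = idf (Tgt f)" and pL: "p \<odot> L_fun po f = idf (Src f)"
    using eta pk p by (simp_all add: eta_sq_def CAT_Obj_Ident fcomp_idf_CAT)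
  have e: "a = structure_square f p"
    using a pk k by (cases a) simp
  have "p \<odot> mu_fun po f = p \<odot> E_map po a"
    using mu a(1) pk by (simp add: mu_sq_def)
  then show ?r
    using f e p k pL R_in_CAT[OF f] by (auto simp: idf_fcomp_CAT)
next
  assume r: ?r
  then obtain p where f: "f \<in> Arr CAT" and a: "a = structure_square f p" and p: "p \<in> Arr CAT"
     "Src p = E_cat po f" "Tgt p = Src f" "p \<odot> L_fun po f = idf (Src f)" "f \<odot> p = R_fun po f"
     "p \<odot> mu_fun po f = p \<odot> E_map po a"
    by auto
  note s = structure_square_in[OF f p(1,2,3,5)]
  have "idf (Tgt f) \<in> Arr CAT"
    using f by (simp add: Arr_CAT_iff is_functor_idf ext_categoryD)
  then show ?l
    using f p s by (simp add: is_algebra_def in_hom_def a eta_sq_def mu_sq_def CAT_Obj_Ident fcomp_idf_CAT)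
qed

text \<open>The multiplication law is tested on the two legs of the pushout defining \<open>E (R f)\<close>; on the
  first it is void.\<close>

lemma mu_law_iff:
  assumes f: "f \<in> Arr CAT" and p: "p \<in> Arr CAT" "Src p = E_cat po f" "Tgt p = Src f"
    and pL: "p \<odot> L_fun po f = idf (Src f)" and fp: "f \<odot> p = R_fun po f"
  defines "q \<equiv> p \<odot> alpha_fun po f"
  shows "p \<odot> mu_fun po f = p \<odot> E_map po (structure_square f p) \<longleftrightarrow>
    q \<odot> nu_fun f = q \<odot> J_map \<lparr>Sdom = T_fun f, Scod = f, Smap = (q, idf (Tgt f))\<rparr>" (is "?l = ?r \<longleftrightarrow> ?J")
proof -
  let ?s = "\<lparr>Sdom = T_fun f, Scod = R_fun po f, Smap = (alpha_fun po f, idf (Tgt f))\<rparr>"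
  let ?i = "inverse_arrow CAT (J_map ?s)"
  let ?a = "structure_square f p"
  note s = alpha_square[OF f] and i = J_alpha_inverse[OF f] and a = structure_square_in[OF f p fp]
    and Rf = R_in_CAT[OF f] and Tf = T_in_CAT[OF f]
  have C: "q \<in> Arr CAT" "Src q = J_cat f" "Tgt q = Src f"
    using f p by (simp_all add: q_def fcomp_in_CAT alpha_in_CAT)
  note in_CAT = f p Rf C i(1,2,3) L_in_CAT alpha_in_CAT mu_in_CAT nu_in_CAT J_map_in_CAT[OF s]
    J_map_in_CAT[OF a] E_map_in_CAT[OF a] fcomp_in_CAT J_map_simps(1,2)[OF s] J_map_simps(1,2)[OF a]
    E_map_simps[OF a]
  \<comment> \<open>\<open>\<langle>q, 1\<rangle>\<close> factors as
    \<open>\<langle>\<alpha>, 1\<rangle> : T f \<rightarrow> R f\<close> followed by the structure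
    square \<open>\<langle>p, 1\<rangle> : R f \<rightarrow> f\<close>.\<close>
  have sT: "J_map \<lparr>Sdom = T_fun f, Scod = f, Smap = (q, idf (Tgt f))\<rparr> = J_map ?a \<odot> J_map ?s"
    using J_map_comp[OF s a] f
    by (simp add: q_def idf_fcomp_CAT idf_in_CAT Arr_CAT_iff[THEN iffD1])
  have la: "?l \<odot> alpha_fun po (R_fun po f) = q \<odot> nu_fun f \<odot> ?i"
    by (simp add: in_CAT fcomp_assoc_CAT mu_alpha q_def)
  have ra: "?r \<odot> alpha_fun po (R_fun po f) = q \<odot> J_map ?a"
    using E_map_alpha[OF a] by (simp add: in_CAT fcomp_assoc_CAT q_def)
  show ?thesis
  proof
    assume "?l = ?r"
    \<comment> \<open>Precomposition with \<open>J \<langle>\<alpha>, 1\<rangle>\<close> cancels the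
      inverse hidden in \<mu>; the other direction precomposes with the inverse.\<close>
    then have "(q \<odot> nu_fun f \<odot> ?i) \<odot> J_map ?s = (q \<odot> J_map ?a) \<odot> J_map ?s"
      using la ra by simp
    then show ?J
      using i(4) by (simp add: in_CAT fcomp_assoc_CAT sT fcomp_idf_CAT)
  next
    assume ?J
    then have "(q \<odot> nu_fun f) \<odot> ?i = (q \<odot> J_map ?a \<odot> J_map ?s) \<odot> ?i"
      by (simp add: sT)
    then have e: "q \<odot> nu_fun f \<odot> ?i = q \<odot> J_map ?a"
      using i(5) by (simp add: in_CAT fcomp_assoc_CAT fcomp_idf_CAT)
    show "?l = ?r"
    proof (rule E_eqI[OF Rf])
      \<comment> \<open>On this leg both sides equal \<open>p\<close>: the left one by
        \<open>\<mu> \<odot> L = 1\<close>, the right one by naturality of \<open>L\<close> and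
        \<open>p \<odot> L = 1\<close>.\<close>
      have "?r \<odot> L_fun po (R_fun po f) = (p \<odot> L_fun po f) \<odot> p"
        using E_map_L[OF a] by (simp add: in_CAT fcomp_assoc_CAT)
      then show "?l \<odot> L_fun po (R_fun po f) = ?r \<odot> L_fun po (R_fun po f)"
        by (simp add: in_CAT fcomp_assoc_CAT mu_L pL fcomp_idf_CAT idf_fcomp_CAT)
    qed (simp_all add: in_CAT la ra e)
  qed
qed

text \<open>The pushout square moves the unit law across: \<open>p \<odot> \<alpha> \<odot> S = p
  \<odot> L \<odot> \<iota> = \<iota>\<close>.\<close>

lemma R_algebra_J_algebra:
  assumes "R_algebra (f, a)"
  shows "J_algebra f (sq_top a \<odot> alpha_fun po f)"
proof -
  obtain p where f: "f \<in> Arr CAT" and a: "a = structure_square f p"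
    and p: "p \<in> Arr CAT" "Src p = E_cat po f" "Tgt p = Src f"
     "p \<odot> L_fun po f = idf (Src f)" "f \<odot> p = R_fun po f"
     "p \<odot> mu_fun po f = p \<odot> E_map po (structure_square f p)"
    using assms by (auto simp: R_algebra_iff)
  have S: "S_fun f \<in> Arr CAT" and io: "iota (Src f) \<in> Arr CAT"
    using f S_in_CAT[OF f] iota_in_CAT[of "Src f"] by (simp_all add: Arr_CAT_iff)
  note C = f p(1-3) S io L_in_CAT alpha_in_CAT R_in_CAT fcomp_in_CAT
  have "(p \<odot> alpha_fun po f) \<odot> S_fun f = (p \<odot> L_fun po f) \<odot> iota (Src f)"
    by (simp add: C fcomp_assoc_CAT L_iota)
  also have "\<dots> = iota (Src f)"
    using io by (simp add: p(4) idf_fcomp_CAT)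
  finally have "(p \<odot> alpha_fun po f) \<odot> S_fun f = iota (Src f)" .
  moreover have "f \<odot> p \<odot> alpha_fun po f = T_fun f"
    using fcomp_assoc_CAT[of "alpha_fun po f" p f] by (simp add: C p(5) R_alpha)
  ultimately show ?thesis
    using mu_law_iff[OF f p(1-5)] p(6) by (simp add: J_algebra_def a C)
qed

text \<open>The functor \<open>p\<close> mediates the cocone formed by the identity and
  \<open>q\<close>. Uniqueness among the algebra structures that restrict to \<open>q\<close> is
  what gives the \<open>THE\<close> in \<open>lens_algebra\<close> a value.\<close>

lemma J_algebra_R_algebra:
  assumes f: "f \<in> Arr CAT" and q: "J_algebra f q"
  shows "\<exists>!p. R_algebra (f, structure_square f p) \<and> p \<odot> alpha_fun po f = q"
proof -
  have qC: "q \<in> Arr CAT" "Src q = J_cat f" "Tgt q = Src f" and qS: "q \<odot> S_fun f = iota (Src f)"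
    and qT: "f \<odot> q = T_fun f"
    and law: "q \<odot> nu_fun f = q \<odot> J_map \<lparr>Sdom = T_fun f, Scod = f, Smap = (q, idf (Tgt f))\<rparr>"
    using q by (simp_all add: J_algebra_def)
  have "\<exists>!p. in_hom CAT p (E_cat po f) (Tgt q) \<and> p \<odot> L_fun po f = idf (Src f) \<and>
      p \<odot> alpha_fun po f = q"
  proof (rule E_mediator[OF f])
    fix a assume "a \<in> Obj (Src f)"
    then show "OMap (idf (Src f)) a = OMap q (OMap (S_fun f) a)"
      using arg_cong[OF qS, of "\<lambda>H. OMap H a"] by (simp del: S_simps(3))
  qed (use f qC in \<open>simp_all add: idf_in_CAT Arr_CAT_iff[THEN iffD1]\<close>)
  then obtain p where p: "p \<in> Arr CAT" "Src p = E_cat po f" "Tgt p = Src f"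
      "p \<odot> L_fun po f = idf (Src f)" and pa: "p \<odot> alpha_fun po f = q"
    and u: "\<And>p'. p' \<in> Arr CAT \<and> Src p' = E_cat po f \<and> Tgt p' = Src f \<and>
      p' \<odot> L_fun po f = idf (Src f) \<and> p' \<odot> alpha_fun po f = q \<Longrightarrow> p' = p"
    unfolding Ex1_def by (auto simp: in_hom_def qC)
  note C = f p(1-3) L_in_CAT alpha_in_CAT R_in_CAT fcomp_in_CAT
  have fp: "f \<odot> p = R_fun po f"
  proof (rule E_eqI[OF f])
    show "(f \<odot> p) \<odot> L_fun po f = R_fun po f \<odot> L_fun po f"
      by (simp add: C fcomp_assoc_CAT p(4) R_L fcomp_idf_CAT)
    show "(f \<odot> p) \<odot> alpha_fun po f = R_fun po f \<odot> alpha_fun po f"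
      by (simp add: C fcomp_assoc_CAT pa R_alpha qT)
  qed (simp_all add: C)
  show ?thesis
  proof (rule ex1I)
    show "R_algebra (f, structure_square f p) \<and> p \<odot> alpha_fun po f = q"
      using mu_law_iff[OF f p fp] law fp f p pa by (simp add: R_algebra_iff)
    fix p' assume "R_algebra (f, structure_square f p') \<and> p' \<odot> alpha_fun po f = q"
    then show "p' = p"
      by (intro u) (auto simp: R_algebra_iff)
  qed
qed

section \<open>The comparison of lenses with algebras, on objects and on morphisms\<close>

definition lens_algebra :: "'u lens \<Rightarrow> 'u small_funct \<times> 'u square" where
  "lens_algebra X = (fst X, structure_square (fst X)
     (THE p. R_algebra (fst X, structure_square (fst X) p) \<and>
        p \<odot> alpha_fun po (fst X) = lens_J (fst X) (snd X)))"

lemma lens_algebra: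
  assumes "is_lens X"
  shows "R_algebra (lens_algebra X)" "fst (lens_algebra X) = fst X"
    "sq_top (snd (lens_algebra X)) \<odot> alpha_fun po (fst X) = lens_J (fst X) (snd X)"
proof -
  have "is_lens (fst X, snd X)"
    using assms by simp
  note J_algebra_R_algebra[OF lensD(1)[OF this] lens_J_algebra(1)[OF this]]
  from theI'[OF this] show "R_algebra (lens_algebra X)" "fst (lens_algebra X) = fst X"
      "sq_top (snd (lens_algebra X)) \<odot> alpha_fun po (fst X) = lens_J (fst X) (snd X)"
    by (simp_all add: lens_algebra_def)
qed

text \<open>The inverse restricts an algebra structure along \<alpha> and reads off the lifts with
  \<open>J_lift\<close>. One composite is the identity because a lens is recovered from its functor,
  the other by uniqueness of the extension along \<alpha>.\<close>

lemma lens_algebra_bij: "bij_betw lens_algebra {X. is_lens X} {Y. R_algebra Y}"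
proof (rule bij_betw_byWitness[where
      f' = "\<lambda>Y. (fst Y, J_lift (fst Y) (sq_top (snd Y) \<odot> alpha_fun po (fst Y)))"])
  show "\<forall>X\<in>{X. is_lens X}. (fst (lens_algebra X), J_lift (fst (lens_algebra X))
      (sq_top (snd (lens_algebra X)) \<odot> alpha_fun po (fst (lens_algebra X)))) = X"
  proof
    fix X :: "'u lens" assume "X \<in> {X. is_lens X}"
    then have "is_lens X" "is_lens (fst X, snd X)"
      by simp_all
    then show "(fst (lens_algebra X), J_lift (fst (lens_algebra X))
        (sq_top (snd (lens_algebra X)) \<odot> alpha_fun po (fst (lens_algebra X)))) = X"
      using lens_algebra(2,3)[of X] lens_J_algebra(2)[of "fst X" "snd X"] by simp
  qed
  have *: "is_lens (f, J_lift f (sq_top a \<odot> alpha_fun po f)) \<and>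
      lens_algebra (f, J_lift f (sq_top a \<odot> alpha_fun po f)) = (f, a)"
    if fa: "R_algebra (f, a)" for f a
  proof -
    have f: "f \<in> Arr CAT"
      using fa by (simp add: R_algebra_iff)
    let ?q = "sq_top a \<odot> alpha_fun po f"
    obtain p where p: "a = structure_square f p"
      using fa by (auto simp: R_algebra_iff)
    note q = R_algebra_J_algebra[OF fa]
    note l = J_algebra_lens[OF f q]
    \<comment> \<open>The given structure \<open>p\<close> itself extends \<open>?q\<close>, so it
      is the extension chosen for the lens obtained from \<open>?q\<close>.\<close>
    have "(THE p. R_algebra (f, structure_square f p) \<and> p \<odot> alpha_fun po f = ?q) = p"
      by (rule the1_equality[OF J_algebra_R_algebra[OF f q]]) (use fa p in simp)
    then show ?thesis
      using l p by (simp add: lens_algebra_def)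
  qed
  show "\<forall>Y\<in>{Y. R_algebra Y}.
      lens_algebra (fst Y, J_lift (fst Y) (sq_top (snd Y) \<odot> alpha_fun po (fst Y))) = Y"
    "(\<lambda>Y. (fst Y, J_lift (fst Y) (sq_top (snd Y) \<odot> alpha_fun po (fst Y)))) ` {Y. R_algebra Y}
      \<subseteq> {X. is_lens X}"
    using *[of "fst _" "snd _"] by (auto simp: prod.collapse)
qed (use lens_algebra(1) in auto)

text \<open>The algebra condition amounts to
  \<open>h \<odot> p = q \<odot> E \<langle>h, k\<rangle>\<close>, an equation out of
  \<open>E f\<close>. Its restriction along \<alpha> is the condition that
  \<open>lens_morphism_iff\<close> identifies with preservation of lifts.\<close>

lemma algebra_morphism_iff:
  assumes X: "is_lens X" and Y: "is_lens Y" and s: "s \<in> Arr CAT2" "Sdom s = fst X" "Scod s = fst Y"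
  shows "Comp CAT2 s (snd (lens_algebra X)) =
      Comp CAT2 (snd (lens_algebra Y)) (AMap (R_functor po) s) \<longleftrightarrow>
    (\<forall>a u. liftable (fst X) a u \<longrightarrow>
       AMap (sq_top s) (snd X a u) = snd Y (OMap (sq_top s) a) (AMap (sq_bot s) u))"
proof -
  define f g h k where "f = fst X" "g = fst Y" "h = sq_top s" "k = sq_bot s"
  note d = this
  have se: "s = \<lparr>Sdom = f, Scod = g, Smap = (h, k)\<rparr>"
    using s(2,3) d by (cases s) simp
  have s': "\<lparr>Sdom = f, Scod = g, Smap = (h, k)\<rparr> \<in> Arr CAT2"
    using s(1) unfolding se .
  have X': "is_lens (f, snd X)" "is_lens (g, snd Y)"
    using X Y d(1,2) by simp_all
  obtain p where p: "snd (lens_algebra X) = structure_square f p" "p \<in> Arr CAT" "Src p = E_cat po f"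
      "Tgt p = Src f" "p \<odot> L_fun po f = idf (Src f)" "p \<odot> alpha_fun po f = lens_J f (snd X)"
    and f: "f \<in> Arr CAT"
    using lens_algebra[OF X] R_algebra_iff[of f "snd (lens_algebra X)"] d
    by (metis fst_conv prod.collapse struct_arrow.select_convs(3))
  obtain q where q: "snd (lens_algebra Y) = structure_square g q" "q \<in> Arr CAT" "Src q = E_cat po g"
      "Tgt q = Src g" "q \<odot> L_fun po g = idf (Src g)" "q \<odot> alpha_fun po g = lens_J g (snd Y)"
    and g: "g \<in> Arr CAT"
    using lens_algebra[OF Y] R_algebra_iff[of g "snd (lens_algebra Y)"] d
    by (metis fst_conv prod.collapse struct_arrow.select_convs(3))
  have hk: "h \<in> Arr CAT" "k \<in> Arr CAT" "Src h = Src f" "Tgt h = Src g" "Src k = Tgt f" "Tgt k = Tgt g"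
    using s d by (simp_all add: Arr_CAT2_iff)
  note E = E_map_in_CAT[OF s(1)] E_map_simps[OF s(1)] E_map_L[OF s(1)] E_map_alpha[OF s(1)]
    J_map_in_CAT[OF s(1)] J_map_simps(1,2)[OF s(1)]
  note E' = E[unfolded s(2,3) d(1,2)[symmetric] d(3)[symmetric]]
  note C = f g p(2-4) q(2-4) hk L_in_CAT alpha_in_CAT fcomp_in_CAT E'(1-3,6-8)
  have "Comp CAT2 s (snd (lens_algebra X)) =
      Comp CAT2 (snd (lens_algebra Y)) (AMap (R_functor po) s) \<longleftrightarrow> h \<odot> p = q \<odot> E_map po s"
    using s(1) by (simp add: p(1) q(1) fcomp_idf_CAT idf_fcomp_CAT hk s(2,3) flip: d)
  also have "\<dots> \<longleftrightarrow> h \<odot> lens_J f (snd X) = lens_J g (snd Y) \<odot> J_map s"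
  proof -
    \<comment> \<open>On the leg \<open>L f\<close> both sides are \<open>h\<close> by the two unit
      laws, so this leg imposes nothing.\<close>
    have "(q \<odot> E_map po s) \<odot> L_fun po f = (q \<odot> L_fun po g) \<odot> h"
      by (simp add: C fcomp_assoc_CAT E'(4))
    then have L: "(h \<odot> p) \<odot> L_fun po f = (q \<odot> E_map po s) \<odot> L_fun po f"
      by (simp add: C fcomp_assoc_CAT p(5) q(5) fcomp_idf_CAT idf_fcomp_CAT)
    have "(q \<odot> E_map po s) \<odot> alpha_fun po f = (q \<odot> alpha_fun po g) \<odot> J_map s"
      by (simp add: C fcomp_assoc_CAT E'(5))
    then have a: "(h \<odot> p) \<odot> alpha_fun po f = h \<odot> lens_J f (snd X)"
        "(q \<odot> E_map po s) \<odot> alpha_fun po f = lens_J g (snd Y) \<odot> J_map s"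
      by (simp_all add: C fcomp_assoc_CAT p(6) q(6))
    show ?thesis
    proof
      assume "h \<odot> p = q \<odot> E_map po s"
      then show "h \<odot> lens_J f (snd X) = lens_J g (snd Y) \<odot> J_map s"
        using a by simp
    next
      assume "h \<odot> lens_J f (snd X) = lens_J g (snd Y) \<odot> J_map s"
      then show "h \<odot> p = q \<odot> E_map po s"
        by (intro E_eqI[OF f _ _ _ _ _ L]) (simp_all add: a C)
    qed
  qed
  also have "\<dots> \<longleftrightarrow> (\<forall>a u. liftable f a u \<longrightarrow> AMap h (snd X a u) = snd Y (OMap h a) (AMap k u))"
    unfolding se by (rule lens_morphism_iff[OF X' s', symmetric])
  finally show ?thesis
    unfolding d .
qed

section \<open>The isomorphism of categories\<close>

lemma isomorphic_Lens_Alg: "isomorphic_categories (Lens :: ('u lens, _) cat) (Alg po)"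
proof -
  define F where "F = \<lparr>Src = Lens, Tgt = Alg po, OMap = restrict lens_algebra (Obj Lens),
     AMap = (\<lambda>s\<in>Arr Lens. \<lparr>Sdom = lens_algebra (Sdom s), Scod = lens_algebra (Scod s),
        Smap = underlying_square s\<rparr>)\<rparr>"
  have F: "Src F = Lens" "Tgt F = Alg po" "\<And>X. is_lens X \<Longrightarrow> OMap F X = lens_algebra X"
    "\<And>s. s \<in> Arr Lens \<Longrightarrow> AMap F s = \<lparr>Sdom = lens_algebra (Sdom s), Scod = lens_algebra (Scod s),
        Smap = underlying_square s\<rparr>"
    by (simp_all add: F_def)
  have Alg: "Obj (Alg po) = {Y. R_algebra Y}" "Dom (Alg po) = Sdom" "Cod (Alg po) = Scod"
    by (simp_all add: Alg_def)
  have CA: "category (Alg po)"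
    unfolding Alg_def by (rule category_algebra_category[OF is_functor_R]) simp_all
  have us: "Sdom (underlying_square s) = fst (Sdom s)" "Scod (underlying_square s) = fst (Scod s)"
      "Smap (underlying_square s) = Smap s" for s :: "('u lens, 'u small_funct \<times> 'u small_funct) struct_arrow"
    by (simp_all add: underlying_square_def)
  \<comment> \<open>Left to right is used for surjectivity on arrows, right to left for
    \<open>F\<close> being well defined.\<close>
  have arr: "\<lparr>Sdom = lens_algebra (Sdom s), Scod = lens_algebra (Scod s), Smap = underlying_square s\<rparr>
      \<in> Arr (Alg po) \<longleftrightarrow> s \<in> Arr Lens" if "is_lens (Sdom s)" "is_lens (Scod s)" for s
  proof (cases "underlying_square s \<in> Arr CAT2")
    case True
    then show ?thesis
      using algebra_morphism_iff[OF that True us(1,2)] that lens_algebra[OF that(1)]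
        lens_algebra[OF that(2)]
      by (simp add: Alg_def Arr_algebra_category Arr_Lens in_hom_def us del: arrow_category_simps)
        (simp add: us)
  qed (simp add: Alg_def Arr_algebra_category Arr_Lens in_hom_def)
  have "is_functor F"
    unfolding is_functor_def F(1,2)
  proof (intro conjI ballI allI impI)
    show "OMap F \<in> Obj Lens \<rightarrow>\<^sub>E Obj (Alg po)" "AMap F \<in> Arr Lens \<rightarrow>\<^sub>E Arr (Alg po)"
      using lens_algebra(1) arr by (auto simp: F_def Alg Arr_Lens[THEN iffD1])
  next
    fix s :: "('u lens, 'u small_funct \<times> 'u small_funct) struct_arrow"
    assume "s \<in> Arr Lens"
    then show "Dom (Alg po) (AMap F s) = OMap F (Dom Lens s)"
        "Cod (Alg po) (AMap F s) = OMap F (Cod Lens s)"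
      using F(3) Arr_Lens[of s] by (simp_all add: F(4) Alg)
  next
    fix X :: "'u lens"
    assume "X \<in> Obj Lens"
    then show "AMap F (Ident Lens X) = Ident (Alg po) (OMap F X)"
      using Ident_in[OF category_Lens, of X] lens_algebra(2)[of X]
      by (simp add: F Alg_def underlying_square_def CAT_Obj_Ident)
  next
    fix s t :: "('u lens, 'u small_funct \<times> 'u small_funct) struct_arrow"
    assume "composable Lens t s"
    then show "AMap F (Comp Lens t s) = Comp (Alg po) (AMap F t) (AMap F s)"
      using Comp_in[OF category_Lens, of t s]
      by (simp add: F Alg_def underlying_square_def composable_def)
  qed (use CA category_Lens in simp_all)
  moreover have "bij_betw (OMap F) (Obj Lens) (Obj (Alg po))"
    using lens_algebra_bij by (simp add: F_def Alg)
  moreover have "bij_betw (AMap F) (Arr Lens) (Arr (Alg po))"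
    unfolding bij_betw_def
  proof
    show "inj_on (AMap F) (Arr Lens)"
    proof (rule inj_onI)
      fix s t :: "('u lens, 'u small_funct \<times> 'u small_funct) struct_arrow"
      assume st: "s \<in> Arr Lens" "t \<in> Arr Lens" "AMap F s = AMap F t"
      then have "Sdom s = Sdom t" "Scod s = Scod t"
        using lens_algebra_bij by (auto simp: F(4) Arr_Lens bij_betw_def dest: inj_onD)
      moreover have "Smap s = Smap t"
        using st by (simp add: F(4) underlying_square_def)
      ultimately show "s = t"
        by (cases s, cases t) simp
    qed
    show "AMap F ` Arr Lens = Arr (Alg po)"
    proof
      show "AMap F ` Arr Lens \<subseteq> Arr (Alg po)"
        using arr by (auto simp: F(4) Arr_Lens[THEN iffD1])
      show "Arr (Alg po) \<subseteq> AMap F ` Arr Lens"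
      proof
        fix t assume t: "t \<in> Arr (Alg po)"
        then have "R_algebra (Sdom t)" "R_algebra (Scod t)"
            and st: "Sdom (Smap t) = fst (Sdom t)" "Scod (Smap t) = fst (Scod t)"
          by (simp_all add: Alg_def Arr_algebra_category in_hom_def)
        moreover have "Z \<in> lens_algebra ` {X. is_lens X}" if "R_algebra Z" for Z
          using lens_algebra_bij that by (simp add: bij_betw_def)
        ultimately obtain X Y where X: "is_lens X" "Sdom t = lens_algebra X"
          and Y: "is_lens Y" "Scod t = lens_algebra Y"
          by blast
        \<comment> \<open>The ends of the square \<open>Smap t\<close> are the functors underlying
          the two algebras, hence those underlying \<open>X\<close> and \<open>Y\<close>; so the
          pair of functors in \<open>t\<close> can be reused unchanged between the two
          lenses.\<close>
        define s where "s = \<lparr>Sdom = X, Scod = Y, Smap = Smap (Smap t)\<rparr>"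
        have e: "\<lparr>Sdom = lens_algebra (Sdom s), Scod = lens_algebra (Scod s),
            Smap = underlying_square s\<rparr> = t"
          using X Y st lens_algebra(2) by (cases t, cases "Smap t") (simp add: s_def underlying_square_def)
        then have "s \<in> Arr Lens"
          using arr[of s] t X(1) Y(1) by (simp add: s_def)
        then show "t \<in> AMap F ` Arr Lens"
          using e F(4)[of s] by force
      qed
    qed
  qed
  ultimately show ?thesis
    using isomorphic_categoriesI[of F] by (simp only: F)
qed

end

theorem theorem23:
  fixes po :: "('u::infinite) po"
  assumes "pushout_choice (CAT :: ('u small_cat, 'u small_funct) cat) po"
  shows "isomorphic_categories (Lens :: ('u lens, _) cat) (Alg po)"
proof -
  interpret chosen_pushouts po
    using assms by unfold_locales
  show ?thesis
    by (rule isomorphic_Lens_Alg)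
qed

end
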